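(* Consider the LPSA iterates described in the context with $\eta_n=\eta_0n^{-\alpha}$, $p_n=\min\{\gamma\eta_n^{\beta},1\}$, where $\gamma>0$, $0<\alpha\le1$, $\beta=1/2$ and $\eta_0>2\cdot\mathbb{1}_{\{\alpha=1\}}/\mu$ (and $\eta_0>0$). Assume: (1) $\|\nabla f(x)-\nabla f(y)\|\le L\|x-y\|$ for all $x,y$; (2) $f$ is $\mu$-strongly convex, $\mu>0$; (3) $\|\nabla^2f(x)-\nabla^2f(y)\|\le\tilde L\|x-y\|$ for all $x,y$; (4) $\|\Sigma(x)-\Sigma(y)\|\le L\|x-y\|$ for all $x,y$; (5) there is $q>2$ with $\sup_n\mathbb{E}\|\xi_n\|^q<\infty$. Put $H=\nabla^2f(x^\star)-\frac{1}{2\eta_0}\mathbb{1}_{\{\alpha=1\}}I_d$ and $$m=\frac1\gamma\big(P_{A^\perp}HP_{A^\perp}\big)^{\dagger}\,P_{A^\perp}\nabla^2f(x^\star)\nabla f(x^\star)$$ ($\dagger$ is the pseudoinverse), and assume $m\neq0$. Then, with $u_n=P_{A^\perp}x_n$, the sequence $\frac{u_n-x^\star}{\sqrt{\eta_{n-1}}}$ converges weakly to the Gaussian distribution $\mathcal N(m,\tilde\Sigma)$, where $\tilde\Sigma$ satisfies the Lyapunov equation $$P_{A^\perp}HP_{A^\perp}\tilde\Sigma+\tilde\Sigma P_{A^\perp}HP_{A^\perp}=P_{A^\perp}\Sigma(x^\star)P_{A^\perp}.$$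
   Context: Setting (LPSA, loopless projected stochastic approximation). Let $A$ be a real matrix with $d$ rows; $P_A$ is the orthogonal projection of $\mathbb{R}^d$ onto the column space of $A$, and $P_{A^\perp}=I_d-P_A$ the orthogonal projection onto the null space of $A^\top$. Let $\mathcal D$ be a probability distribution, $f(x)=\mathbb{E}_{\zeta\sim\mathcal D}f(x,\zeta)$, with $\mathbb{E}_{\zeta\sim\mathcal D}\nabla f(x,\zeta)=\nabla f(x)$ (gradients in $x$). Let $x^\star$ be the unique minimizer of $f$ over $\{x\in\mathbb{R}^d: A^\top x=0\}$. Starting from a deterministic point $x_1$, for $n\ge 1$ sample $\zeta_n\sim\mathcal D$ and $\omega_n\sim\mathrm{Bernoulli}(p_n)$ (all independent), set $x_{n+1/2}=x_n-\eta_n\nabla f(x_n,\zeta_n)$, and set $x_{n+1}=P_{A^\perp}x_{n+1/2}$ if $\omega_n=1$, $x_{n+1}=x_{n+1/2}$ if $\omega_n=0$. The gradient noise is $\xi_n=\nabla f(x_n)-\nabla f(x_n,\zeta_n)$, a martingale difference with respect to $\mathcal F_n=\sigma(\zeta_k,\omega_k:k<n)$, and $\mathbb{E}[\xi_n\xi_n^\top\mid\mathcal F_n]=\Sigma(x_n)$, where $\Sigma(x)$ is the covariance matrix of $\nabla f(x,\zeta)$, $\zeta\sim\mathcal D$. $\|\cdot\|$ is the Euclidean norm for vectors and the spectral norm for matrices. Since $u_n-x^\star$ lies in the null space of $A^\top$, $\tilde\Sigma$ is the positive semidefinite solution of the Lyapunov equation with $P_{A^\perp}\tilde\Sigma=\tilde\Sigma$.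 *)

theory Defs
  imports "HOL-Probability.Probability"
begin

section \<open>Matrices\<close>

text \<open>The library norm on matrices is the Frobenius norm, hence a separate notion.\<close>

definition spectral_norm :: "real^'n^'m \<Rightarrow> real" where
  "spectral_norm M = onorm (\<lambda>v. M *v v)"

definition orthogonal_projection :: "(real^'n) set \<Rightarrow> real^'n^'n" where
  "orthogonal_projection S =
     (THE P. \<forall>x. P *v x \<in> S \<and> (\<forall>y\<in>S. orthogonal (x - P *v x) y))"

lemma orthogonal_projection_unique_exists:
  fixes S :: "(real^'n) set"
  assumes S: "subspace S"
  shows "\<exists>!P::real^'n^'n. \<forall>x. P *v x \<in> S \<and> (\<forall>y\<in>S. orthogonal (x - P *v x) y)"
proof -
  have dec: "\<exists>p. p \<in> S \<and> (\<forall>y\<in>S. orthogonal (x - p) y)" for x :: "real^'n"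
  proof -
    obtain y z where "y \<in> span S" "\<And>w. w \<in> span S \<Longrightarrow> orthogonal z w" "x = y + z"
      using orthogonal_subspace_decomp_exists[of S x] by metis
    then show ?thesis
      using S by (intro exI[of _ y]) (auto simp: span_eq_iff[THEN iffD2])
  qed
  have uniq: "p = q"
    if p: "p \<in> S" "\<forall>y\<in>S. orthogonal (x - p) y" and q: "q \<in> S" "\<forall>y\<in>S. orthogonal (x - q) y"
    for x p q :: "real^'n"
  proof -
    have d: "p - q \<in> S" using S p q by (simp add: subspace_diff)
    have "inner (x - q) (p - q) - inner (x - p) (p - q) = 0"
      using d p(2) q(2) by (simp add: orthogonal_def)
    then have "inner (p - q) (p - q) = 0"
      by (simp add: inner_diff_left)
    then show ?thesis by simp
  qed
  define g where "g x = (SOME p. p \<in> S \<and> (\<forall>y\<in>S. orthogonal (x - p) y))" for x :: "real^'n"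
  have g: "g x \<in> S" "\<forall>y\<in>S. orthogonal (x - g x) y" for x
    using someI_ex[OF dec[of x]] unfolding g_def by auto
  have lin: "linear g"
  proof (rule linearI)
    fix a b
    show "g (a + b) = g a + g b"
    proof (rule uniq[OF g])
      show "g a + g b \<in> S" using S g by (simp add: subspace_add)
      show "\<forall>y\<in>S. orthogonal (a + b - (g a + g b)) y"
        using g(2)[of a] g(2)[of b] by (simp add: orthogonal_def inner_diff_left inner_add_left)
    qed
  next
    fix c :: real and b
    show "g (c *\<^sub>R b) = c *\<^sub>R g b"
    proof (rule uniq[OF g])
      show "c *\<^sub>R g b \<in> S" using S g by (simp add: subspace_mul)
      show "\<forall>y\<in>S. orthogonal (c *\<^sub>R b - c *\<^sub>R g b) y"
        using g(2)[of b] by (simp add: orthogonal_def inner_diff_left)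
    qed
  qed
  have mg: "matrix g *v x = g x" for x
    using lin by (simp add: matrix_works)
  show ?thesis
  proof (rule ex1I[of _ "matrix g"])
    show "\<forall>x. matrix g *v x \<in> S \<and> (\<forall>y\<in>S. orthogonal (x - matrix g *v x) y)"
      using g mg by simp
  next
    fix P :: "real^'n^'n"
    assume "\<forall>x. P *v x \<in> S \<and> (\<forall>y\<in>S. orthogonal (x - P *v x) y)"
    then have "P *v x = matrix g *v x" for x
      using uniq g mg by metis
    then show "P = matrix g"
      by (simp add: matrix_eq)
  qed
qed

definition range_projection :: "real^'k^'d \<Rightarrow> real^'d^'d" where
  "range_projection A = orthogonal_projection (span (columns A))"

definition range_perp_projection :: "real^'k^'d \<Rightarrow> real^'d^'d" where
  "range_perp_projection A = mat 1 - range_projection A"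

text \<open>The Moore--Penrose inverse, through the four Penrose conditions.\<close>

definition is_pseudoinverse :: "real^'n^'m \<Rightarrow> real^'m^'n \<Rightarrow> bool" where
  "is_pseudoinverse M X \<longleftrightarrow>
     M ** X ** M = M \<and> X ** M ** X = X \<and>
     transpose (M ** X) = M ** X \<and> transpose (X ** M) = X ** M"

definition pseudoinverse :: "real^'n^'m \<Rightarrow> real^'m^'n" where
  "pseudoinverse M = (THE X. is_pseudoinverse M X)"

lemma is_pseudoinverse_unique:
  fixes M :: "real^'n^'m"
  assumes X: "is_pseudoinverse M X" and Y: "is_pseudoinverse M Y"
  shows "X = Y"
proof -
  have MX: "M ** X = M ** Y"
  proof -
    have "M ** X = transpose (M ** X)" using X by (simp add: is_pseudoinverse_def)
    also have "\<dots> = transpose ((M ** Y) ** (M ** X))"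
      using Y by (simp add: is_pseudoinverse_def matrix_mul_assoc)
    also have "\<dots> = transpose (M ** X) ** transpose (M ** Y)"
      by (rule matrix_transpose_mul)
    also have "\<dots> = (M ** X) ** (M ** Y)"
      using X Y by (simp add: is_pseudoinverse_def)
    also have "\<dots> = M ** Y"
      using X by (simp add: is_pseudoinverse_def matrix_mul_assoc)
    finally show ?thesis .
  qed
  have XM: "X ** M = Y ** M"
  proof -
    have "X ** M = transpose (X ** M)" using X by (simp add: is_pseudoinverse_def)
    also have "\<dots> = transpose ((X ** M) ** (Y ** M))"
      using Y by (simp add: is_pseudoinverse_def flip: matrix_mul_assoc)
    also have "\<dots> = transpose (Y ** M) ** transpose (X ** M)"
      by (rule matrix_transpose_mul)
    also have "\<dots> = (Y ** M) ** (X ** M)"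
      using X Y by (simp add: is_pseudoinverse_def)
    also have "\<dots> = Y ** M"
      using X by (simp add: is_pseudoinverse_def flip: matrix_mul_assoc)
    finally show ?thesis .
  qed
  have "X = X ** (M ** X)" using X by (simp add: is_pseudoinverse_def matrix_mul_assoc)
  also have "\<dots> = (X ** M) ** Y" by (simp add: MX matrix_mul_assoc)
  also have "\<dots> = Y" using Y by (simp add: XM is_pseudoinverse_def)
  finally show ?thesis .
qed

definition positive_semidefinite :: "real^'n^'n \<Rightarrow> bool" where
  "positive_semidefinite S \<longleftrightarrow> transpose S = S \<and> (\<forall>v. 0 \<le> v \<bullet> (S *v v))"

text \<open>
  The condition \<open>P S = S\<close> singles out the solution supported on the range of \<open>P\<close>; the Lyapunov
  equation itself does not see the block of \<open>S\<close> on the kernel of \<open>P\<close>.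
\<close>

definition projected_lyapunov_solution ::
    "real^'n^'n \<Rightarrow> real^'n^'n \<Rightarrow> real^'n^'n \<Rightarrow> real^'n^'n \<Rightarrow> bool" where
  "projected_lyapunov_solution P H C S \<longleftrightarrow>
     positive_semidefinite S \<and> P ** S = S \<and>
     (P ** H ** P) ** S + S ** (P ** H ** P) = P ** C ** P"

section \<open>Strong convexity\<close>

definition strongly_convex :: "real \<Rightarrow> ('a::real_normed_vector \<Rightarrow> real) \<Rightarrow> bool" where
  "strongly_convex \<mu> f \<longleftrightarrow>
     (\<forall>x y t. 0 \<le> t \<and> t \<le> 1 \<longrightarrow>
        f ((1 - t) *\<^sub>R x + t *\<^sub>R y)
          \<le> (1 - t) * f x + t * f y - \<mu> / 2 * t * (1 - t) * (norm (x - y))\<^sup>2)"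

section \<open>Probability\<close>

definition covariance_matrix :: "'z measure \<Rightarrow> ('z \<Rightarrow> real^'n) \<Rightarrow> real^'n^'n" where
  "covariance_matrix D Y =
     (\<chi> i j. \<integral>z. (Y z - (\<integral>w. Y w \<partial>D)) $ i * (Y z - (\<integral>w. Y w \<partial>D)) $ j \<partial>D)"

text \<open>
  The law of \<open>m + B Z\<close> with \<open>Z\<close> a standard Gaussian vector and \<open>B B\<^sup>T = S\<close>. It does not depend on
  the chosen factor \<open>B\<close>, which exists iff \<open>S\<close> is positive semidefinite; singular \<open>S\<close> is allowed.
\<close>

definition multivariate_normal :: "real^'n \<Rightarrow> real^'n^'n \<Rightarrow> (real^'n) measure" where
  "multivariate_normal m S =
     (let B = (SOME B::real^'n^'n. B ** transpose B = S) in
      distr (\<Pi>\<^sub>M i\<in>(UNIV::'n set). std_normal_distribution) borel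
        (\<lambda>z. m + B *v (\<chi> i. z i)))"

text \<open>The library's \<^const>\<open>weak_conv_m\<close> is confined to measures on the real line.\<close>

definition weakly_converges :: "(nat \<Rightarrow> 'a::topological_space measure) \<Rightarrow> 'a measure \<Rightarrow> bool" where
  "weakly_converges \<mu>s \<mu> \<longleftrightarrow>
     (\<forall>h::'a \<Rightarrow> real. continuous_on UNIV h \<and> bounded (range h) \<longrightarrow>
        (\<lambda>n. \<integral>x. h x \<partial>\<mu>s n) \<longlonglongrightarrow> (\<integral>x. h x \<partial>\<mu>))"

section \<open>The algorithm\<close>

text \<open>
  The driving randomness: \<open>\<zeta> n \<sim> D\<close> and \<open>\<omega> n \<sim> Bernoulli (p n)\<close> for \<open>n \<ge> 1\<close>, all of these
  variables being jointly independent. Since the two families have different value spaces,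
  the independence is that of the generated sigma-algebras, as in the definition
  of \<^const>\<open>prob_space.indep_vars\<close>.
\<close>

definition lpsa_samples ::
    "'w measure \<Rightarrow> 'z measure \<Rightarrow> (nat \<Rightarrow> real) \<Rightarrow> (nat \<Rightarrow> 'w \<Rightarrow> 'z) \<Rightarrow> (nat \<Rightarrow> 'w \<Rightarrow> bool) \<Rightarrow> bool" where
  "lpsa_samples M D p \<zeta> \<omega> \<longleftrightarrow>
     (\<forall>n\<ge>1. \<zeta> n \<in> measurable M D \<and> distr M D (\<zeta> n) = D) \<and>
     (\<forall>n\<ge>1. \<omega> n \<in> measurable M (count_space UNIV) \<and>
        distr M (count_space UNIV) (\<omega> n) = measure_pmf (bernoulli_pmf (p n))) \<and>
     prob_space.indep_sets M
       (\<lambda>i. case i of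
          Inl n \<Rightarrow> {\<zeta> n -` B \<inter> space M | B. B \<in> sets D}
        | Inr n \<Rightarrow> {\<omega> n -` B \<inter> space M | B. B \<in> sets (count_space UNIV)})
       ({1..} <+> {1..})"

text \<open>
  \<open>Q\<close> is the projection applied in the projection steps and \<open>g\<close> the stochastic gradient.
  Iterates are indexed from 1; \<open>x 0\<close> is irrelevant.
\<close>

definition lpsa_iterates ::
    "'w measure \<Rightarrow> real^'d^'d \<Rightarrow> (real^'d \<Rightarrow> 'z \<Rightarrow> real^'d) \<Rightarrow> (nat \<Rightarrow> real) \<Rightarrow>
     (nat \<Rightarrow> 'w \<Rightarrow> 'z) \<Rightarrow> (nat \<Rightarrow> 'w \<Rightarrow> bool) \<Rightarrow> real^'d \<Rightarrow> (nat \<Rightarrow> 'w \<Rightarrow> real^'d) \<Rightarrow> bool" where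
  "lpsa_iterates M Q g \<eta> \<zeta> \<omega> x1 x \<longleftrightarrow>
     (\<forall>s\<in>space M. x 1 s = x1 \<and>
       (\<forall>n\<ge>1. let x_half = x n s - \<eta> n *\<^sub>R g (x n s) (\<zeta> n s)
          in x (Suc n) s = (if \<omega> n s then Q *v x_half else x_half)))"

end

theory Submission
  imports Defs "HOL-Real_Asymp.Real_Asymp"
begin

text \<open>
  Split the iterate into its component \<open>u\<^sub>n = P x\<^sub>n\<close> in the constraint space and the orthogonal component
  \<open>v\<^sub>n\<close>. The two live on different time scales. The orthogonal component is pushed by
  \<open>- \<eta>\<^sub>n \<nabla>f(x\<^sup>\<star>)\<close> at every step and reset to zero at rate \<open>p\<^sub>n = \<gamma> sqrt \<eta>\<^sub>n\<close>, so it is of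
  size \<open>sqrt \<eta>\<^sub>n\<close> with mean close to \<open>- sqrt \<eta>\<^sub>n \<nabla>f(x\<^sup>\<star>) / \<gamma>\<close>, and it forgets its past after
  \<open>1 / p\<^sub>n\<close> steps. The component \<open>u\<^sub>n\<close> moves on the longer scale \<open>1 / \<eta>\<^sub>n\<close>; it therefore sees
  \<open>v\<^sub>n\<close> only through its mean, and \<open>(u\<^sub>n - x\<^sup>\<star>) / sqrt \<eta>\<^sub>n\<^sub>-\<^sub>1\<close> behaves like a linear recursion with
  drift \<open>- P H P\<close>, constant input \<open>P \<nabla>\<^sup>2f(x\<^sup>\<star>) \<nabla>f(x\<^sup>\<star>) / \<gamma>\<close> and noise covariance
  \<open>P \<Sigma>(x\<^sup>\<star>) P\<close>. Its stationary law is \<open>N(m, \<Sigma>~)\<close>; the shift by \<open>1 / (2 \<eta>\<^sub>0)\<close> in \<open>H\<close> comes from the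
  growth of the normalisation when \<open>\<alpha> = 1\<close>.

  Four steps make this precise.

  First, \<open>E |u\<^sub>n - x\<^sup>\<star>|\<^sup>2\<close> and \<open>E |v\<^sub>n|\<^sup>2\<close> are \<open>O(\<eta>\<^sub>n)\<close>: strong monotonicity of the gradient
  and the resets give a coupled pair of contracting inequalities (\<open>second_moments\<close>, \<open>coupled_recursion_bound\<close>).

  Second, the averaging of \<open>v\<^sub>n\<close> is carried out by a corrector. The resets make
  \<open>p\<^sub>n v\<^sub>n\<close> equal to \<open>v\<^sub>n - E(v\<^sub>n\<^sub>+\<^sub>1 | x\<^sub>n)\<close> up to the push, so subtracting
  \<open>(\<eta>\<^sub>n / p\<^sub>n) P \<nabla>\<^sup>2f(x\<^sup>\<star>) v\<^sub>n\<close> from \<open>u\<^sub>n - x\<^sup>\<star>\<close> turns the fluctuations of \<open>v\<^sub>n\<close> into a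
  telescoping term and a martingale difference that is negligible against the gradient noise
  (\<open>corrected_step\<close>, \<open>remainder_negligible\<close>, \<open>reset_noise_moment\<close>).

  Third, the characteristic function \<open>\<phi>\<^sub>n\<close> of the corrected and normalised error satisfies, by a second-order
  expansion, a one-step recursion with error \<open>o(\<eta>\<^sub>n) |t|\<close>, and the characteristic function of the claimed Gaussian
  law satisfies the same recursion, because of the Lyapunov equation
  (\<open>char_one_step_uniform\<close>, \<open>gaussian_one_step\<close>). One step replaces \<open>t\<close> by
  \<open>t - \<eta>\<^sub>n P H P t\<close>, which is shorter by a factor \<open>1 - (\<mu> / 2) \<eta>\<^sub>n\<close> for \<open>t\<close> in the constraint space.
  Hence the distance \<open>sup |\<phi>\<^sub>n(t) - \<phi>(t)| / |t|\<close> over a ball contracts up to an error \<open>o(\<eta>\<^sub>n)\<close>, and since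
  the step sizes are not summable it tends to zero (\<open>char_tendsto_range\<close>). The division by \<open>|t|\<close> is what turns the
  shortening of \<open>t\<close> into a contraction of this distance.

  Fourth, pointwise convergence of characteristic functions and bounded first moments give weak convergence in any
  dimension (\<open>weakly_convergesI_characteristic_function\<close>).

  The step from \<open>x\<^sub>n\<close> to \<open>x\<^sub>n\<^sub>+\<^sub>1\<close> uses \<open>\<zeta>\<^sub>n\<close> and \<open>\<omega>\<^sub>n\<close>, which are independent of
  \<open>x\<^sub>n\<close>; the conditional expectations are therefore integrals over these two samples (\<open>expectation_step\<close>).
\<close>


section \<open>Positive semidefinite matrices\<close>

lemma inner_matrix_vector_transpose:
  fixes B :: "real^'n^'m"
  shows "(B *v x) \<bullet> y = x \<bullet> (transpose B *v y)"
  by (metis dot_lmul_matrix inner_commute transpose_matrix_vector)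

lemma inner_matrix_vector_symmetric:
  fixes B :: "real^'n^'n"
  assumes "transpose B = B"
  shows "(B *v x) \<bullet> y = x \<bullet> (B *v y)"
  using inner_matrix_vector_transpose[of B x y] assms by simp

lemma norm_matrix_vector_mult_le_spectral_norm:
  fixes B :: "real^'n^'m"
  shows "norm (B *v v) \<le> spectral_norm B * norm v"
  unfolding spectral_norm_def
  by (rule onorm) (rule matrix_vector_mul_bounded_linear)

text \<open>
  At a zero of a nonnegative quadratic form the form is minimal, so its derivative \<open>2 S v\<close> vanishes; the proof
  moves from \<open>v\<close> in the direction \<open>S v\<close>.
\<close>

lemma positive_semidefinite_null:
  fixes S :: "real^'n^'n"
  assumes S: "positive_semidefinite S" and v: "v \<bullet> (S *v v) = 0"
  shows "S *v v = 0"
proof -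
  have sym: "transpose S = S" and pos: "\<And>w. 0 \<le> w \<bullet> (S *v w)"
    using S by (auto simp: positive_semidefinite_def)
  define w where "w = S *v v"
  define c where "c = w \<bullet> (S *v w)"
  define a where "a = w \<bullet> w"
  have vw: "v \<bullet> (S *v w) = a" unfolding a_def w_def
    by (metis inner_matrix_vector_symmetric sym)
  have "0 \<le> 2 * t * a + t\<^sup>2 * c" for t
  proof -
    have "0 \<le> (v + t *\<^sub>R w) \<bullet> (S *v (v + t *\<^sub>R w))" using pos by simp
    also have "\<dots> = 2 * t * a + t\<^sup>2 * c"
      using v vw by (simp add: matrix_vector_right_distrib inner_simps matrix_vector_mult_scaleR
          c_def power2_eq_square algebra_simps) (simp add: w_def a_def)
    finally show ?thesis .
  qed
  note q = this
  have c0: "c \<ge> 0" using pos c_def by simp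
  have a0: "a \<ge> 0" by (simp add: a_def)
  have "a = 0"
  proof (rule ccontr)
    assume "a \<noteq> 0"
    then have a: "a > 0" using a0 by simp
    have "0 \<le> 2 * (- (a / (c + 1))) * a + (- (a / (c + 1)))\<^sup>2 * c" by (rule q)
    also have "\<dots> = (a\<^sup>2 / (c+1)) * (c / (c + 1) - 2)"
    proof -
      have "c + 1 \<noteq> 0" using c0 by simp
      then show ?thesis by (simp add: divide_simps) (simp add: algebra_simps power2_eq_square)
    qed
    also have "\<dots> < 0"
      using a c0 by (intro mult_pos_neg) (simp_all add: field_simps)
    finally show False by simp
  qed
  then show ?thesis by (simp add: a_def w_def)
qed

text \<open>
  Cholesky elimination: subtracting \<open>b b\<^sup>T\<close>, with \<open>b\<close> the normalised column of a coordinate, clears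
  that row and column and leaves the matrix positive semidefinite. Induction is over the set of coordinates that are
  not yet cleared, and column \<open>a\<close> of the factor stores the vector \<open>b\<close> of coordinate \<open>a\<close>.
\<close>

lemma positive_semidefinite_factorization:
  fixes S :: "real^'n^'n"
  assumes "positive_semidefinite S"
  shows "\<exists>B::real^'n^'n. B ** transpose B = S"
proof -
  have "\<exists>B::real^'n^'n. B ** transpose B = S \<and> (\<forall>i k. k \<notin> I \<longrightarrow> B $ i $ k = 0)"
    if "finite I" "positive_semidefinite S" "\<And>i j. i \<notin> I \<Longrightarrow> S $ i $ j = 0" for I and S :: "real^'n^'n"
    using that
  proof (induction I arbitrary: S rule: finite_induct)
    case empty
    then have "S = 0" by (simp add: vec_eq_iff)
    then show ?case by (intro exI[of _ 0]) (simp add: matrix_matrix_mult_def vec_eq_iff)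
  next
    case (insert a I S)
    have sym: "S $ i $ j = S $ j $ i" for i j
      using insert.prems(1) by (auto simp: positive_semidefinite_def transpose_def vec_eq_iff)
    have pos: "0 \<le> v \<bullet> (S *v v)" for v using insert.prems(1) by (simp add: positive_semidefinite_def)
    have tS: "transpose S = S" using insert.prems(1) by (simp add: positive_semidefinite_def)
    define e where "e = (axis a 1 :: real^'n)"
    have Se: "(S *v e) $ i = S $ i $ a" for i
      by (simp add: e_def matrix_vector_mult_basis column_def)
    have eSe: "e \<bullet> (S *v e) = S $ a $ a"
      by (simp add: e_def inner_axis' Se[unfolded e_def])
    show ?case
    proof (cases "S $ a $ a = 0")
      case True
      then have "S *v e = 0" using positive_semidefinite_null[OF insert.prems(1)] eSe by simp
      then have "S $ i $ a = 0" for i using Se[of i] by simp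
      then have "S $ a $ j = 0" for j using sym by metis
      then have "\<And>i j. i \<notin> I \<Longrightarrow> S $ i $ j = 0" using insert.prems(2) by (metis insertE)
      then obtain B where "B ** transpose B = S" "\<forall>i k. k \<notin> I \<longrightarrow> B $ i $ k = 0"
        using insert.IH[OF insert.prems(1)] by blast
      then show ?thesis by (intro exI[of _ B]) auto
    next
      case False
      then have s0: "S $ a $ a > 0" using pos[of e] eSe by simp
      define s where "s = S $ a $ a"
      have s: "s > 0" using s0 s_def by simp
      define b where "b = (\<chi> i. S $ i $ a / sqrt s)"
      define S' where "S' = (\<chi> i j. S $ i $ j - b $ i * b $ j)"
      have bb: "b $ i * b $ j = S $ i $ a * S $ j $ a / s" for i j
        using s by (simp add: b_def)
      have S'v: "v \<bullet> (S' *v v) = v \<bullet> (S *v v) - (v \<bullet> b)\<^sup>2" for v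
      proof -
        have "v \<bullet> (S' *v v) = (\<Sum>i\<in>UNIV. \<Sum>j\<in>UNIV. v $ i * (S $ i $ j - b $ i * b $ j) * v $ j)"
          by (simp add: inner_vec_def matrix_vector_mult_def S'_def sum_distrib_left mult.assoc)
        also have "\<dots> = (\<Sum>i\<in>UNIV. \<Sum>j\<in>UNIV. v $ i * S $ i $ j * v $ j)
            - (\<Sum>i\<in>UNIV. \<Sum>j\<in>UNIV. (v $ i * b $ i) * (v $ j * b $ j))"
          by (simp add: algebra_simps sum_subtractf)
        also have "(\<Sum>i\<in>UNIV. \<Sum>j\<in>UNIV. v $ i * S $ i $ j * v $ j) = v \<bullet> (S *v v)"
          by (simp add: inner_vec_def matrix_vector_mult_def sum_distrib_left mult.assoc)
        also have "(\<Sum>i\<in>UNIV. \<Sum>j\<in>UNIV. (v $ i * b $ i) * (v $ j * b $ j)) = (v \<bullet> b)\<^sup>2"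
          by (simp add: inner_vec_def power2_eq_square sum_product)
        finally show ?thesis .
      qed
      have psd: "positive_semidefinite S'"
        unfolding positive_semidefinite_def
      proof (intro conjI allI)
        show "transpose S' = S'"
          unfolding S'_def transpose_def vec_eq_iff using sym by (simp add: mult.commute)
        fix v
        have vb: "v \<bullet> b = (v \<bullet> (S *v e)) / sqrt s"
          by (simp add: inner_vec_def b_def Se sum_divide_distrib)
        define t where "t = - (v \<bullet> (S *v e)) / s"
        have ev: "e \<bullet> (S *v v) = v \<bullet> (S *v e)"
          using inner_matrix_vector_symmetric[OF tS, of e v] by (simp add: inner_commute)
        have "0 \<le> (v + t *\<^sub>R e) \<bullet> (S *v (v + t *\<^sub>R e))" by (rule pos)
        also have "\<dots> = v \<bullet> (S *v v) + 2 * t * (v \<bullet> (S *v e)) + t\<^sup>2 * s"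
          using eSe ev by (simp add: matrix_vector_right_distrib inner_simps matrix_vector_mult_scaleR
             s_def power2_eq_square algebra_simps)
        also have "\<dots> = v \<bullet> (S *v v) - (v \<bullet> (S *v e))\<^sup>2 / s"
          using s by (simp add: t_def field_simps power2_eq_square)
        also have "\<dots> = v \<bullet> (S' *v v)"
          using s by (simp add: S'v vb power_divide)
        finally show "0 \<le> v \<bullet> (S' *v v)" .
      qed
      have "S' $ i $ j = 0" if "i \<notin> I" for i j
      proof (cases "i = a")
        case True
        then show ?thesis using s sym[of a j] by (simp add: S'_def bb) (simp add: s_def)
      next
        case False
        then have "i \<notin> insert a I" using that by simp
        then have "\<And>j. S $ i $ j = 0" using insert.prems(2) by blast
        then show ?thesis by (simp add: S'_def bb)
      qed
      then obtain B where B: "B ** transpose B = S'" "\<forall>i k. k \<notin> I \<longrightarrow> B $ i $ k = 0"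
        using insert.IH[OF psd] by blast
      define B' where "B' = (\<chi> i k. if k = a then b $ i else B $ i $ k)"
      have "(B' ** transpose B') $ i $ j = S $ i $ j" for i j
      proof -
        have "(B' ** transpose B') $ i $ j = (\<Sum>k\<in>UNIV. B' $ i $ k * B' $ j $ k)"
          by (simp add: matrix_matrix_mult_def transpose_def)
        also have "\<dots> = b $ i * b $ j + (\<Sum>k\<in>UNIV - {a}. B $ i $ k * B $ j $ k)"
          by (subst sum.remove[of _ a]) (auto simp: B'_def intro!: sum.cong)
        also have "(\<Sum>k\<in>UNIV - {a}. B $ i $ k * B $ j $ k) = (\<Sum>k\<in>UNIV. B $ i $ k * B $ j $ k)"
          using B(2) insert.hyps by (intro sum.mono_neutral_left) auto
        also have "\<dots> = (B ** transpose B) $ i $ j"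
          by (simp add: matrix_matrix_mult_def transpose_def)
        also have "\<dots> = S $ i $ j - b $ i * b $ j" by (simp add: B(1) S'_def)
        finally show ?thesis by simp
      qed
      then have "B' ** transpose B' = S" by (simp add: vec_eq_iff)
      moreover have "\<forall>i k. k \<notin> insert a I \<longrightarrow> B' $ i $ k = 0"
        using B(2) by (auto simp: B'_def)
      ultimately show ?thesis by blast
    qed
  qed
  from this[of UNIV S] assms show ?thesis by auto
qed

section \<open>Orthogonal projections and Hessians\<close>

lemma subspace_projection:
  fixes S :: "(real^'n) set"
  assumes S: "subspace S"
  defines "R \<equiv> orthogonal_projection S"
  shows "R *v x \<in> S" "y \<in> S \<Longrightarrow> (x - R *v x) \<bullet> y = 0"
proof -
  have "\<forall>x. R *v x \<in> S \<and> (\<forall>y\<in>S. orthogonal (x - R *v x) y)"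
    unfolding R_def orthogonal_projection_def
    by (rule theI'[OF orthogonal_projection_unique_exists[OF S]])
  then show "R *v x \<in> S" "y \<in> S \<Longrightarrow> (x - R *v x) \<bullet> y = 0"
    by (auto simp: orthogonal_def)
qed

lemma transpose_eqI_inner:
  fixes B :: "real^'n^'n"
  assumes "\<And>x y. (B *v x) \<bullet> y = x \<bullet> (B *v y)"
  shows "transpose B = B"
proof -
  have "x \<bullet> (transpose B *v y) = x \<bullet> (B *v y)" for x y
    using assms[of x y] inner_matrix_vector_transpose[of B x y] by simp
  then have "transpose B *v y = B *v y" for y
    by (metis vector_eq_rdot inner_commute)
  then show ?thesis by (simp add: matrix_eq)
qed

lemma
  fixes A :: "real^'k^'d"
  defines "P \<equiv> range_perp_projection A"
  shows range_perp_projection_symmetric: "transpose P = P"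
    and range_perp_projection_idempotent: "P *v (P *v x) = P *v x"
    and range_perp_projection_fixes_iff: "P *v x = x \<longleftrightarrow> transpose A *v x = 0"
proof -
  define S where "S = span (columns A)"
  define R where "R = orthogonal_projection S"
  have Sub: "subspace S" by (simp add: S_def)
  note R = subspace_projection[OF Sub, folded R_def]
  have P: "P *v x = x - R *v x" for x
    by (simp add: P_def range_perp_projection_def range_projection_def R_def S_def
        matrix_vector_mult_diff_rdistrib)
  have RR: "(R *v x) \<bullet> y = x \<bullet> (R *v y)" for x y
    using R(2)[OF R(1)[of x], of y] R(2)[OF R(1)[of y], of x]
    by (simp add: inner_diff_left) (metis inner_commute)
  have tR: "transpose R = R"
    using RR by (rule transpose_eqI_inner)
  show "transpose P = P"
    by (rule transpose_eqI_inner) (simp add: P inner_simps RR)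
  have fixed: "R *v y = y" if "y \<in> S" for y
  proof -
    have "y - R *v y \<in> S" using that R(1) Sub by (simp add: subspace_diff)
    then have "(y - R *v y) \<bullet> (y - R *v y) = 0" using R(2) by blast
    then show ?thesis by simp
  qed
  show "P *v (P *v x) = P *v x" for x
    using fixed[OF R(1)[of x]] by (simp add: P matrix_vector_mult_diff_distrib)
  show "P *v x = x \<longleftrightarrow> transpose A *v x = 0" for x
  proof
    assume "P *v x = x"
    then have "R *v x = 0" by (simp add: P)
    then have "x \<bullet> y = 0" if "y \<in> S" for y using R(2)[OF that, of x] by simp
    moreover have "column k A \<in> S" for k
      unfolding S_def by (rule span_base) (auto simp: columns_def)
    ultimately have "x \<bullet> column k A = 0" for k by blast
    then show "transpose A *v x = 0"
      by (simp add: vec_eq_iff matrix_vector_mult_def transpose_def column_def inner_vec_def mult.commute)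
  next
    assume "transpose A *v x = 0"
    then have "x \<bullet> column k A = 0" for k
      by (simp add: vec_eq_iff matrix_vector_mult_def transpose_def column_def inner_vec_def mult.commute)
    then have c: "y \<in> columns A \<Longrightarrow> orthogonal x y" for y
      by (auto simp: columns_def orthogonal_def)
    then have "orthogonal x y" if "y \<in> S" for y
      using that unfolding S_def by (meson orthogonal_to_span)
    then have "x \<bullet> (R *v x) = 0" using R(1) by (auto simp: orthogonal_def)
    moreover have "x \<bullet> (R *v x) = (R *v x) \<bullet> (R *v x)"
      using R(2)[OF R(1)[of x], of x] by (simp add: inner_diff_left)
    ultimately show "P *v x = x" by (simp add: P)
  qed
qed

lemma lipschitz_derivative_linearization:
  fixes gf :: "real^'d \<Rightarrow> real^'d" and hess :: "real^'d \<Rightarrow> real^'d^'d"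
  assumes hess: "\<And>x. (gf has_derivative (\<lambda>h. hess x *v h)) (at x)"
    and lip: "\<And>x y. spectral_norm (hess x - hess y) \<le> K * norm (x - y)" and K: "K \<ge> 0"
  shows "norm (gf y - gf z - hess x *v (y - z)) \<le> norm (y - z) * (K * (norm (z - x) + norm (y - z)))"
proof -
  define g where "g w = gf w - hess x *v w" for w
  have "norm (g y - g z) \<le> norm (y - z) * (K * (norm (z - x) + norm (y - z)))"
  proof (rule differentiable_bound_general[where a = 0 and b = 1 and f = "\<lambda>t. g (z + t *\<^sub>R (y - z))"
        and \<phi> = "\<lambda>t. t * (norm (y - z) * (K * (norm (z - x) + norm (y - z))))"
        and f' = "\<lambda>t. (hess (z + t *\<^sub>R (y - z)) - hess x) *v (y - z)"
        and \<phi>' = "\<lambda>t. norm (y - z) * (K * (norm (z - x) + norm (y - z)))", simplified])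
    have gd: "(g has_derivative (\<lambda>h. (hess w - hess x) *v h)) (at w)" for w
      unfolding g_def matrix_vector_mult_diff_rdistrib
      by (intro has_derivative_diff hess bounded_linear.has_derivative[OF matrix_vector_mul_bounded_linear]
          has_derivative_ident)
    have d: "((\<lambda>t. g (z + t *\<^sub>R (y - z))) has_vector_derivative
        (hess (z + t *\<^sub>R (y - z)) - hess x) *v (y - z)) (at t)" for t
    proof -
      have "((\<lambda>t. g (z + t *\<^sub>R (y - z))) has_derivative
          (\<lambda>h. (hess (z + t *\<^sub>R (y - z)) - hess x) *v (h *\<^sub>R (y - z)))) (at t)"
        by (rule has_derivative_compose[OF _ gd]) (auto intro!: derivative_eq_intros)
      then show ?thesis by (simp add: has_vector_derivative_def matrix_vector_mult_scaleR)
    qed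
    then show "\<And>t. 0 < t \<Longrightarrow> t < 1 \<Longrightarrow> ((\<lambda>t. g (z + t *\<^sub>R (y - z))) has_vector_derivative
        (hess (z + t *\<^sub>R (y - z)) - hess x) *v (y - z)) (at t)" by blast
    show "continuous_on {0..1} (\<lambda>t. g (z + t *\<^sub>R (y - z)))"
      using d by (meson has_vector_derivative_continuous continuous_at_imp_continuous_on)
    fix t :: real assume t: "0 < t" "t < 1"
    have "norm ((hess (z + t *\<^sub>R (y - z)) - hess x) *v (y - z))
        \<le> spectral_norm (hess (z + t *\<^sub>R (y - z)) - hess x) * norm (y - z)"
      by (rule norm_matrix_vector_mult_le_spectral_norm)
    also have "\<dots> \<le> (K * (norm (z - x) + norm (y - z))) * norm (y - z)"
    proof (intro mult_right_mono order_trans[OF lip] mult_left_mono K norm_ge_zero)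
      have "norm (z + t *\<^sub>R (y - z) - x) \<le> norm (z - x) + norm (t *\<^sub>R (y - z))"
        using norm_triangle_ineq[of "z - x" "t *\<^sub>R (y - z)"] by (simp add: algebra_simps)
      also have "norm (t *\<^sub>R (y - z)) \<le> norm (y - z)"
        using t by (simp add: mult_left_le_one_le)
      finally show "norm (z + t *\<^sub>R (y - z) - x) \<le> norm (z - x) + norm (y - z)" by simp
    qed
    finally show "norm ((hess (z + t *\<^sub>R (y - z)) - hess x) *v (y - z))
       \<le> norm (y - z) * (K * (norm (z - x) + norm (y - z)))" by (simp add: mult.commute)
  qed (auto intro!: continuous_intros derivative_eq_intros)
  then show ?thesis by (simp add: g_def matrix_vector_mult_diff_distrib algebra_simps)
qed

text \<open>
  The second difference of \<open>f\<close> over a parallelogram is symmetric in its two sides. By the mean value theorem along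
  one side, divided by \<open>s\<^sup>2\<close> it tends to the bilinear form of the Hessian.
\<close>

lemma lipschitz_hessian_symmetric:
  fixes f :: "real^'d \<Rightarrow> real" and gf :: "real^'d \<Rightarrow> real^'d" and hess :: "real^'d \<Rightarrow> real^'d^'d"
  assumes gf: "\<And>x. GDERIV f x :> gf x"
    and hess: "\<And>x. (gf has_derivative (\<lambda>h. hess x *v h)) (at x)"
    and lip: "\<And>x y. spectral_norm (hess x - hess y) \<le> K * norm (x - y)" and K: "K \<ge> 0"
  shows "transpose (hess x) = hess x"
proof -
  define T where "T h k s = f (x + s *\<^sub>R h + s *\<^sub>R k) - f (x + s *\<^sub>R h) - f (x + s *\<^sub>R k) + f x" for h k s
  have fd: "(f has_derivative (\<lambda>h. h \<bullet> gf y)) (at y)" for y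
    using gf by (simp add: gderiv_def)
  have bound: "\<bar>T h k s / s\<^sup>2 - (hess x *v k) \<bullet> h\<bar> \<le> s * (norm k * (K * (norm h + norm k)) * norm h)"
    if s: "s > 0" for h k s
  proof -
    define \<psi> where "\<psi> \<tau> = f (x + \<tau> *\<^sub>R h + s *\<^sub>R k) - f (x + \<tau> *\<^sub>R h)" for \<tau>
    have d: "(\<psi> has_real_derivative (gf (x + \<tau> *\<^sub>R h + s *\<^sub>R k) - gf (x + \<tau> *\<^sub>R h)) \<bullet> h) (at \<tau>)" for \<tau>
    proof -
      have "(\<psi> has_derivative (\<lambda>u. (u *\<^sub>R h) \<bullet> gf (x + \<tau> *\<^sub>R h + s *\<^sub>R k) - (u *\<^sub>R h) \<bullet> gf (x + \<tau> *\<^sub>R h))) (at \<tau>)"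
        unfolding \<psi>_def
        by (intro has_derivative_diff; rule has_derivative_compose[OF _ fd])
           (auto intro!: derivative_eq_intros)
      moreover have "(\<lambda>u. (u *\<^sub>R h) \<bullet> gf (x + \<tau> *\<^sub>R h + s *\<^sub>R k) - (u *\<^sub>R h) \<bullet> gf (x + \<tau> *\<^sub>R h))
          = (*) ((gf (x + \<tau> *\<^sub>R h + s *\<^sub>R k) - gf (x + \<tau> *\<^sub>R h)) \<bullet> h)"
        by (auto simp: fun_eq_iff inner_diff_left inner_commute algebra_simps)
      ultimately show ?thesis
        by (simp add: has_field_derivative_def)
    qed
    obtain \<tau> where \<tau>: "0 < \<tau>" "\<tau> < s"
      "\<psi> s - \<psi> 0 = (s - 0) * ((gf (x + \<tau> *\<^sub>R h + s *\<^sub>R k) - gf (x + \<tau> *\<^sub>R h)) \<bullet> h)"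
      using MVT2[OF s, of \<psi> "\<lambda>\<tau>. (gf (x + \<tau> *\<^sub>R h + s *\<^sub>R k) - gf (x + \<tau> *\<^sub>R h)) \<bullet> h"] d by blast
    define e where "e = gf (x + \<tau> *\<^sub>R h + s *\<^sub>R k) - gf (x + \<tau> *\<^sub>R h) - hess x *v (s *\<^sub>R k)"
    have "norm e \<le> norm (s *\<^sub>R k) * (K * (norm (\<tau> *\<^sub>R h) + norm (s *\<^sub>R k)))"
      using lipschitz_derivative_linearization[OF hess lip K, of "x + \<tau> *\<^sub>R h + s *\<^sub>R k" "x + \<tau> *\<^sub>R h" x]
      by (simp add: e_def)
    also have "\<dots> \<le> norm (s *\<^sub>R k) * (K * (norm (s *\<^sub>R h) + norm (s *\<^sub>R k)))"
      using \<tau> s K by (intro mult_left_mono add_right_mono) (auto intro!: mult_right_mono)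
    also have "\<dots> = s\<^sup>2 * (norm k * (K * (norm h + norm k)))"
      using s by (simp add: power2_eq_square algebra_simps)
    finally have e: "norm e \<le> s\<^sup>2 * (norm k * (K * (norm h + norm k)))" .
    have "T h k s = s * ((e + s *\<^sub>R (hess x *v k)) \<bullet> h)"
      using \<tau>(3) by (simp add: T_def \<psi>_def e_def matrix_vector_mult_scaleR algebra_simps)
    then have "T h k s / s\<^sup>2 - (hess x *v k) \<bullet> h = (e \<bullet> h) / s"
      using s by (simp add: inner_add_left power2_eq_square field_simps)
    also have "\<bar>\<dots>\<bar> \<le> (norm e * norm h) / s"
      using s by (simp add: abs_divide divide_right_mono Cauchy_Schwarz_ineq2)
    also have "\<dots> \<le> (s\<^sup>2 * (norm k * (K * (norm h + norm k))) * norm h) / s"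
      using e s by (intro divide_right_mono mult_right_mono) auto
    also have "\<dots> = s * (norm k * (K * (norm h + norm k)) * norm h)"
      using s by (simp add: power2_eq_square)
    finally show ?thesis .
  qed
  have lim: "((\<lambda>s. T h k s / s\<^sup>2) \<longlongrightarrow> (hess x *v k) \<bullet> h) (at_right 0)" for h k
  proof (rule Lim_transform2[OF tendsto_const])
    have "((\<lambda>s. (hess x *v k) \<bullet> h - T h k s / s\<^sup>2) \<longlongrightarrow> 0) (at_right 0)"
    proof (rule Lim_null_comparison)
      show "\<forall>\<^sub>F s in at_right 0. norm ((hess x *v k) \<bullet> h - T h k s / s\<^sup>2)
          \<le> s * (norm k * (K * (norm h + norm k)) * norm h)"
        unfolding eventually_at_right_field
        using bound by (intro exI[of _ 1]) (auto simp: abs_minus_commute)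
      show "((\<lambda>s. s * (norm k * (K * (norm h + norm k)) * norm h)) \<longlongrightarrow> 0) (at_right 0)"
        by (auto intro!: tendsto_eq_intros)
    qed
    then show "((\<lambda>s. (hess x *v k) \<bullet> h - T h k s / s\<^sup>2) \<longlongrightarrow> 0) (at_right 0)" .
  qed
  have "(hess x *v k) \<bullet> h = k \<bullet> (hess x *v h)" for h k
  proof -
    have "T h k = T k h" by (simp add: T_def fun_eq_iff algebra_simps)
    then have "(hess x *v k) \<bullet> h = (hess x *v h) \<bullet> k"
      using tendsto_unique[OF _ lim[of h k] ] lim[of k h] by auto
    then show ?thesis by (simp add: inner_commute)
  qed
  then show ?thesis by (rule transpose_eqI_inner)
qed

section \<open>The Lyapunov equation\<close>

lemma matrix_sub_ldistrib: "A ** (B - C) = A ** B - A ** (C::real^'n^'m)"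
  by (simp add: matrix_matrix_mult_def vec_eq_iff algebra_simps sum_subtractf)

lemma matrix_sub_rdistrib: "(A - B) ** C = A ** C - B ** (C::real^'n^'m)"
  by (simp add: matrix_matrix_mult_def vec_eq_iff algebra_simps sum_subtractf)

lemma matrix_add_rdistrib: "(A + B) ** C = A ** C + B ** (C::real^'n^'m)"
  by (simp add: matrix_matrix_mult_def vec_eq_iff algebra_simps sum.distrib)

lemma norm_matrix_squared_columns:
  "inner (S::real^'n^'n) S = (\<Sum>j\<in>UNIV. inner (column j S) (column j S))"
proof -
  have "inner S S = (\<Sum>i\<in>UNIV. \<Sum>j\<in>UNIV. S $ i $ j * S $ i $ j)"
    by (simp add: inner_vec_def)
  also have "\<dots> = (\<Sum>j\<in>UNIV. \<Sum>i\<in>UNIV. S $ i $ j * S $ i $ j)" by (rule sum.swap)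
  finally show ?thesis by (simp add: inner_vec_def column_def)
qed

text \<open>
  Pair the equation with \<open>S\<close> in the Frobenius inner product: \<open>N S\<close> contributes the form of \<open>N\<close> on the columns
  of \<open>S\<close> and \<open>S N\<close> the form on its rows.
\<close>

lemma lyapunov_operator_injective:
  fixes N S :: "real^'n^'n"
  assumes sym: "transpose N = N" and c: "c > 0" and N: "\<And>v. v \<bullet> (N *v v) \<ge> c * (v \<bullet> v)"
    and eq: "N ** S + S ** N = 0"
  shows "S = 0"
proof -
  have "inner S (N ** S) = (\<Sum>i\<in>UNIV. \<Sum>j\<in>UNIV. S $ i $ j * (N ** S) $ i $ j)"
    by (simp add: inner_vec_def)
  also have "\<dots> = (\<Sum>j\<in>UNIV. \<Sum>i\<in>UNIV. S $ i $ j * (N ** S) $ i $ j)" by (rule sum.swap)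
  also have "\<dots> = (\<Sum>j\<in>UNIV. column j S \<bullet> (N *v column j S))"
    by (simp add: inner_vec_def column_def matrix_matrix_mult_def matrix_vector_mult_def)
  also have "\<dots> \<ge> (\<Sum>j\<in>UNIV. c * (column j S \<bullet> column j S))"
    by (rule sum_mono) (rule N)
  finally have 1: "inner S (N ** S) \<ge> c * inner S S"
    by (simp add: norm_matrix_squared_columns sum_distrib_left)
  have N_sym: "N $ k $ j = N $ j $ k" for j k
    using sym by (metis transpose_def vec_lambda_beta)
  have "inner S (S ** N) = (\<Sum>i\<in>UNIV. (S $ i) \<bullet> (N *v (S $ i)))"
    by (simp add: inner_vec_def matrix_matrix_mult_def matrix_vector_mult_def)
       (simp add: N_sym mult.commute)
  also have "\<dots> \<ge> (\<Sum>i\<in>UNIV. c * ((S $ i) \<bullet> (S $ i)))"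
    by (rule sum_mono) (rule N)
  finally have 2: "inner S (S ** N) \<ge> c * inner S S"
    by (simp add: inner_vec_def[of S] sum_distrib_left)
  have "inner S (N ** S) + inner S (S ** N) = 0"
    using eq by (metis inner_add_right inner_zero_right)
  then have "c * inner S S \<le> 0" using 1 2 by linarith
  then have "inner S S \<le> 0" using c by (simp add: mult_le_0_iff)
  then show ?thesis by (metis inner_eq_zero_iff inner_ge_zero order_antisym)
qed

text \<open>
  A minimiser \<open>v\<close> of the quadratic form on the unit sphere, with minimum \<open>l\<close>, is a null vector of the positive
  semidefinite matrix \<open>S - l I\<close>.
\<close>

lemma symmetric_matrix_minimal_eigenvector:
  fixes S :: "real^'n^'n"
  assumes sym: "transpose S = S"
  obtains v l where "norm v = 1" "S *v v = l *\<^sub>R v" "\<And>w. w \<bullet> (S *v w) \<ge> l * (w \<bullet> w)"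
proof -
  have cont: "continuous_on (sphere 0 1) (\<lambda>w. w \<bullet> (S *v w))"
    by (intro continuous_intros linear_continuous_on matrix_vector_mul_bounded_linear)
  have "sphere (0::real^'n) 1 \<noteq> {}" by simp
  then obtain v where v: "v \<in> sphere 0 1" "\<forall>w\<in>sphere 0 1. v \<bullet> (S *v v) \<le> w \<bullet> (S *v w)"
    using continuous_attains_inf[OF compact_sphere _ cont] by blast
  define l where "l = v \<bullet> (S *v v)"
  have low: "w \<bullet> (S *v w) \<ge> l * (w \<bullet> w)" for w
  proof (cases "w = 0")
    case False
    define u where "u = (1 / norm w) *\<^sub>R w"
    have "u \<in> sphere 0 1" using False by (simp add: u_def)
    then have "l \<le> u \<bullet> (S *v u)" using v(2) l_def by blast
    also have "u \<bullet> (S *v u) = (w \<bullet> (S *v w)) / (w \<bullet> w)"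
      by (simp add: u_def matrix_vector_mult_scaleR flip: power2_norm_eq_inner power2_eq_square)
    finally show ?thesis using False by (simp add: pos_le_divide_eq)
  qed simp
  define R where "R = S - l *\<^sub>R mat 1"
  have Rw: "R *v w = S *v w - l *\<^sub>R w" for w
    by (simp add: R_def matrix_vector_mult_diff_rdistrib flip: scaleR_matrix_vector_assoc)
  have "transpose R = R"
    by (rule transpose_eqI_inner) (simp add: Rw inner_simps inner_matrix_vector_symmetric[OF sym])
  then have "positive_semidefinite R"
    using low by (simp add: positive_semidefinite_def Rw inner_simps)
  moreover have "v \<bullet> (R *v v) = 0"
    using v(1) by (simp add: Rw inner_simps l_def norm_eq_sqrt_inner)
  ultimately have "R *v v = 0" by (rule positive_semidefinite_null)
  then have "S *v v = l *\<^sub>R v" by (simp add: Rw)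
  moreover have "norm v = 1" using v(1) by simp
  ultimately show ?thesis using low that by blast
qed

text \<open>
  Evaluated at an eigenvector of the smallest eigenvalue \<open>l\<close> of \<open>S\<close>, the equation reads
  \<open>2 l (v \<bullet> N v) = v \<bullet> C v \<ge> 0\<close>, so \<open>l \<ge> 0\<close>.
\<close>

lemma lyapunov_solution_positive:
  fixes N S C :: "real^'n^'n"
  assumes S: "transpose S = S" and c: "c > 0" and N: "\<And>v. v \<bullet> (N *v v) \<ge> c * (v \<bullet> v)" "transpose N = N"
    and C: "\<And>v. v \<bullet> (C *v v) \<ge> 0" and eq: "N ** S + S ** N = C"
  shows "positive_semidefinite S"
proof -
  obtain v l where v: "norm v = 1" "S *v v = l *\<^sub>R v" and low: "\<And>w. w \<bullet> (S *v w) \<ge> l * (w \<bullet> w)"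
    using symmetric_matrix_minimal_eigenvector[OF S] by blast
  have "v \<bullet> (C *v v) = v \<bullet> (N *v (S *v v)) + v \<bullet> (S *v (N *v v))"
    by (simp add: eq[symmetric] matrix_vector_mult_add_rdistrib inner_simps matrix_vector_mul_assoc)
  also have "v \<bullet> (S *v (N *v v)) = (S *v v) \<bullet> (N *v v)"
    by (simp add: inner_matrix_vector_symmetric[OF S])
  finally have "v \<bullet> (C *v v) = 2 * l * (v \<bullet> (N *v v))"
    by (simp add: v matrix_vector_mult_scaleR)
  then have "0 \<le> l * (v \<bullet> (N *v v))" using C[of v] by simp
  moreover have "v \<bullet> (N *v v) > 0" using N(1)[of v] c v(1) by (simp add: norm_eq_sqrt_inner)
  ultimately have "l \<ge> 0" by (simp add: zero_le_mult_iff)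
  then have "w \<bullet> (S *v w) \<ge> 0" for w
    using low[of w] by (meson inner_ge_zero mult_nonneg_nonneg order_trans)
  then show ?thesis using S by (simp add: positive_semidefinite_def)
qed

text \<open>
  Adding \<open>I - P\<close> to \<open>P H P\<close> gives a positive definite \<open>N\<close>, for which the Lyapunov operator is injective on all
  matrices and hence bijective. As \<open>N\<close> commutes with \<open>I - P\<close> and the right-hand side is annihilated by \<open>I - P\<close>,
  the solution is supported on the range of \<open>P\<close>, where \<open>N\<close> and \<open>P H P\<close> agree.
\<close>

lemma projected_lyapunov_solution_exists_unique:
  fixes P H C :: "real^'n^'n"
  assumes P: "transpose P = P" "P ** P = P" and H: "transpose H = H"
    and c: "c > 0" and pos: "\<And>v. P *v v = v \<Longrightarrow> v \<bullet> (H *v v) \<ge> c * (v \<bullet> v)"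
    and C: "positive_semidefinite C"
  shows "\<exists>!S. projected_lyapunov_solution P H C S"
proof -
  define M where "M = P ** H ** P"
  define Q where "Q = mat 1 - P"
  define N where "N = M + Q"
  define K where "K = P ** C ** P"
  have tM: "transpose M = M" and tQ: "transpose Q = Q"
  proof -
    show "transpose M = M" by (simp add: M_def matrix_transpose_mul P(1) H matrix_mul_assoc)
    have "P $ i $ j = P $ j $ i" for i j using P(1) by (metis transpose_def vec_lambda_beta)
    then show "transpose Q = Q" by (simp add: Q_def transpose_def vec_eq_iff mat_def eq_commute)
  qed
  have tN: "transpose N = N"
    using tM tQ by (simp add: N_def transpose_def vec_eq_iff)
  have PQ: "P ** Q = 0" "Q ** P = 0"
    by (simp_all add: Q_def matrix_sub_ldistrib matrix_sub_rdistrib P(2))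
  have QM: "Q ** M = 0" "M ** Q = 0" "P ** M = M" "M ** P = M"
    by (simp_all add: M_def PQ P(2) matrix_mul_assoc) (simp_all add: PQ P(2) flip: matrix_mul_assoc)
  have PP: "P *v (P *v v) = P *v v" for v
    by (simp add: matrix_vector_mul_assoc P(2))
  have Nv: "v \<bullet> (N *v v) \<ge> min c 1 * (v \<bullet> v)" for v
  proof -
    have o: "(P *v v) \<bullet> (Q *v v) = 0"
      by (simp add: inner_matrix_vector_symmetric[OF P(1)] matrix_vector_mul_assoc PQ)
    have s: "v = P *v v + Q *v v" by (simp add: Q_def matrix_vector_mult_diff_rdistrib)
    have "v \<bullet> v = (P *v v) \<bullet> (P *v v) + (Q *v v) \<bullet> (Q *v v)"
      by (subst (1 2) s) (simp add: inner_simps o inner_commute[of "Q *v v" "P *v v"])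
    moreover have "v \<bullet> (M *v v) = (P *v v) \<bullet> (H *v (P *v v))"
      by (simp add: M_def inner_matrix_vector_symmetric[OF P(1)] flip: matrix_vector_mul_assoc)
    moreover have "v \<bullet> (Q *v v) = (Q *v v) \<bullet> (Q *v v)"
      using o by (subst (1) s) (simp add: inner_simps)
    moreover have "(P *v v) \<bullet> (H *v (P *v v)) \<ge> c * ((P *v v) \<bullet> (P *v v))"
      using pos PP by blast
    moreover have "c * ((P *v v) \<bullet> (P *v v)) \<ge> min c 1 * ((P *v v) \<bullet> (P *v v))"
      "1 * ((Q *v v) \<bullet> (Q *v v)) \<ge> min c 1 * ((Q *v v) \<bullet> (Q *v v))"
      by (rule mult_right_mono; simp)+
    ultimately show ?thesis
      by (simp add: N_def matrix_vector_mult_add_rdistrib inner_simps algebra_simps)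
  qed
  have c': "min c 1 > 0" using c by simp
  define Ly where "Ly S = N ** S + S ** N" for S
  have lin: "linear Ly"
  proof (rule linearI)
    show "Ly (S + T) = Ly S + Ly T" for S T
      by (simp add: Ly_def matrix_add_ldistrib matrix_add_rdistrib)
    show "Ly (k *\<^sub>R S) = k *\<^sub>R Ly S" for k S
      by (simp add: Ly_def matrix_scalar_ac scaleR_add_right flip: scalar_matrix_assoc)
  qed
  have inj: "inj Ly"
    unfolding linear_injective_0[OF lin]
  proof (intro allI impI)
    fix S assume "Ly S = 0"
    then show "S = 0" unfolding Ly_def by (rule lyapunov_operator_injective[OF tN c' Nv])
  qed
  then have "surj Ly" by (rule linear_injective_imp_surjective[OF lin]) simp
  from surjD[OF this, of K] obtain S where "K = Ly S" ..
  then have S: "N ** S + S ** N = K" by (simp add: Ly_def)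
  have uniq: "S' = T" if "N ** S' + S' ** N = N ** T + T ** N" for S' T
    using injD[OF inj, of S' T] that by (simp add: Ly_def)
  have tC: "transpose C = C" using C by (simp add: positive_semidefinite_def)
  have tK: "transpose K = K" by (simp add: K_def matrix_transpose_mul P tC matrix_mul_assoc)
  have tadd: "transpose (X + Y) = transpose X + transpose Y" for X Y :: "real^'n^'n"
    by (simp add: transpose_def vec_eq_iff)
  have tS: "transpose S = S"
  proof (rule uniq)
    have "transpose K = N ** transpose S + transpose S ** N"
      by (simp add: S[symmetric] tadd matrix_transpose_mul tN add.commute)
    then show "N ** transpose S + transpose S ** N = N ** S + S ** N"
      by (simp add: tK S)
  qed
  have QN: "Q ** N = N ** Q" using QM PQ
    by (simp add: N_def matrix_add_ldistrib matrix_add_rdistrib)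
  have QK: "Q ** K = 0" by (simp add: K_def PQ matrix_mul_assoc)
  have QS: "Q ** S = 0"
  proof (rule lyapunov_operator_injective[OF tN c' Nv])
    have "N ** (Q ** S) + (Q ** S) ** N = Q ** (N ** S + S ** N)"
      by (simp add: matrix_add_ldistrib matrix_mul_assoc QN)
    then show "N ** (Q ** S) + (Q ** S) ** N = 0" by (simp add: S QK)
  qed
  have PS: "P ** S = S" using QS by (simp add: Q_def matrix_sub_rdistrib)
  have red: "N ** T + T ** N = M ** T + T ** M" if "P ** T = T" "transpose T = T" for T
  proof -
    have QT: "Q ** T = 0" using that(1) by (simp add: Q_def matrix_sub_rdistrib)
    have "transpose (Q ** T) = 0" by (simp add: QT transpose_def vec_eq_iff)
    then have "T ** Q = 0" by (simp add: matrix_transpose_mul that tQ)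
    with QT show ?thesis by (simp add: N_def matrix_add_ldistrib matrix_add_rdistrib)
  qed
  have Kpos: "v \<bullet> (K *v v) \<ge> 0" for v
  proof -
    have "v \<bullet> (K *v v) = (P *v v) \<bullet> (C *v (P *v v))"
      by (simp add: K_def inner_matrix_vector_symmetric[OF P(1)] flip: matrix_vector_mul_assoc)
    then show ?thesis using C by (simp add: positive_semidefinite_def)
  qed
  show ?thesis
  proof (rule ex1I[of _ S])
    show "projected_lyapunov_solution P H C S"
      unfolding projected_lyapunov_solution_def
      using lyapunov_solution_positive[OF tS c' Nv tN Kpos S] PS red[OF PS tS] S
      by (simp add: M_def K_def)
    fix T assume "projected_lyapunov_solution P H C T"
    then have "P ** T = T" "transpose T = T" "M ** T + T ** M = K"
      by (auto simp: projected_lyapunov_solution_def positive_semidefinite_def M_def K_def)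
    then show "T = S" using uniq[of T S] red[of T] S by simp
  qed
qed

section \<open>Characteristic functions of Gaussian vectors\<close>

lemma char_multivariate_normal:
  fixes mm :: "real^'d" and S :: "real^'d^'d"
  assumes S: "positive_semidefinite S"
  shows "prob_space (multivariate_normal mm S)" "sets (multivariate_normal mm S) = sets borel"
    "(\<integral>y. cis (t \<bullet> y) \<partial>multivariate_normal mm S)
      = cis (t \<bullet> mm) * of_real (exp (- (t \<bullet> (S *v t)) / 2))"
proof -
  define B where "B = (SOME B::real^'d^'d. B ** transpose B = S)"
  have B: "B ** transpose B = S"
    unfolding B_def by (rule someI_ex) (rule positive_semidefinite_factorization[OF S])
  define PM where "PM = (\<Pi>\<^sub>M i\<in>(UNIV::'d set). std_normal_distribution)"
  define X where "X z = mm + B *v (\<chi> i. z i)" for z :: "'d \<Rightarrow> real"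
  have G: "multivariate_normal mm S = distr PM borel X"
    by (simp add: multivariate_normal_def B_def PM_def X_def[abs_def] Let_def)
  interpret sn: prob_space std_normal_distribution
    by (rule prob_space_normal_density) simp
  interpret pp: product_prob_space "\<lambda>i::'d. std_normal_distribution" UNIV by unfold_locales
  interpret pi: prob_space PM
    unfolding PM_def by (rule prob_space_PiM) (rule sn.prob_space_axioms) 
  have comp: "(\<lambda>z. z i) \<in> borel_measurable PM" for i
    using measurable_component_singleton[of i UNIV "\<lambda>i::'d. std_normal_distribution"]
    unfolding PM_def by (simp add: measurable_cong_sets[OF refl, of std_normal_distribution borel])
  have vecm: "(\<lambda>z. \<chi> i. z i) \<in> borel_measurable PM"
    by (auto simp: borel_measurable_euclidean_space[of "\<lambda>z. \<chi> i. z i"] Basis_vec_def inner_axis comp)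
  have Xm: "X \<in> borel_measurable PM"
    unfolding X_def
    by (intro borel_measurable_add borel_measurable_const
        borel_measurable_continuous_on[OF _ vecm] linear_continuous_on matrix_vector_mul_bounded_linear)
  show "prob_space (multivariate_normal mm S)" unfolding G by (rule pi.prob_space_distr[OF Xm])
  show "sets (multivariate_normal mm S) = sets borel" by (simp add: G)
  have cism: "(\<lambda>y. cis (t \<bullet> y)) \<in> borel_measurable borel" for t :: "real^'d"
    unfolding cis_conv_exp by (intro borel_measurable_continuous_onI continuous_intros)
  define w where "w = transpose B *v t"
  have tX: "cis (t \<bullet> X z) = cis (t \<bullet> mm) * (\<Prod>i\<in>UNIV. iexp (w $ i * z i))" for z
  proof -
    have "t \<bullet> X z = t \<bullet> mm + w \<bullet> (\<chi> i. z i)"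
      by (simp add: X_def inner_add_right w_def inner_commute[of t] inner_matrix_vector_transpose)
         (simp add: inner_commute)
    also have "w \<bullet> (\<chi> i. z i) = (\<Sum>i\<in>UNIV. w $ i * z i)" by (simp add: inner_vec_def)
    finally show ?thesis
      by (simp add: cis_conv_exp exp_add[symmetric] distrib_left sum_distrib_left exp_sum[symmetric])
  qed
  have one: "(\<integral>y. iexp (a * y) \<partial>std_normal_distribution) = of_real (exp (- a\<^sup>2 / 2))" for a
    using char_std_normal_distribution unfolding char_def by (metis)
  have int1: "integrable std_normal_distribution (\<lambda>y. iexp (a * y))" for a
    by (rule sn.integrable_const_bound[of _ 1])
       (auto simp: intro!: borel_measurable_continuous_onI continuous_intros)
  have "(\<integral>y. cis (t \<bullet> y) \<partial>multivariate_normal mm S) = (\<integral>z. cis (t \<bullet> X z) \<partial>PM)"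
    unfolding G by (rule integral_distr[OF Xm cism])
  also have "\<dots> = cis (t \<bullet> mm) * (\<integral>z. (\<Prod>i\<in>UNIV. iexp (w $ i * z i)) \<partial>PM)"
    by (simp add: tX)
  also have "(\<integral>z. (\<Prod>i\<in>UNIV. iexp (w $ i * z i)) \<partial>PM) = (\<Prod>i\<in>UNIV. \<integral>y. iexp (w $ i * y) \<partial>std_normal_distribution)"
    unfolding PM_def by (rule pp.product_integral_prod) (use int1 in auto)
  also have "\<dots> = of_real (exp (- (w \<bullet> w) / 2))"
    unfolding one
    by (simp add: inner_vec_def power2_eq_square sum_negf sum_divide_distrib exp_sum[symmetric] flip: of_real_prod)
  also have "w \<bullet> w = t \<bullet> (S *v t)"
  proof -
    have "w \<bullet> w = t \<bullet> (B *v w)" unfolding w_def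
      using inner_matrix_vector_transpose[of B "transpose B *v t" t] by (simp add: inner_commute)
    then show ?thesis
      by (simp add: w_def matrix_vector_mul_assoc B del: transpose_matrix_vector)
  qed
  finally show "(\<integral>y. cis (t \<bullet> y) \<partial>multivariate_normal mm S)
      = cis (t \<bullet> mm) * of_real (exp (- (t \<bullet> (S *v t)) / 2))" .
qed

section \<open>Weak convergence from characteristic functions\<close>

text \<open>
  The real functions whose integrals are determined by the characteristic function. The product formulas for sine
  and cosine make them an algebra.
\<close>

inductive_set trigonometric_polynomials :: "('a::real_inner \<Rightarrow> real) set" where
  const: "(\<lambda>_. c) \<in> trigonometric_polynomials"
| cos: "(\<lambda>x. cos (k \<bullet> x)) \<in> trigonometric_polynomials"
| sin: "(\<lambda>x. sin (k \<bullet> x)) \<in> trigonometric_polynomials"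
| add: "f \<in> trigonometric_polynomials \<Longrightarrow> g \<in> trigonometric_polynomials \<Longrightarrow>
    (\<lambda>x. f x + g x) \<in> trigonometric_polynomials"
| scale: "f \<in> trigonometric_polynomials \<Longrightarrow> (\<lambda>x. c * f x) \<in> trigonometric_polynomials"

lemma trigonometric_polynomials_mult:
  fixes f g :: "'a::real_inner \<Rightarrow> real"
  assumes "f \<in> trigonometric_polynomials" "g \<in> trigonometric_polynomials"
  shows "(\<lambda>x. f x * g x) \<in> trigonometric_polynomials"
  using assms(1)
proof induction
  case (const c)
  then show ?case using assms(2) by (rule trigonometric_polynomials.scale)
next
  case (cos k)
  show ?case using assms(2)
  proof induction
    case (const c)
    have "(\<lambda>x. cos (k \<bullet> x) * c) = (\<lambda>x. c * cos (k \<bullet> x))" by (simp add: mult.commute)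
    then show ?case by (simp add: trigonometric_polynomials.intros)
  next
    case (cos l)
    have "(\<lambda>x. cos (k \<bullet> x) * cos (l \<bullet> x)) = (\<lambda>x. (1/2) * (cos ((k - l) \<bullet> x) + cos ((k + l) \<bullet> x)))"
      by (simp add: cos_times_cos inner_diff_left inner_add_left fun_eq_iff)
    then show ?case by (simp only: trigonometric_polynomials.intros)
  next
    case (sin l)
    have "(\<lambda>x. cos (k \<bullet> x) * sin (l \<bullet> x)) = (\<lambda>x. (1/2) * (sin ((k + l) \<bullet> x) + (-1) * sin ((k - l) \<bullet> x)))"
      by (simp add: cos_times_sin inner_diff_left inner_add_left fun_eq_iff)
    then show ?case by (simp only: trigonometric_polynomials.intros)
  next
    case (add f g)
    from add.IH show ?case unfolding distrib_left by (rule trigonometric_polynomials.add)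
  next
    case (scale f c)
    from scale.IH show ?case unfolding mult.left_commute[of _ c] by (rule trigonometric_polynomials.scale)
  qed
next
  case (sin k)
  show ?case using assms(2)
  proof induction
    case (const c)
    have "(\<lambda>x. sin (k \<bullet> x) * c) = (\<lambda>x. c * sin (k \<bullet> x))" by (simp add: mult.commute)
    then show ?case by (simp add: trigonometric_polynomials.intros)
  next
    case (cos l)
    have "(\<lambda>x. sin (k \<bullet> x) * cos (l \<bullet> x)) = (\<lambda>x. (1/2) * (sin ((k + l) \<bullet> x) + sin ((k - l) \<bullet> x)))"
      by (simp add: sin_times_cos inner_diff_left inner_add_left fun_eq_iff)
    then show ?case by (simp only: trigonometric_polynomials.intros)
  next
    case (sin l)
    have "(\<lambda>x. sin (k \<bullet> x) * sin (l \<bullet> x)) = (\<lambda>x. (1/2) * (cos ((k - l) \<bullet> x) + (-1) * cos ((k + l) \<bullet> x)))"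
      by (simp add: sin_times_sin inner_diff_left inner_add_left fun_eq_iff)
    then show ?case by (simp only: trigonometric_polynomials.intros)
  next
    case (add f g)
    from add.IH show ?case unfolding distrib_left by (rule trigonometric_polynomials.add)
  next
    case (scale f c)
    from scale.IH show ?case unfolding mult.left_commute[of _ c] by (rule trigonometric_polynomials.scale)
  qed
next
  case (add f1 f2)
  from add.IH show ?case unfolding distrib_right by (rule trigonometric_polynomials.add)
next
  case (scale f c)
  from scale.IH show ?case unfolding mult.assoc by (rule trigonometric_polynomials.scale)
qed

lemma trigonometric_polynomials_continuous:
  assumes "f \<in> trigonometric_polynomials"
  shows "continuous_on UNIV f"
  using assms by induction (auto intro!: continuous_intros)

lemma trigonometric_polynomials_bounded:
  assumes "f \<in> trigonometric_polynomials"
  shows "\<exists>B. \<forall>x. \<bar>f x\<bar> \<le> B"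
  using assms
proof induction
  case (cos k)
  show ?case by (intro exI[of _ 1]) auto
next
  case (sin k)
  show ?case by (intro exI[of _ 1]) auto
next
  case (add f g)
  then obtain B C where "\<forall>x. \<bar>f x\<bar> \<le> B" "\<forall>x. \<bar>g x\<bar> \<le> C" by blast
  then show ?case by (intro exI[of _ "B + C"] allI order_trans[OF abs_triangle_ineq] add_mono) auto
next
  case (scale f c)
  then obtain B where "\<forall>x. \<bar>f x\<bar> \<le> B" by blast
  then show ?case by (intro exI[of _ "\<bar>c\<bar> * B"]) (auto simp: abs_mult intro: mult_left_mono)
qed auto

text \<open>
  Extend the function periodically from a large box; the extension lives on a torus,
  where the trigonometric polynomials are dense by Stone--Weierstrass.
\<close>

lemma trigonometric_approximation:
  fixes h :: "real^'d \<Rightarrow> real"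
  assumes h: "continuous_on UNIV h" and B: "\<And>x. \<bar>h x\<bar> \<le> B" and R: "R > 0" and e: "e > 0"
  obtains T where "T \<in> trigonometric_polynomials" "\<And>x. norm x \<le> R \<Longrightarrow> \<bar>T x - h x\<bar> < e"
    "\<And>x. \<bar>T x\<bar> \<le> B + e"
proof -
  \<comment> \<open>The scale is such that the ball of radius \<open>R\<close> corresponds to arguments of modulus at most \<open>pi / 4\<close>
    and the cutoff vanishes before the modulus reaches \<open>pi / 2\<close>, away from the discontinuity of \<open>Arg\<close>.\<close>
  define s where "s = 4 * R / pi"
  have s: "s > 0" using R by (simp add: s_def)
  define K where "K = {w::complex^'d. \<forall>i. norm (w $ i) = 1}"
  define E where "E x = (\<chi> i. cis (x $ i / s))" for x :: "real^'d"
  define \<theta> where "\<theta> w = (\<chi> i. s * Arg (w $ i))" for w :: "complex^'d"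
  define ch where "ch x = max 0 (min 1 (2 - norm x / R))" for x :: "real^'d"
  define g where "g w = ch (\<theta> w) * h (\<theta> w)" for w
  \<comment> \<open>functions on the torus that are trigonometric polynomials in the angles\<close>
  define Rg where "Rg = {f. continuous_on K f \<and> (\<lambda>x. f (E x)) \<in> trigonometric_polynomials}"
  have EK: "E x \<in> K" for x by (simp add: E_def K_def)
  have compK: "compact K"
  proof -
    have "closed K"
      unfolding K_def by (intro closed_Collect_all closed_Collect_eq continuous_intros)
    moreover have "bounded K"
      unfolding bounded_iff
    proof (intro exI ballI)
      fix w assume "w \<in> K"
      have "norm w \<le> (\<Sum>i\<in>UNIV. norm (w $ i))" unfolding norm_vec_def by (rule L2_set_le_sum) simp
      also have "\<dots> = real CARD('d)" using \<open>w \<in> K\<close> by (simp add: K_def)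
      finally show "norm w \<le> real CARD('d)" .
    qed
    ultimately show ?thesis by (simp add: compact_eq_bounded_closed)
  qed
  have inner_axis: "axis i (1 / s) \<bullet> x = x $ i / s" for i and x :: "real^'d"
    by (simp add: inner_axis')
  interpret function_ring_on Rg K
  proof
    show "compact K" by (rule compK)
    show "f \<in> Rg \<Longrightarrow> continuous_on K f" for f by (simp add: Rg_def)
    show "f \<in> Rg \<Longrightarrow> g \<in> Rg \<Longrightarrow> (\<lambda>x. f x + g x) \<in> Rg" for f g
      by (simp add: Rg_def trigonometric_polynomials.add continuous_on_add)
    show "f \<in> Rg \<Longrightarrow> g \<in> Rg \<Longrightarrow> (\<lambda>x. f x * g x) \<in> Rg" for f g
      by (simp add: Rg_def trigonometric_polynomials_mult continuous_on_mult)
    show "(\<lambda>_. c) \<in> Rg" for c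
      by (simp add: Rg_def trigonometric_polynomials.const)
    fix w z assume "w \<in> K" "z \<in> K" "w \<noteq> z"
    then obtain i where i: "w $ i \<noteq> z $ i" by (auto simp: vec_eq_iff)
    have "(\<lambda>w. Re (w $ i)) \<in> Rg"
      using trigonometric_polynomials.cos[of "axis i (1/s) :: real^'d"]
      by (simp add: Rg_def E_def inner_axis continuous_intros)
    moreover have "(\<lambda>w. Im (w $ i)) \<in> Rg"
      using trigonometric_polynomials.sin[of "axis i (1/s) :: real^'d"]
      by (simp add: Rg_def E_def inner_axis continuous_intros)
    ultimately show "\<exists>f\<in>Rg. f w \<noteq> f z" using i complex_eq_iff by metis
  qed
  have chi01: "0 \<le> ch x" "ch x \<le> 1" for x by (auto simp: ch_def)
  have chi_cont: "continuous_on UNIV ch"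
    unfolding ch_def by (intro continuous_intros) (use R in auto)
  have gB: "\<bar>g w\<bar> \<le> B" for w
  proof -
    have "\<bar>g w\<bar> = ch (\<theta> w) * \<bar>h (\<theta> w)\<bar>" using chi01 by (simp add: g_def abs_mult)
    also have "\<dots> \<le> 1 * \<bar>h (\<theta> w)\<bar>" using chi01 by (intro mult_right_mono) auto
    finally show ?thesis using B[of "\<theta> w"] by linarith
  qed
  have g0: "g w = 0" if "pi / 2 \<le> \<bar>Arg (w $ i)\<bar>" for w i
  proof -
    have "2 * R = s * (pi / 2)" by (simp add: s_def)
    also have "\<dots> \<le> s * \<bar>Arg (w $ i)\<bar>" using that s by (intro mult_left_mono) auto
    also have "\<dots> = \<bar>\<theta> w $ i\<bar>" using s by (simp add: \<theta>_def abs_mult)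
    also have "\<dots> \<le> norm (\<theta> w)" by (rule component_le_norm_cart)
    finally have "2 \<le> norm (\<theta> w) / R" using R by (simp add: pos_le_divide_eq)
    then show ?thesis by (simp add: g_def ch_def)
  qed
  have "continuous_on K g"
  proof (rule continuous_at_imp_continuous_on, rule ballI)
    fix w assume w: "w \<in> K"
    show "isCont g w"
    proof (cases "\<exists>i. Re (w $ i) < 0")
      case True
      then obtain i where i: "Re (w $ i) < 0" by blast
      have "open {z::complex^'d. Re (z $ i) < 0}"
        by (intro open_Collect_less continuous_intros)
      moreover have "g z = 0" if "z \<in> {z. Re (z $ i) < 0}" for z
      proof (rule g0)
        show "pi / 2 \<le> \<bar>Arg (z $ i)\<bar>"
        proof -
          have z: "Re (z $ i) < 0" "z $ i \<noteq> 0" using that by auto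
          then have "\<not> \<bar>Im (Ln (z $ i))\<bar> \<le> pi / 2" using Re_Ln_pos_le[OF z(2)] by simp
          then show ?thesis using z by (simp add: Arg_eq_Im_Ln)
        qed
      qed
      ultimately have "\<forall>\<^sub>F z in nhds w. g z = 0"
        using i unfolding eventually_nhds by blast
      then show ?thesis
        by (subst isCont_cong[where g = "\<lambda>_. 0"]) auto
    next
      case False
      have "isCont (\<lambda>w. Arg (w $ i)) w" for i
      proof -
        have "norm (w $ i) = 1" using w by (simp add: K_def)
        then have "w $ i \<noteq> 0" by auto
        moreover have "0 \<le> Re (w $ i)" using False by (meson not_less)
        ultimately have "w $ i \<notin> \<real>\<^sub>\<le>\<^sub>0"
          by (metis complex_eq_iff complex_nonpos_Reals_iff order_antisym zero_complex.sel)
        then have "isCont Arg (w $ i)" by (rule continuous_at_Arg)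
        moreover have "isCont (\<lambda>w. w $ i) w" by (intro continuous_intros)
        ultimately show ?thesis by (rule isCont_o2[rotated])
      qed
      then have th: "isCont \<theta> w"
        unfolding \<theta>_def isCont_def by (intro tendsto_vec_lambda tendsto_mult tendsto_const)
      have "isCont (\<lambda>x. ch x * h x) (\<theta> w)"
        using chi_cont h by (intro continuous_intros) (auto simp: continuous_on_eq_continuous_at)
      then show ?thesis unfolding g_def
        by (rule isCont_o2[OF th])
    qed
  qed
  then obtain f where f: "f \<in> Rg" "\<And>w. w \<in> K \<Longrightarrow> \<bar>g w - f w\<bar> < e"
    using Stone_Weierstrass_basic[OF _ e] by blast
  show ?thesis
  proof (rule that[of "\<lambda>x. f (E x)"])
    show "(\<lambda>x. f (E x)) \<in> trigonometric_polynomials" using f(1) by (simp add: Rg_def)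
    show "\<bar>f (E x)\<bar> \<le> B + e" for x using f(2)[OF EK[of x]] gB[of "E x"] by linarith
    fix x :: "real^'d" assume x: "norm x \<le> R"
    have "\<theta> (E x) = x"
    proof -
      have "Arg (cis (x $ i / s)) = x $ i / s" for i
      proof (rule Arg_cis)
        have "\<bar>x $ i\<bar> \<le> R" using component_le_norm_cart[of x i] x by linarith
        then have "\<bar>x $ i\<bar> < s * pi" using R by (simp add: s_def)
        then show "x $ i / s \<in> {-pi<..pi}" using s by (auto simp: field_simps abs_less_iff)
      qed
      then show ?thesis using s by (simp add: \<theta>_def E_def vec_eq_iff)
    qed
    moreover have "ch x = 1" using x R by (simp add: ch_def)
    ultimately have "g (E x) = h x" by (simp add: g_def)
    then show "\<bar>f (E x) - h x\<bar> < e" using f(2)[OF EK[of x]] by simp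
  qed
qed

text \<open>
  Only the behaviour on a large ball matters: bounded first moments make the mass outside small, and on the ball
  the test function is close to a trigonometric polynomial, whose integral is a combination of values of the
  characteristic function. A uniform bound on the approximating polynomials controls the tails.
\<close>

theorem weakly_convergesI_characteristic_function:
  fixes N :: "nat \<Rightarrow> (real^'d) measure" and N0 :: "(real^'d) measure"
  assumes N: "\<And>n. prob_space (N n)" "\<And>n. sets (N n) = sets borel"
    and N0: "prob_space N0" "sets N0 = sets borel"
    and tight: "\<And>n. n \<ge> n0 \<Longrightarrow> integrable (N n) norm" "\<And>n. n \<ge> n0 \<Longrightarrow> (\<integral>x. norm x \<partial>N n) \<le> K"
    and char: "\<And>t. (\<lambda>n. \<integral>x. cis (t \<bullet> x) \<partial>N n) \<longlonglongrightarrow> (\<integral>x. cis (t \<bullet> x) \<partial>N0)"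
  shows "weakly_converges N N0"
  unfolding weakly_converges_def
proof (intro allI impI)
  fix h :: "real^'d \<Rightarrow> real" assume hh: "continuous_on UNIV h \<and> bounded (range h)"
  then obtain B where B: "\<And>x. \<bar>h x\<bar> \<le> B" unfolding bounded_iff by auto
  have hc: "continuous_on UNIV h" using hh by blast
  have B0: "B \<ge> 0" using B[of 0] by linarith
  have meas: "f \<in> borel_measurable M'" if "continuous_on UNIV f" "sets M' = sets borel"
    for f :: "real^'d \<Rightarrow> 'b::topological_space" and M'
    using borel_measurable_continuous_onI[OF that(1)] measurable_cong_sets[OF that(2) refl] by auto
  have bounded_integrable: "integrable M' f" if "continuous_on UNIV f" "sets M' = sets borel" "prob_space M'" "\<And>x. norm (f x) \<le> C"
    for f :: "real^'d \<Rightarrow> 'b::{banach,second_countable_topology}" and M' C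
  proof -
    interpret prob_space M' by (rule that(3))
    show ?thesis by (rule integrable_const_bound[of _ C]) (use that meas in auto)
  qed
  have cisc: "continuous_on UNIV (\<lambda>x::real^'d. cis (t \<bullet> x))" for t
    unfolding cis_conv_exp by (intro continuous_intros)
  have conv: "(\<lambda>n. \<integral>x. T x \<partial>N n) \<longlonglongrightarrow> (\<integral>x. T x \<partial>N0)" if "T \<in> trigonometric_polynomials" for T
    using that
  proof induction
    case (const c)
    have "measure (N n) (space (N n)) = 1" for n using N(1) by (rule prob_space.prob_space)
    moreover have "measure N0 (space N0) = 1" using N0(1) by (rule prob_space.prob_space)
    ultimately show ?case by simp
  next
    case (cos k)
    have *: "(\<integral>x. cos (k \<bullet> x) \<partial>M') = Re (\<integral>x. cis (k \<bullet> x) \<partial>M')" if "prob_space M'" "sets M' = sets borel" for M'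
      by (subst integral_Re[symmetric]) (auto intro!: bounded_integrable[of _ _ 1] cisc that)
    show ?case unfolding *[OF N] *[OF N0] by (intro tendsto_Re char)
  next
    case (sin k)
    have *: "(\<integral>x. sin (k \<bullet> x) \<partial>M') = Im (\<integral>x. cis (k \<bullet> x) \<partial>M')" if "prob_space M'" "sets M' = sets borel" for M'
      by (subst integral_Im[symmetric]) (auto intro!: bounded_integrable[of _ _ 1] cisc that)
    show ?case unfolding *[OF N] *[OF N0] by (intro tendsto_Im char)
  next
    case (add f g)
    obtain B1 B2 where "\<forall>x. \<bar>f x\<bar> \<le> B1" "\<forall>x. \<bar>g x\<bar> \<le> B2"
      using add.hyps trigonometric_polynomials_bounded by metis
    then have "integrable M' f" "integrable M' g" if "prob_space M'" "sets M' = sets borel" for M'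
      using that add.hyps by (auto intro!: bounded_integrable trigonometric_polynomials_continuous)
    then show ?case using add.IH N N0 by (simp add: tendsto_add)
  next
    case (scale f c)
    then show ?case by (simp add: tendsto_mult_left)
  qed
  show "(\<lambda>n. \<integral>x. h x \<partial>N n) \<longlonglongrightarrow> (\<integral>x. h x \<partial>N0)"
  proof (rule metric_LIMSEQ_I)
    fix e :: real assume e: "e > 0"
    define \<delta> where "\<delta> = min 1 (e / 8)"
    have \<delta>: "\<delta> > 0" "\<delta> \<le> 1" "\<delta> \<le> e/8" using e by (auto simp: \<delta>_def)
    define C where "C = 2 * B + 1"
    have C: "C > 0" using B0 by (simp add: C_def)
    interpret N0: prob_space N0 by (rule N0(1))
    have sp0: "space N0 = UNIV" using sets_eq_imp_space_eq[OF N0(2)] by simp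
    have spn: "space (N n) = UNIV" for n using sets_eq_imp_space_eq[OF N(2)[of n]] by simp
    have "(\<lambda>j::nat. measure N0 {x. real j < norm x}) \<longlonglongrightarrow> measure N0 (\<Inter>j::nat. {x. real j < norm x})"
      by (rule N0.finite_Lim_measure_decseq) (auto simp: N0(2) decseq_def intro!: borel_open open_Collect_less continuous_intros)
    moreover have "(\<Inter>j::nat. {x::real^'d. real j < norm x}) = {}"
      by auto (metis less_asym reals_Archimedean2)
    ultimately have "(\<lambda>j::nat. measure N0 {x. real j < norm x}) \<longlonglongrightarrow> 0" by simp
    then have "\<forall>\<^sub>F j in sequentially. measure N0 {x. real j < norm x} < \<delta> / C"
      using \<delta> C by (intro order_tendstoD) auto
    then obtain j0 where j0: "\<And>j. j \<ge> j0 \<Longrightarrow> measure N0 {x. real j < norm x} < \<delta> / C"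
      unfolding eventually_sequentially by blast
    obtain j1 :: nat where j1: "real j1 > \<bar>K\<bar> * C / \<delta>" using reals_Archimedean2 by blast
    define R where "R = real (max (Suc j0) j1)"
    have R: "R > 0" "R \<ge> real j1" by (auto simp: R_def)
    have tail0: "measure N0 {x. R < norm x} \<le> \<delta> / C" 
      using less_imp_le[OF j0[of "max (Suc j0) j1"]] by (simp add: R_def del: of_nat_max)
    have tailn: "measure (N n) {x. R < norm x} \<le> \<delta> / C" if "n \<ge> n0" for n
    proof -
      interpret prob_space "N n" by (rule N(1))
      have "measure (N n) {x. R < norm x} \<le> measure (N n) {x\<in>space (N n). R \<le> norm x}"
        by (intro finite_measure_mono) (auto simp: spn N(2) intro!: borel_closed closed_Collect_le continuous_intros)
      also have "\<dots> \<le> (\<integral>x. norm x \<partial>N n) / R"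
        by (rule integral_Markov_inequality_measure[where A = "{}"]) (use tight(1)[OF that] R in auto)
      also have "\<dots> \<le> \<bar>K\<bar> / R" using tight(2)[OF that] R by (intro divide_right_mono) auto
      also have "\<dots> \<le> \<delta> / C"
      proof -
        have "\<bar>K\<bar> * C / \<delta> \<le> R" using j1 R by linarith
        then show ?thesis using \<delta> C R by (simp add: field_simps)
      qed
      finally show ?thesis .
    qed
    obtain T where T: "T \<in> trigonometric_polynomials" "\<And>x. norm x \<le> R \<Longrightarrow> \<bar>T x - h x\<bar> < \<delta>"
      "\<And>x. \<bar>T x\<bar> \<le> B + \<delta>"
      using trigonometric_approximation[OF hc B R(1) \<delta>(1)] by blast
    have Tc: "continuous_on UNIV T" using T(1) by (rule trigonometric_polynomials_continuous)
    have close: "\<bar>(\<integral>x. T x \<partial>M') - (\<integral>x. h x \<partial>M')\<bar> \<le> 2 * \<delta>"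
      if M': "prob_space M'" "sets M' = sets borel" and tail: "measure M' {x. R < norm x} \<le> \<delta> / C" for M'
    proof -
      interpret prob_space M' by (rule M'(1))
      have sp: "space M' = UNIV" using sets_eq_imp_space_eq[OF M'(2)] by simp
      have iT: "integrable M' T" by (rule bounded_integrable[OF Tc M'(2,1)]) (use T(3) in auto)
      have ih: "integrable M' h" by (rule bounded_integrable[OF hc M'(2,1)]) (use B in auto)
      have set: "{x. R < norm x} \<in> sets M'"
        by (auto simp: M'(2) intro!: borel_open open_Collect_less continuous_intros)
      have "\<bar>(\<integral>x. T x \<partial>M') - (\<integral>x. h x \<partial>M')\<bar> = \<bar>\<integral>x. T x - h x \<partial>M'\<bar>" using iT ih by simp
      also have "\<dots> \<le> (\<integral>x. \<bar>T x - h x\<bar> \<partial>M')" by (rule integral_abs_bound)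
      also have "\<dots> \<le> (\<integral>x. \<delta> + C * indicator {x. R < norm x} x \<partial>M')"
      proof (rule integral_mono)
        show "integrable M' (\<lambda>x. \<bar>T x - h x\<bar>)" using iT ih by simp
        show "integrable M' (\<lambda>x. \<delta> + C * indicator {x. R < norm x} x)"
          using set by (auto intro!: integrable_real_indicator simp: less_top[symmetric])
        show "\<bar>T x - h x\<bar> \<le> \<delta> + C * indicator {x. R < norm x} x" for x
          using T(2,3)[of x] B[of x] \<delta> by (auto simp: indicator_def C_def)
      qed
      also have "\<dots> = \<delta> + C * measure M' {x. R < norm x}"
        using set prob_space by (simp add: emeasure_eq_measure)
      also have "\<dots> \<le> \<delta> + C * (\<delta> / C)" using tail C by (intro add_mono mult_left_mono) auto
      finally show ?thesis using C by simp
    qed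
    obtain n1 where n1: "\<And>n. n \<ge> n1 \<Longrightarrow> \<bar>(\<integral>x. T x \<partial>N n) - (\<integral>x. T x \<partial>N0)\<bar> < \<delta>"
      using conv[OF T(1)] \<delta>(1) unfolding LIMSEQ_def dist_real_def by meson
    show "\<exists>no. \<forall>n\<ge>no. dist (\<integral>x. h x \<partial>N n) (\<integral>x. h x \<partial>N0) < e"
    proof (intro exI allI impI)
      fix n assume n: "n \<ge> max n0 n1"
      have "\<bar>(\<integral>x. T x \<partial>N n) - (\<integral>x. h x \<partial>N n)\<bar> \<le> 2 * \<delta>"
        using close[OF N] tailn n by simp
      moreover have "\<bar>(\<integral>x. T x \<partial>N0) - (\<integral>x. h x \<partial>N0)\<bar> \<le> 2 * \<delta>" using close[OF N0 tail0] .
      moreover have "\<bar>(\<integral>x. T x \<partial>N n) - (\<integral>x. T x \<partial>N0)\<bar> < \<delta>" using n1 n by simp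
      ultimately have "\<bar>(\<integral>x. h x \<partial>N n) - (\<integral>x. h x \<partial>N0)\<bar> < 5 * \<delta>" by (simp add: abs_if split: if_splits)
      then show "dist (\<integral>x. h x \<partial>N n) (\<integral>x. h x \<partial>N0) < e" using \<delta>(3) e by (simp add: dist_real_def)
    qed
  qed
qed

section \<open>The iterates as a Markov chain\<close>

text \<open>
  The pointwise limit, by continuity, of the functions obtained by replacing the argument \<open>y\<close> by simple
  functions of \<open>y\<close> that converge to it; each of these is a finite sum of products of measurable functions.
\<close>

lemma borel_measurable_Caratheodory:
  fixes F :: "'a::euclidean_space \<Rightarrow> 'z \<Rightarrow> real"
  assumes meas: "\<And>y. F y \<in> borel_measurable D"
    and cont: "\<And>z. z \<in> space D \<Longrightarrow> continuous_on UNIV (\<lambda>y. F y z)"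
  shows "(\<lambda>(y, z). F y z) \<in> borel_measurable (borel \<Otimes>\<^sub>M D)"
proof -
  obtain S :: "nat \<Rightarrow> 'a \<Rightarrow> 'a" where S: "\<And>i. simple_function borel (S i)" "\<And>y. (\<lambda>i. S i y) \<longlonglongrightarrow> y"
    using borel_measurable_implies_sequence_metric[of "\<lambda>y::'a. y" borel 0] by auto
  show ?thesis
  proof (rule borel_measurable_LIMSEQ_real)
    fix w :: "'a \<times> 'z" assume "w \<in> space (borel \<Otimes>\<^sub>M D)"
    then obtain y z where w: "w = (y, z)" "z \<in> space D" by (auto simp: space_pair_measure)
    have "isCont (\<lambda>y. F y z) y" using cont[OF w(2)] by (simp add: continuous_on_eq_continuous_at)
    then have "(\<lambda>i. F (S i y) z) \<longlonglongrightarrow> F y z" using S(2) by (rule isCont_tendsto_compose)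
    then show "(\<lambda>i. case w of (y, z) \<Rightarrow> F (S i y) z) \<longlonglongrightarrow> (case w of (y, z) \<Rightarrow> F y z)"
      by (simp add: w)
  next
    fix i
    have fin: "finite (range (S i))" using simple_functionD(1)[OF S(1)[of i]] by simp
    have "(\<lambda>w. case w of (y, z) \<Rightarrow> F (S i y) z)
        = (\<lambda>w. \<Sum>c\<in>range (S i). indicator (S i -` {c}) (fst w) * F c (snd w))"
    proof
      fix w :: "'a \<times> 'z"
      have "(\<Sum>c\<in>range (S i). indicator (S i -` {c}) (fst w) * F c (snd w))
          = (\<Sum>c\<in>range (S i). if c = S i (fst w) then F c (snd w) else 0)"
        by (rule sum.cong) (auto simp: indicator_def)
      then show "(case w of (y, z) \<Rightarrow> F (S i y) z)
          = (\<Sum>c\<in>range (S i). indicator (S i -` {c}) (fst w) * F c (snd w))"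
        using fin by (simp add: case_prod_unfold)
    qed
    moreover have "S i -` {c} \<in> sets borel" for c
      using simple_functionD(2)[OF S(1)[of i], of "{c}"] by simp
    ultimately show "(\<lambda>w. case w of (y, z) \<Rightarrow> F (S i y) z) \<in> borel_measurable (borel \<Otimes>\<^sub>M D)"
      using meas by simp
  qed
qed

text \<open>
  The stochastic gradient is jointly measurable as a limit of difference quotients of the jointly measurable
  \<open>F\<close>; without this the iterates would not be random variables.
\<close>

lemma borel_measurable_gradient:
  fixes F :: "real^'d \<Rightarrow> 'z \<Rightarrow> real"
  assumes meas: "\<And>y. F y \<in> borel_measurable D"
    and grad: "\<And>y z. z \<in> space D \<Longrightarrow> GDERIV (\<lambda>y. F y z) y :> gF y z"
  shows "(\<lambda>(y, z). gF y z) \<in> borel_measurable (borel \<Otimes>\<^sub>M D)"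
proof -
  have der: "((\<lambda>y. F y z) has_derivative (\<lambda>h. h \<bullet> gF y z)) (at y)" if "z \<in> space D" for y z
    using grad[OF that] by (simp add: gderiv_def)
  have "continuous_on UNIV (\<lambda>y. F y z)" if "z \<in> space D" for z
    using der[OF that] by (meson continuous_at_imp_continuous_on has_derivative_continuous)
  then have Fm: "(\<lambda>w. F (fst w) (snd w)) \<in> borel_measurable (borel \<Otimes>\<^sub>M D)"
    using borel_measurable_Caratheodory[of F D, OF meas] by (simp add: case_prod_unfold)
  have shift: "(\<lambda>w. F (fst w + c) (snd w)) \<in> borel_measurable (borel \<Otimes>\<^sub>M D)" for c
  proof -
    have "(\<lambda>w. (fst w + c, snd w)) \<in> measurable (borel \<Otimes>\<^sub>M D) (borel \<Otimes>\<^sub>M D)" by measurable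
    from measurable_compose[OF this Fm] show ?thesis by simp
  qed
  have "(\<lambda>w. gF (fst w) (snd w) \<bullet> b) \<in> borel_measurable (borel \<Otimes>\<^sub>M D)" for b
  proof (rule borel_measurable_LIMSEQ_real)
    fix w :: "(real^'d) \<times> 'z" assume "w \<in> space (borel \<Otimes>\<^sub>M D)"
    then have w: "snd w \<in> space D" by (auto simp: space_pair_measure)
    define \<phi> where "\<phi> t = F (fst w + t *\<^sub>R b) (snd w)" for t :: real
    have "(\<phi> has_derivative (\<lambda>t. (t *\<^sub>R b) \<bullet> gF (fst w) (snd w))) (at 0)"
      unfolding \<phi>_def
      by (rule has_derivative_compose[where g = "\<lambda>y. F y (snd w)"])
        (auto intro!: derivative_eq_intros der w)
    then have "(\<phi> has_real_derivative gF (fst w) (snd w) \<bullet> b) (at 0)"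
      by (simp add: has_field_derivative_def inner_commute mult_commute_abs)
    then have "((\<lambda>h. (\<phi> (0 + h) - \<phi> 0) / h) \<longlongrightarrow> gF (fst w) (snd w) \<bullet> b) (at 0)"
      by (simp add: DERIV_def)
    moreover have "filterlim (\<lambda>i. inverse (real (Suc i))) (at 0) sequentially"
      using LIMSEQ_inverse_real_of_nat by (simp add: filterlim_at)
    ultimately have "(\<lambda>i. (\<phi> (0 + inverse (real (Suc i))) - \<phi> 0) / inverse (real (Suc i)))
        \<longlonglongrightarrow> gF (fst w) (snd w) \<bullet> b"
      by (rule filterlim_compose)
    then show "(\<lambda>i. (F (fst w + inverse (real (Suc i)) *\<^sub>R b) (snd w) - F (fst w) (snd w)) / inverse (real (Suc i)))
        \<longlonglongrightarrow> gF (fst w) (snd w) \<bullet> b"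
      by (simp add: \<phi>_def)
  next
    fix i
    show "(\<lambda>w. (F (fst w + inverse (real (Suc i)) *\<^sub>R b) (snd w) - F (fst w) (snd w)) / inverse (real (Suc i)))
        \<in> borel_measurable (borel \<Otimes>\<^sub>M D)"
      using shift Fm by (intro borel_measurable_divide borel_measurable_diff) auto
  qed
  then show ?thesis
    unfolding case_prod_unfold by (subst borel_measurable_euclidean_space) blast
qed

locale lpsa_chain = D: prob_space D + M: prob_space M
  for D :: "'z measure" and M :: "'w measure" +
  fixes P :: "real^'d^'d" and gF :: "real^'d \<Rightarrow> 'z \<Rightarrow> real^'d" and \<eta> p :: "nat \<Rightarrow> real"
    and \<zeta> :: "nat \<Rightarrow> 'w \<Rightarrow> 'z" and \<omega> :: "nat \<Rightarrow> 'w \<Rightarrow> bool" and x1 :: "real^'d"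
    and x :: "nat \<Rightarrow> 'w \<Rightarrow> real^'d"
  assumes gF_measurable: "(\<lambda>(y, z). gF y z) \<in> borel_measurable (borel \<Otimes>\<^sub>M D)"
    and samples: "lpsa_samples M D p \<zeta> \<omega>"
    and iterates: "lpsa_iterates M P gF \<eta> \<zeta> \<omega> x1 x"
    and p01: "\<And>n. n \<ge> 1 \<Longrightarrow> 0 \<le> p n \<and> p n \<le> 1"
begin

abbreviation gen :: "nat + nat \<Rightarrow> 'w set set" where
  "gen \<equiv> (\<lambda>i. case i of
          Inl n \<Rightarrow> {\<zeta> n -` B \<inter> space M | B. B \<in> sets D}
        | Inr n \<Rightarrow> {\<omega> n -` B \<inter> space M | B. B \<in> sets (count_space UNIV)})"

lemma zeta_measurable: "n \<ge> 1 \<Longrightarrow> \<zeta> n \<in> measurable M D"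
  and zeta_distr: "n \<ge> 1 \<Longrightarrow> distr M D (\<zeta> n) = D"
  and omega_measurable: "n \<ge> 1 \<Longrightarrow> \<omega> n \<in> measurable M (count_space UNIV)"
  and omega_distr: "n \<ge> 1 \<Longrightarrow> distr M (count_space UNIV) (\<omega> n) = measure_pmf (bernoulli_pmf (p n))"
  and gen_indep: "M.indep_sets gen ({1..} <+> {1..})"
  using samples by (simp_all add: lpsa_samples_def)

lemma x_initial: "s \<in> space M \<Longrightarrow> x (Suc 0) s = x1"
  and x_step: "s \<in> space M \<Longrightarrow> n \<ge> 1 \<Longrightarrow> x (Suc n) s =
    (if \<omega> n s then P *v (x n s - \<eta> n *\<^sub>R gF (x n s) (\<zeta> n s)) else x n s - \<eta> n *\<^sub>R gF (x n s) (\<zeta> n s))"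
  using iterates by (simp_all add: lpsa_iterates_def Let_def)

definition past :: "nat \<Rightarrow> (nat + nat) set" where
  "past n = {1..<n} <+> {1..<n}"

definition history :: "nat \<Rightarrow> 'w measure" where
  "history n = sigma (space M) (\<Union>i\<in>past n. gen i)"

lemma gen_subset: "(\<Union>i\<in>I. gen i) \<subseteq> Pow (space M)"
  by (auto split: sum.splits)

lemma space_history [simp]: "space (history n) = space M"
  and sets_history: "sets (history n) = sigma_sets (space M) (\<Union>i\<in>past n. gen i)"
  using gen_subset by (simp_all add: history_def)

lemma iterate_measurable_history: "n \<ge> 1 \<Longrightarrow> x n \<in> measurable (history n) borel"
proof (induction n rule: nat_induct_at_least)
  case base
  have "x 1 \<in> measurable (history 1) borel \<longleftrightarrow> (\<lambda>_. x1) \<in> measurable (history 1) borel"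
    by (rule measurable_cong) (simp add: x_initial)
  then show ?case by simp
next
  case (Suc n)
  have sub: "sets (history n) \<subseteq> sets (history (Suc n))"
    unfolding sets_history by (rule sigma_sets_mono', rule UN_mono) (auto simp: past_def)
  have xn: "x n \<in> measurable (history (Suc n)) borel"
    using Suc.IH sub unfolding measurable_def by auto
  have zn: "\<zeta> n \<in> measurable (history (Suc n)) D"
  proof (rule measurableI)
    show "s \<in> space (history (Suc n)) \<Longrightarrow> \<zeta> n s \<in> space D" for s
      using zeta_measurable[OF Suc.hyps] by (auto simp: measurable_def)
    fix B assume "B \<in> sets D"
    then have "\<zeta> n -` B \<inter> space M \<in> gen (Inl n)" by auto
    moreover have "Inl n \<in> past (Suc n)" using Suc.hyps by (auto simp: past_def)
    ultimately show "\<zeta> n -` B \<inter> space (history (Suc n)) \<in> sets (history (Suc n))"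
      unfolding sets_history space_history by (intro sigma_sets.Basic) blast
  qed
  have wn: "\<omega> n \<in> measurable (history (Suc n)) (count_space UNIV)"
  proof (rule measurableI)
    fix B :: "bool set"
    have "\<omega> n -` B \<inter> space M \<in> gen (Inr n)" by auto
    moreover have "Inr n \<in> past (Suc n)" using Suc.hyps by (auto simp: past_def)
    ultimately show "\<omega> n -` B \<inter> space (history (Suc n)) \<in> sets (history (Suc n))"
      unfolding sets_history space_history by (intro sigma_sets.Basic) blast
  qed simp
  have g: "(\<lambda>s. gF (x n s) (\<zeta> n s)) \<in> measurable (history (Suc n)) borel"
    using measurable_compose[OF measurable_Pair[OF xn zn] gF_measurable] by simp
  have half: "(\<lambda>s. x n s - \<eta> n *\<^sub>R gF (x n s) (\<zeta> n s)) \<in> measurable (history (Suc n)) borel"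
    using xn g by simp
  have Phalf: "(\<lambda>s. P *v (x n s - \<eta> n *\<^sub>R gF (x n s) (\<zeta> n s))) \<in> measurable (history (Suc n)) borel"
    by (rule borel_measurable_continuous_on[OF _ half])
      (intro linear_continuous_on matrix_vector_mul_bounded_linear)
  have "(\<lambda>s. if \<omega> n s then P *v (x n s - \<eta> n *\<^sub>R gF (x n s) (\<zeta> n s))
      else x n s - \<eta> n *\<^sub>R gF (x n s) (\<zeta> n s)) \<in> measurable (history (Suc n)) borel"
    using half Phalf predE[OF wn] by (intro measurable_If)
  moreover have "x (Suc n) \<in> measurable (history (Suc n)) borel \<longleftrightarrow>
     (\<lambda>s. if \<omega> n s then P *v (x n s - \<eta> n *\<^sub>R gF (x n s) (\<zeta> n s))
      else x n s - \<eta> n *\<^sub>R gF (x n s) (\<zeta> n s)) \<in> measurable (history (Suc n)) borel"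
    by (rule measurable_cong) (use Suc.hyps x_step in simp)
  ultimately show ?case by simp
qed

lemma gen_events: "i \<in> {1..} <+> {1..} \<Longrightarrow> gen i \<subseteq> sets M"
  using gen_indep unfolding M.indep_sets_def by blast

lemma iterate_measurable: "n \<ge> 1 \<Longrightarrow> x n \<in> measurable M borel"
proof -
  assume n: "n \<ge> 1"
  have "(\<Union>i\<in>past n. gen i) \<subseteq> sets M"
    by (rule UN_least, rule gen_events) (auto simp: past_def)
  then have "sets (history n) \<subseteq> sets M"
    unfolding sets_history by (rule sets.sigma_sets_subset)
  then show ?thesis using iterate_measurable_history[OF n] by (auto simp: measurable_def)
qed

text \<open>
  Grouping the independent family into the samples before time \<open>n\<close> and the two samples of time \<open>n\<close>.
\<close>

lemma past_present_independent:
  assumes n: "n \<ge> 1" and A: "A \<in> sets (history n)"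
    and B: "B \<in> sigma_sets (space M) (\<Union>i\<in>{Inl n, Inr n}. gen i)"
  shows "M.prob (A \<inter> B) = M.prob A * M.prob B"
proof -
  define I where "I b = (if b then past n else {Inl n, Inr n})" for b
  have "M.indep_sets (\<lambda>j. sigma_sets (space M) (\<Union>i\<in>I j. gen i)) UNIV"
  proof (rule M.indep_sets_collect_sigma)
    show "M.indep_sets gen (\<Union>j\<in>UNIV. I j)"
      by (rule M.indep_sets_mono_index[OF _ gen_indep]) (use n in \<open>auto simp: I_def past_def UNIV_bool\<close>)
    show "disjoint_family_on I UNIV"
      by (auto simp: disjoint_family_on_def I_def past_def)
    fix i
    show "Int_stable (gen i)"
    proof (cases i)
      case (Inl k)
      show ?thesis unfolding Int_stable_def
      proof (intro ballI)
        fix a b assume "a \<in> gen i" "b \<in> gen i"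
        then obtain B1 B2 where "B1 \<in> sets D" "a = \<zeta> k -` B1 \<inter> space M"
          "B2 \<in> sets D" "b = \<zeta> k -` B2 \<inter> space M" using Inl by auto
        then have "B1 \<inter> B2 \<in> sets D" "a \<inter> b = \<zeta> k -` (B1 \<inter> B2) \<inter> space M" by auto
        then show "a \<inter> b \<in> gen i" unfolding Inl sum.case mem_Collect_eq by blast
      qed
    next
      case (Inr k)
      show ?thesis unfolding Int_stable_def
      proof (intro ballI)
        fix a b assume "a \<in> gen i" "b \<in> gen i"
        then obtain B1 B2 where "B1 \<in> sets (count_space UNIV)" "a = \<omega> k -` B1 \<inter> space M"
          "B2 \<in> sets (count_space UNIV)" "b = \<omega> k -` B2 \<inter> space M" using Inr by auto
        then have "B1 \<inter> B2 \<in> sets (count_space UNIV)" "a \<inter> b = \<omega> k -` (B1 \<inter> B2) \<inter> space M" by auto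
        then show "a \<inter> b \<in> gen i" unfolding Inr sum.case mem_Collect_eq by blast
      qed
    qed
  qed
  then have "M.prob (\<Inter>j\<in>UNIV. if j then A else B) = (\<Prod>j\<in>UNIV. M.prob (if j then A else B))"
    using A B by (intro M.indep_setsD) (auto simp: I_def sets_history UNIV_bool)
  then show ?thesis by (simp add: UNIV_bool Int_commute mult.commute)
qed

lemma joint_distribution:
  assumes n: "n \<ge> 1"
  shows "distr M (borel \<Otimes>\<^sub>M (D \<Otimes>\<^sub>M count_space UNIV)) (\<lambda>s. (x n s, \<zeta> n s, \<omega> n s))
    = distr M borel (x n) \<Otimes>\<^sub>M (D \<Otimes>\<^sub>M measure_pmf (bernoulli_pmf (p n)))"
proof -
  let ?C = "count_space (UNIV::bool set)"
  note xm = iterate_measurable[OF n] and zm = zeta_measurable[OF n] and wm = omega_measurable[OF n]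
  have zw: "(\<lambda>s. (\<zeta> n s, \<omega> n s)) \<in> measurable M (D \<Otimes>\<^sub>M ?C)"
    using zm wm by (rule measurable_Pair)
  interpret dx: prob_space "distr M borel (x n)" by (rule M.prob_space_distr[OF xm])
  interpret dz: prob_space "distr M D (\<zeta> n)" by (rule M.prob_space_distr[OF zm])
  interpret dw: prob_space "distr M ?C (\<omega> n)" by (rule M.prob_space_distr[OF wm])
  interpret dzw: prob_space "distr M (D \<Otimes>\<^sub>M ?C) (\<lambda>s. (\<zeta> n s, \<omega> n s))" by (rule M.prob_space_distr[OF zw])
  have pair1: "distr M D (\<zeta> n) \<Otimes>\<^sub>M distr M ?C (\<omega> n) = distr M (D \<Otimes>\<^sub>M ?C) (\<lambda>s. (\<zeta> n s, \<omega> n s))"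
  proof (rule pair_measure_eqI)
    show "sigma_finite_measure (distr M D (\<zeta> n))" "sigma_finite_measure (distr M ?C (\<omega> n))"
      by unfold_locales
    fix A B assume AB: "A \<in> sets (distr M D (\<zeta> n))" "B \<in> sets (distr M ?C (\<omega> n))"
    define E where "E j = (case j of Inl k \<Rightarrow> \<zeta> n -` A \<inter> space M | Inr k \<Rightarrow> \<omega> n -` B \<inter> space M)"
      for j :: "nat + nat"
    have "M.prob (\<Inter>j\<in>{Inl n, Inr n}. E j) = (\<Prod>j\<in>{Inl n, Inr n}. M.prob (E j))"
      by (rule M.indep_setsD[OF gen_indep]) (use n AB in \<open>auto simp: E_def\<close>)
    then have "M.prob ((\<zeta> n -` A \<inter> space M) \<inter> (\<omega> n -` B \<inter> space M))
        = M.prob (\<zeta> n -` A \<inter> space M) * M.prob (\<omega> n -` B \<inter> space M)"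
      by (simp add: E_def)
    moreover have "(\<lambda>s. (\<zeta> n s, \<omega> n s)) -` (A \<times> B) \<inter> space M
        = (\<zeta> n -` A \<inter> space M) \<inter> (\<omega> n -` B \<inter> space M)" by auto
    ultimately show "emeasure (distr M D (\<zeta> n)) A * emeasure (distr M ?C (\<omega> n)) B
        = emeasure (distr M (D \<Otimes>\<^sub>M ?C) (\<lambda>s. (\<zeta> n s, \<omega> n s))) (A \<times> B)"
      using AB zm wm zw by (simp add: emeasure_distr M.emeasure_eq_measure ennreal_mult)
  next
    show "sets (distr M D (\<zeta> n) \<Otimes>\<^sub>M distr M ?C (\<omega> n)) = sets (distr M (D \<Otimes>\<^sub>M ?C) (\<lambda>s. (\<zeta> n s, \<omega> n s)))"
      unfolding sets_distr by (rule sets_pair_measure_cong) simp_all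
  qed
  have pair2: "distr M borel (x n) \<Otimes>\<^sub>M distr M (D \<Otimes>\<^sub>M ?C) (\<lambda>s. (\<zeta> n s, \<omega> n s))
      = distr M (borel \<Otimes>\<^sub>M (D \<Otimes>\<^sub>M ?C)) (\<lambda>s. (x n s, \<zeta> n s, \<omega> n s))"
  proof (rule pair_measure_eqI)
    show "sigma_finite_measure (distr M borel (x n))"
      "sigma_finite_measure (distr M (D \<Otimes>\<^sub>M ?C) (\<lambda>s. (\<zeta> n s, \<omega> n s)))" by unfold_locales
    fix A B assume AB: "A \<in> sets (distr M borel (x n))"
      "B \<in> sets (distr M (D \<Otimes>\<^sub>M ?C) (\<lambda>s. (\<zeta> n s, \<omega> n s)))"
    have A': "x n -` A \<inter> space M \<in> sets (history n)"
      using measurable_sets[OF iterate_measurable_history[OF n]] AB by simp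
    define N where "N = sigma (space M) (\<Union>i\<in>{Inl n, Inr n}. gen i)"
    have sN: "space N = space M" "sets N = sigma_sets (space M) (\<Union>i\<in>{Inl n, Inr n}. gen i)"
      unfolding N_def by (rule space_measure_of[OF gen_subset], rule sets_measure_of[OF gen_subset])
    have "\<zeta> n \<in> measurable N D"
    proof (rule measurableI)
      show "s \<in> space N \<Longrightarrow> \<zeta> n s \<in> space D" for s
        using zm by (auto simp: measurable_def sN)
      fix B assume "B \<in> sets D"
      then have "\<zeta> n -` B \<inter> space M \<in> gen (Inl n)" by auto
      then show "\<zeta> n -` B \<inter> space N \<in> sets N"
        unfolding sN by (intro sigma_sets.Basic) blast
    qed
    moreover have "\<omega> n \<in> measurable N ?C"
    proof (rule measurableI)
      fix B :: "bool set"
      have "\<omega> n -` B \<inter> space M \<in> gen (Inr n)" by auto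
      then show "\<omega> n -` B \<inter> space N \<in> sets N"
        unfolding sN by (intro sigma_sets.Basic) blast
    qed simp
    ultimately have "(\<lambda>s. (\<zeta> n s, \<omega> n s)) \<in> measurable N (D \<Otimes>\<^sub>M ?C)" by (rule measurable_Pair)
    then have B': "(\<lambda>s. (\<zeta> n s, \<omega> n s)) -` B \<inter> space M \<in> sigma_sets (space M) (\<Union>i\<in>{Inl n, Inr n}. gen i)"
      using measurable_sets[of _ N _ B] AB unfolding sN sets_distr by blast
    have "(\<lambda>s. (x n s, \<zeta> n s, \<omega> n s)) -` (A \<times> B) \<inter> space M
        = (x n -` A \<inter> space M) \<inter> ((\<lambda>s. (\<zeta> n s, \<omega> n s)) -` B \<inter> space M)" by auto
    then show "emeasure (distr M borel (x n)) A * emeasure (distr M (D \<Otimes>\<^sub>M ?C) (\<lambda>s. (\<zeta> n s, \<omega> n s))) B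
        = emeasure (distr M (borel \<Otimes>\<^sub>M (D \<Otimes>\<^sub>M ?C)) (\<lambda>s. (x n s, \<zeta> n s, \<omega> n s))) (A \<times> B)"
      using AB xm zw past_present_independent[OF n A' B'] measurable_Pair[OF xm zw]
      by (simp add: emeasure_distr M.emeasure_eq_measure ennreal_mult)
  qed simp
  have zw_distr: "distr M (D \<Otimes>\<^sub>M ?C) (\<lambda>s. (\<zeta> n s, \<omega> n s)) = D \<Otimes>\<^sub>M measure_pmf (bernoulli_pmf (p n))"
    using pair1[symmetric] unfolding zeta_distr[OF n] omega_distr[OF n] .
  show ?thesis
    using pair2[symmetric] unfolding zw_distr .
qed

text \<open>
  The Markov property: the samples of step \<open>n\<close> can be integrated out with the iterate held fixed. It replaces
  conditional expectations throughout.
\<close>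

lemma expectation_step:
  fixes h :: "real^'d \<Rightarrow> 'z \<Rightarrow> bool \<Rightarrow> 'b::{banach,second_countable_topology}"
  assumes n: "n \<ge> 1"
    and h: "\<And>b. (\<lambda>(y, z). h y z b) \<in> borel_measurable (borel \<Otimes>\<^sub>M D)"
    and int: "integrable M (\<lambda>s. h (x n s) (\<zeta> n s) (\<omega> n s))"
  shows "(\<integral>s. h (x n s) (\<zeta> n s) (\<omega> n s) \<partial>M)
    = (\<integral>s. (\<integral>z. p n *\<^sub>R h (x n s) z True + (1 - p n) *\<^sub>R h (x n s) z False \<partial>D) \<partial>M)"
proof -
  let ?C = "count_space (UNIV::bool set)"
  let ?B = "measure_pmf (bernoulli_pmf (p n))"
  let ?X = "distr M borel (x n)"
  note xm = iterate_measurable[OF n] and zm = zeta_measurable[OF n] and wm = omega_measurable[OF n]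
  have sfX: "sigma_finite_measure ?X"
    by (rule prob_space_imp_sigma_finite[OF M.prob_space_distr[OF xm]])
  have sfB: "sigma_finite_measure ?B"
    by (rule prob_space_imp_sigma_finite[OF measure_pmf.prob_space_axioms])
  have sfDB: "sigma_finite_measure (D \<Otimes>\<^sub>M ?B)"
    by (rule prob_space_imp_sigma_finite[OF
          prob_space_pair[OF D.prob_space_axioms measure_pmf.prob_space_axioms]])
  have DB: "pair_sigma_finite D ?B"
    by (rule pair_sigma_finite.intro[OF D.sigma_finite_measure_axioms sfB])
  have XDB: "pair_sigma_finite ?X (D \<Otimes>\<^sub>M ?B)"
    by (rule pair_sigma_finite.intro[OF sfX sfDB])
  define H where "H w = h (fst w) (fst (snd w)) (snd (snd w))" for w
  define G where "G y z = p n *\<^sub>R h y z True + (1 - p n) *\<^sub>R h y z False" for y z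
  have GH: "G y z = (\<integral>b. H (y, z, b) \<partial>?B)" for y z
    using p01[OF n]
    by (subst integral_measure_pmf[of UNIV]) (simp_all add: G_def H_def UNIV_bool add.commute)
  have "(\<lambda>(y, z). G y z) \<in> borel_measurable (borel \<Otimes>\<^sub>M D)"
    using h[of True] h[of False] by (simp add: case_prod_unfold G_def)
  then have Gm: "(\<lambda>y. \<integral>z. G y z \<partial>D) \<in> borel_measurable borel"
    by (rule D.borel_measurable_lebesgue_integral)
  have Hm: "H \<in> borel_measurable (borel \<Otimes>\<^sub>M (D \<Otimes>\<^sub>M ?C))"
  proof -
    have m: "(\<lambda>w. (fst w, fst (snd w))) \<in> measurable (borel \<Otimes>\<^sub>M (D \<Otimes>\<^sub>M ?C)) (borel \<Otimes>\<^sub>M D)" by measurable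
    have "(\<lambda>w. if snd (snd w) then h (fst w) (fst (snd w)) True else h (fst w) (fst (snd w)) False)
       \<in> borel_measurable (borel \<Otimes>\<^sub>M (D \<Otimes>\<^sub>M ?C))"
      by (rule measurable_If)
        (use measurable_compose[OF m h[of True]] measurable_compose[OF m h[of False]] in auto)
    moreover have "H = (\<lambda>w. if snd (snd w) then h (fst w) (fst (snd w)) True else h (fst w) (fst (snd w)) False)"
      by (auto simp: H_def fun_eq_iff)
    ultimately show ?thesis by simp
  qed
  have T: "(\<lambda>s. (x n s, \<zeta> n s, \<omega> n s)) \<in> measurable M (borel \<Otimes>\<^sub>M (D \<Otimes>\<^sub>M ?C))"
    using xm zm wm by measurable
  have int2: "integrable (?X \<Otimes>\<^sub>M (D \<Otimes>\<^sub>M ?B)) H"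
    unfolding joint_distribution[OF n, symmetric]
    using int by (subst integrable_distr_eq[OF T Hm]) (simp add: H_def)
  have "(\<integral>s. h (x n s) (\<zeta> n s) (\<omega> n s) \<partial>M) = (\<integral>w. H w \<partial>(?X \<Otimes>\<^sub>M (D \<Otimes>\<^sub>M ?B)))"
    unfolding joint_distribution[OF n, symmetric]
    by (subst integral_distr[OF T Hm]) (simp add: H_def)
  also have "\<dots> = (\<integral>y. (\<integral>w. H (y, w) \<partial>(D \<Otimes>\<^sub>M ?B)) \<partial>?X)"
    by (rule pair_sigma_finite.integral_fst'[OF XDB int2, symmetric])
  also have "\<dots> = (\<integral>y. (\<integral>z. G y z \<partial>D) \<partial>?X)"
  proof (rule integral_cong_AE)
    show "AE y in ?X. (\<integral>w. H (y, w) \<partial>(D \<Otimes>\<^sub>M ?B)) = (\<integral>z. G y z \<partial>D)"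
      using pair_sigma_finite.AE_integrable_fst'[OF XDB int2]
    proof eventually_elim
      case (elim y)
      show ?case unfolding GH by (rule pair_sigma_finite.integral_fst'[OF DB elim, symmetric])
    qed
    have "(\<lambda>(y, w). H (y, w)) \<in> borel_measurable (?X \<Otimes>\<^sub>M (D \<Otimes>\<^sub>M ?B))"
      using borel_measurable_integrable[OF int2] by simp
    then show "(\<lambda>y. \<integral>w. H (y, w) \<partial>(D \<Otimes>\<^sub>M ?B)) \<in> borel_measurable ?X"
      by (rule sigma_finite_measure.borel_measurable_lebesgue_integral[OF sfDB])
    show "(\<lambda>y. \<integral>z. G y z \<partial>D) \<in> borel_measurable ?X" using Gm by simp
  qed
  also have "\<dots> = (\<integral>s. (\<integral>z. G (x n s) z \<partial>D) \<partial>M)"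
    by (rule integral_distr[OF xm Gm])
  finally show ?thesis unfolding G_def .
qed

end

section \<open>Step sizes and recursive inequalities\<close>

text \<open>
  A contraction at rate \<open>c\<close> with input of size \<open>c \<tau>\<close> stays of order \<open>\<tau>\<close>, provided \<open>\<tau>\<close> itself decays
  at most at half the rate of the contraction.
\<close>

lemma recursive_inequality_bound:
  fixes z c \<tau> :: "nat \<Rightarrow> real"
  assumes rec: "\<And>n. n \<ge> N \<Longrightarrow> z (Suc n) \<le> (1 - c n) * z n + K0 * (c n * \<tau> n)"
    and c: "\<And>n. n \<ge> N \<Longrightarrow> 0 \<le> c n \<and> c n \<le> 1"
    and \<tau>: "\<And>n. n \<ge> N \<Longrightarrow> \<tau> n > 0"
    and slow: "\<And>n. n \<ge> N \<Longrightarrow> (1 - c n / 2) * \<tau> n \<le> \<tau> (Suc n)"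
  shows "\<exists>K. \<forall>n\<ge>N. z n \<le> K * \<tau> n"
proof -
  define K where "K = max 0 (max (2 * K0) (z N / \<tau> N))"
  have K: "K \<ge> 0" "2 * K0 \<le> K" "z N / \<tau> N \<le> K" by (auto simp: K_def)
  have "z n \<le> K * \<tau> n" if "n \<ge> N" for n
    using that
  proof (induction n rule: nat_induct_at_least)
    case base
    then show ?case using K(3) \<tau>[of N] by (simp add: pos_divide_le_eq)
  next
    case (Suc n)
    have cn: "0 \<le> c n" "c n \<le> 1" "\<tau> n > 0" using c \<tau> Suc.hyps by auto
    have "z (Suc n) \<le> (1 - c n) * z n + K0 * (c n * \<tau> n)" by (rule rec[OF Suc.hyps])
    also have "\<dots> \<le> (1 - c n) * (K * \<tau> n) + (K / 2) * (c n * \<tau> n)"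
      using Suc.IH K cn by (intro add_mono mult_left_mono mult_right_mono) auto
    also have "\<dots> = K * ((1 - c n / 2) * \<tau> n)" by (simp add: algebra_simps)
    also have "\<dots> \<le> K * \<tau> (Suc n)" by (rule mult_left_mono[OF slow[OF Suc.hyps] K(1)])
    finally show ?case .
  qed
  then show ?thesis by blast
qed

text \<open>
  The excess of \<open>z\<close> over a fixed level \<open>r / 2\<close> is eventually multiplied by \<open>1 - c \<eta> \<le> exp (- c \<eta>)\<close> in each step,
  and the step sizes have infinite sum.
\<close>

lemma recursive_inequality_tendsto_zero:
  fixes z \<eta> \<epsilon> :: "nat \<Rightarrow> real"
  assumes rec: "\<And>n. n \<ge> N \<Longrightarrow> z (Suc n) \<le> (1 - c * \<eta> n) * z n + \<epsilon> n * \<eta> n"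
    and z: "\<And>n. z n \<ge> 0" and c: "c > 0"
    and \<eta>: "\<And>n. n \<ge> N \<Longrightarrow> 0 \<le> \<eta> n \<and> c * \<eta> n \<le> 1"
    and div: "filterlim (\<lambda>n. \<Sum>i<n. \<eta> i) at_top sequentially"
    and \<epsilon>: "\<epsilon> \<longlonglongrightarrow> 0"
  shows "z \<longlonglongrightarrow> 0"
proof (rule LIMSEQ_I)
  fix r :: real assume r: "r > 0"
  have "\<forall>\<^sub>F n in sequentially. \<epsilon> n < c * (r / 2)"
    using order_tendstoD(2)[OF \<epsilon>, of "c * (r/2)"] c r by simp
  then obtain N1 where N1: "\<And>n. n \<ge> N1 \<Longrightarrow> \<epsilon> n < c * (r / 2)"
    unfolding eventually_sequentially by blast
  \<comment> \<open>from here on the input is below \<open>c * (r / 2)\<close>\<close>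
  define n0 where "n0 = max N N1"
  define y where "y n = max 0 (z n - r / 2)" for n
  define T where "T n = (\<Sum>i<n. \<eta> i)" for n
  have step: "y (Suc n) \<le> (1 - c * \<eta> n) * y n" if "n \<ge> n0" for n
  proof -
    have n: "n \<ge> N" "n \<ge> N1" using that by (auto simp: n0_def)
    have "\<epsilon> n * \<eta> n \<le> c * (r / 2) * \<eta> n" using N1[OF n(2)] \<eta>[OF n(1)] by (intro mult_right_mono) auto
    then have "z (Suc n) - r / 2 \<le> (1 - c * \<eta> n) * (z n - r / 2)"
      using rec[OF n(1)] by (simp add: algebra_simps)
    also have "\<dots> \<le> (1 - c * \<eta> n) * y n" using \<eta>[OF n(1)] by (intro mult_left_mono) (auto simp: y_def)
    finally show ?thesis using \<eta>[OF n(1)] by (auto simp: y_def[of "Suc n"] y_def)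
  qed
  have y0: "y n \<ge> 0" for n by (simp add: y_def)
  have exp_bound: "y n \<le> y n0 * exp (c * (T n0 - T n))" if "n \<ge> n0" for n
    using that
  proof (induction n rule: nat_induct_at_least)
    case base
    then show ?case by simp
  next
    case (Suc n)
    have "y (Suc n) \<le> (1 - c * \<eta> n) * y n" by (rule step[OF Suc.hyps])
    also have "\<dots> \<le> exp (- (c * \<eta> n)) * y n"
      using exp_ge_add_one_self[of "- (c * \<eta> n)"] y0 by (intro mult_right_mono) auto
    also have "\<dots> \<le> exp (- (c * \<eta> n)) * (y n0 * exp (c * (T n0 - T n)))"
      by (rule mult_left_mono[OF Suc.IH]) simp
    also have "\<dots> = y n0 * exp (c * (T n0 - T (Suc n)))"
      by (simp add: T_def exp_add[symmetric] algebra_simps)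
    finally show ?case .
  qed
  have "(\<lambda>n. y n0 * exp (c * (T n0 - T n))) \<longlonglongrightarrow> 0"
  proof -
    have "filterlim (\<lambda>n. c * (T n - T n0)) at_top sequentially"
    proof (rule filterlim_tendsto_pos_mult_at_top[OF tendsto_const c])
      show "filterlim (\<lambda>n. T n - T n0) at_top sequentially"
        using filterlim_tendsto_add_at_top[OF tendsto_const[of "- T n0"] div] by (simp add: T_def)
    qed
    then have "filterlim (\<lambda>n. c * (T n0 - T n)) at_bot sequentially"
      by (subst filterlim_uminus_at_bot) (simp add: algebra_simps)
    then have "(\<lambda>n. exp (c * (T n0 - T n))) \<longlonglongrightarrow> 0" by (rule filterlim_compose[OF exp_at_bot])
    then show ?thesis by (rule tendsto_mult_right_zero)
  qed
  then have "\<forall>\<^sub>F n in sequentially. y n0 * exp (c * (T n0 - T n)) < r / 2"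
    by (rule order_tendstoD) (use r in simp)
  then obtain N2 where N2: "\<And>n. n \<ge> N2 \<Longrightarrow> y n0 * exp (c * (T n0 - T n)) < r / 2"
    unfolding eventually_sequentially by blast
  show "\<exists>no. \<forall>n\<ge>no. norm (z n - 0) < r"
  proof (intro exI allI impI)
    fix n assume n: "n \<ge> max n0 N2"
    then have "y n < r / 2" using exp_bound[of n] N2[of n] by force
    then have "z n < r" unfolding y_def using r by linarith
    then show "norm (z n - 0) < r" using z[of n] by simp
  qed
qed

lemma eventually_bound_imp_bound:
  fixes z \<tau> :: "nat \<Rightarrow> real"
  assumes b: "\<forall>n\<ge>N. z n \<le> K * \<tau> n" and \<tau>: "\<And>n. n \<ge> 1 \<Longrightarrow> \<tau> n > 0"
  shows "\<exists>K'\<ge>0. \<forall>n\<ge>1. z n \<le> K' * \<tau> n"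
proof -
  define K' where "K' = Max (insert 0 (insert K ((\<lambda>n. z n / \<tau> n) ` {1..N})))"
  have fin: "finite (insert 0 (insert K ((\<lambda>n. z n / \<tau> n) ` {1..N})))" by simp
  have K': "K' \<ge> 0" "K' \<ge> K" "\<And>n. n \<in> {1..N} \<Longrightarrow> z n / \<tau> n \<le> K'"
    unfolding K'_def by (rule Max_ge[OF fin], blast)+
  have "z n \<le> K' * \<tau> n" if "n \<ge> 1" for n
  proof (cases "n \<le> N")
    case True
    then have "z n / \<tau> n \<le> K'" using K'(3) that by simp
    then show ?thesis using \<tau>[OF that] by (simp add: pos_divide_le_eq)
  next
    case False
    then have "z n \<le> K * \<tau> n" using b by simp
    also have "\<dots> \<le> K' * \<tau> n" using K'(2) \<tau>[OF that] by (intro mult_right_mono) auto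
    finally show ?thesis .
  qed
  with K'(1) show ?thesis by blast
qed

locale step_sizes =
  fixes \<eta> p :: "nat \<Rightarrow> real" and \<eta>\<^sub>0 \<alpha> \<gamma> \<mu> :: real
  assumes eta: "\<And>n. \<eta> n = \<eta>\<^sub>0 * real n powr (- \<alpha>)"
    and p: "\<And>n. p n = min (\<gamma> * \<eta> n powr (1/2)) 1"
    and gamma: "\<gamma> > 0" and alpha: "0 < \<alpha>" "\<alpha> \<le> 1" and eta0: "\<eta>\<^sub>0 > 0" "\<eta>\<^sub>0 > 2 * of_bool (\<alpha> = 1) / \<mu>"
    and mu: "\<mu> > 0"
begin

lemma eta_pos: "n \<ge> 1 \<Longrightarrow> \<eta> n > 0"
  using eta0 by (simp add: eta)

lemma eta_tendsto: "\<eta> \<longlonglongrightarrow> 0"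
proof -
  have "(\<lambda>n. \<eta>\<^sub>0 * real n powr (- \<alpha>)) \<longlonglongrightarrow> \<eta>\<^sub>0 * 0"
    by (intro tendsto_mult tendsto_const tendsto_neg_powr filterlim_real_sequentially) (use alpha in simp)
  then show ?thesis by (simp add: eta[abs_def])
qed

lemma sqrt_eta_tendsto: "(\<lambda>n. sqrt (\<eta> n)) \<longlonglongrightarrow> 0"
  using tendsto_real_sqrt[OF eta_tendsto] by simp

lemma p_eq: "p n = min (\<gamma> * sqrt (\<eta> n)) 1"
proof -
  have "\<eta> n \<ge> 0" using eta0 by (simp add: eta)
  then show ?thesis by (simp add: p powr_half_sqrt)
qed

lemma p_bounds: "n \<ge> 1 \<Longrightarrow> 0 < p n" "p n \<le> 1"
  using gamma eta_pos[of n] by (auto simp: p_eq)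

lemma eventually_small_sqrt_eta:
  assumes "\<delta> > 0"
  shows "\<exists>N\<ge>2. \<forall>n\<ge>N. sqrt (\<eta> n) < \<delta>"
proof -
  obtain N where "\<forall>n\<ge>N. sqrt (\<eta> n) < \<delta>"
    using order_tendstoD(2)[OF sqrt_eta_tendsto assms] unfolding eventually_sequentially by blast
  then show ?thesis by (intro exI[of _ "max 2 N"]) auto
qed

lemma p_small: "sqrt (\<eta> n) < 1 / \<gamma> \<Longrightarrow> p n = \<gamma> * sqrt (\<eta> n)"
  using gamma by (simp add: p_eq field_simps)

lemma p_tendsto: "p \<longlonglongrightarrow> 0"
proof -
  have "(\<lambda>n. min (\<gamma> * sqrt (\<eta> n)) 1) \<longlonglongrightarrow> min (\<gamma> * 0) 1"
    by (intro tendsto_min tendsto_mult tendsto_const sqrt_eta_tendsto)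
  then show ?thesis by (simp add: p_eq[abs_def])
qed

lemma eta_ratio: "n \<ge> 1 \<Longrightarrow> (1 - 1 / real n) * \<eta> n \<le> \<eta> (Suc n)"
proof -
  assume n: "n \<ge> 1"
  define t where "t = real n / real (Suc n)"
  have t: "0 < t" "t \<le> 1" using n by (auto simp: t_def)
  have "1 - 1 / real n \<le> t" using n by (simp add: t_def field_simps)
  also have "t = t powr 1" using t by simp
  also have "\<dots> \<le> t powr \<alpha>" using t alpha by (intro powr_mono') auto
  finally have "(1 - 1 / real n) * \<eta> n \<le> t powr \<alpha> * \<eta> n"
    using eta_pos[OF n] by (intro mult_right_mono) auto
  also have "\<dots> = \<eta> (Suc n)"
    using n by (simp add: eta t_def powr_divide powr_minus field_simps)
  finally show ?thesis .
qed

lemma eta_decreasing: "n \<ge> 1 \<Longrightarrow> \<eta> (Suc n) \<le> \<eta> n"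
  using eta0 alpha by (simp add: eta powr_mono2')

text \<open>
  The relative decrease \<open>1 / n\<close> of the step sizes is dominated by the contraction rate. For \<open>\<alpha> = 1\<close> this is the
  condition \<open>\<mu> \<eta>\<^sub>0 > 2\<close>.
\<close>

lemma inverse_le_eta: "\<exists>N. \<forall>n\<ge>N. 1 / real n \<le> \<mu> * \<eta> n / 2"
proof (cases "\<alpha> = 1")
  case True
  then have "\<mu> * \<eta>\<^sub>0 > 2" using eta0 mu by (simp add: field_simps)
  then have "1 / real n \<le> \<mu> * \<eta> n / 2" if "n \<ge> 1" for n
    using that True by (simp add: eta powr_minus field_simps)
  then show ?thesis by blast
next
  case False
  have "(\<lambda>n. real n powr (\<alpha> - 1)) \<longlonglongrightarrow> 0"
    by (intro tendsto_neg_powr filterlim_real_sequentially) (use alpha False in simp)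
  then have "\<forall>\<^sub>F n in sequentially. real n powr (\<alpha> - 1) < \<mu> * \<eta>\<^sub>0 / 2"
    by (rule order_tendstoD) (use mu eta0 in simp)
  then obtain N where N: "\<And>n. n \<ge> N \<Longrightarrow> real n powr (\<alpha> - 1) < \<mu> * \<eta>\<^sub>0 / 2"
    unfolding eventually_sequentially by blast
  have "1 / real n \<le> \<mu> * \<eta> n / 2" if n: "n \<ge> max 1 N" for n
  proof -
    have "1 / real n = real n powr (\<alpha> - 1) * real n powr (- \<alpha>)"
      using n powr_add[of "real n" "\<alpha> - 1" "- \<alpha>", symmetric] powr_minus[of "real n" 1]
      by (simp add: inverse_eq_divide)
    also have "\<dots> \<le> (\<mu> * \<eta>\<^sub>0 / 2) * real n powr (- \<alpha>)"
      using N[of n] n by (intro mult_right_mono) auto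
    finally show ?thesis by (simp add: eta)
  qed
  then show ?thesis by blast
qed

lemma eta_divergent: "filterlim (\<lambda>n. \<Sum>i<n. \<eta> i) at_top sequentially"
proof -
  have "filterlim (\<lambda>n. \<eta>\<^sub>0 * (harm n)) at_top sequentially"
    by (rule filterlim_tendsto_pos_mult_at_top[OF tendsto_const eta0(1) harm_at_top])
  then have 1: "filterlim (\<lambda>n. \<eta>\<^sub>0 * (harm (n - 1))) at_top sequentially"
    by (rule filterlim_compose) (rule filterlim_minus_const_nat_at_top)
  show ?thesis
  proof (rule filterlim_at_top_mono[OF 1], rule always_eventually, rule allI)
    fix n
    have "\<eta>\<^sub>0 * harm (n - 1) = (\<Sum>i=1..n-1. \<eta>\<^sub>0 * inverse (real i))"
      by (simp add: harm_def sum_distrib_left)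
    also have "\<dots> \<le> (\<Sum>i=1..n-1. \<eta> i)"
    proof (rule sum_mono)
      fix i assume i: "i \<in> {1..n-1}"
      have "inverse (real i) = real i powr (-1)" using i by (simp add: powr_minus)
      also have "\<dots> \<le> real i powr (- \<alpha>)" using i alpha by (intro powr_mono) auto
      finally show "\<eta>\<^sub>0 * inverse (real i) \<le> \<eta> i" using eta0 by (simp add: eta mult_left_mono)
    qed
    also have "\<dots> \<le> (\<Sum>i<n. \<eta> i)"
      using eta0 by (intro sum_mono2) (auto simp: eta)
    finally show "\<eta>\<^sub>0 * harm (n - 1) \<le> (\<Sum>i<n. \<eta> i)" .
  qed
qed

text \<open>The normalisation by \<open>sqrt (\<eta> (n - 1))\<close> drifts at rate \<open>1 / (2 n)\<close> when \<open>\<alpha> = 1\<close>.\<close>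

definition rescaling :: "nat \<Rightarrow> real" where
  "rescaling n = sqrt (\<eta> (n - 1)) / sqrt (\<eta> n)"

lemma rescaling_eq: "n \<ge> 2 \<Longrightarrow> rescaling n = (real n / (real n - 1)) powr (\<alpha> / 2)"
proof -
  assume n: "n \<ge> 2"
  have "sqrt (\<eta> (n - 1)) / sqrt (\<eta> n) = sqrt (\<eta> (n - 1) / \<eta> n)" by (simp add: real_sqrt_divide)
  also have "\<eta> (n - 1) / \<eta> n = (real n / (real n - 1)) powr \<alpha>"
    using n eta0 by (simp add: eta powr_divide powr_minus of_nat_diff field_simps)
  also have "sqrt \<dots> = (real n / (real n - 1)) powr (\<alpha> / 2)"
    using n by (simp add: powr_half_sqrt[symmetric] powr_powr)
  finally show ?thesis by (simp add: rescaling_def)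
qed

lemma rescaling_tendsto: "(\<lambda>n. (rescaling n - 1) / \<eta> n) \<longlonglongrightarrow> of_bool (\<alpha> = 1) / (2 * \<eta>\<^sub>0)"
proof (cases "\<alpha> = 1")
  case True
  have "(\<lambda>n. ((real n / (real n - 1)) powr (1 / 2) - 1) / (\<eta>\<^sub>0 * real n powr (- 1))) \<longlonglongrightarrow> inverse \<eta>\<^sub>0 / 2"
    using eta0(1) by real_asymp
  moreover have "\<forall>\<^sub>F n in sequentially. ((real n / (real n - 1)) powr (1 / 2) - 1) / (\<eta>\<^sub>0 * real n powr (- 1))
      = (rescaling n - 1) / \<eta> n"
    using eventually_ge_at_top[of 2] by eventually_elim (simp add: rescaling_eq True eta)
  ultimately show ?thesis using True by (simp add: tendsto_cong inverse_eq_divide mult.commute)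
next
  case False
  have "(\<lambda>n. (2 / \<eta>\<^sub>0) * real n powr (\<alpha> - 1)) \<longlonglongrightarrow> (2 / \<eta>\<^sub>0) * 0"
    by (intro tendsto_mult tendsto_const tendsto_neg_powr filterlim_real_sequentially) (use alpha False in simp)
  then have lim: "(\<lambda>n. (2 / \<eta>\<^sub>0) * real n powr (\<alpha> - 1)) \<longlonglongrightarrow> 0" by simp
  have "(\<lambda>n. (rescaling n - 1) / \<eta> n) \<longlonglongrightarrow> 0"
  proof (rule Lim_null_comparison[OF _ lim])
    show "\<forall>\<^sub>F n in sequentially. norm ((rescaling n - 1) / \<eta> n) \<le> (2 / \<eta>\<^sub>0) * real n powr (\<alpha> - 1)"
      using eventually_ge_at_top[of 2]
    proof eventually_elim
      case (elim n)
      define t where "t = real n / (real n - 1)"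
      have t: "t \<ge> 1" using elim by (simp add: t_def)
      have l: "rescaling n = t powr (\<alpha> / 2)" using rescaling_eq[OF elim] by (simp add: t_def)
      have "1 \<le> rescaling n" using t alpha by (simp add: l ge_one_powr_ge_zero)
      moreover have "rescaling n \<le> t powr 1" unfolding l using t alpha by (intro powr_mono) auto
      moreover have "t powr 1 - 1 = 1 / (real n - 1)" using elim by (simp add: t_def field_simps)
      moreover have "1 / (real n - 1) \<le> 2 / real n" using elim by (simp add: field_simps)
      ultimately have "0 \<le> rescaling n - 1" "rescaling n - 1 \<le> 2 / real n" by linarith+
      then have "(rescaling n - 1) / \<eta> n \<le> (2 / real n) / \<eta> n" "(rescaling n - 1) / \<eta> n \<ge> 0"
        using divide_right_mono[of "rescaling n - 1" "2 / real n" "\<eta> n"] eta_pos[of n] elim by auto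
      then have "norm ((rescaling n - 1) / \<eta> n) \<le> (2 / real n) / \<eta> n" unfolding real_norm_def by linarith
      also have "\<dots> = (2 / \<eta>\<^sub>0) * real n powr (\<alpha> - 1)"
        using elim by (simp add: eta powr_minus powr_diff field_simps)
      finally show ?case .
    qed
  qed
  then show ?thesis using False by simp
qed


text \<open>
  The mean squares of the two components of the iterate, \<open>A\<close> for the component in the constraint space and
  \<open>V\<close> for the orthogonal one, contract at the rates \<open>\<eta>\<close> and \<open>p\<close>, and \<open>p\<close> is of the larger
  order \<open>sqrt \<eta>\<close>. Their sum is therefore bounded, which decouples the second inequality and then the first.
\<close>

lemma coupled_recursion_bound:
  fixes A V :: "nat \<Rightarrow> real"
  assumes C: "C \<ge> 0" and A0: "\<And>n. A n \<ge> 0" and V0: "\<And>n. V n \<ge> 0"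
    and V: "\<And>n. n \<ge> 1 \<Longrightarrow> V (Suc n) \<le> (1 - p n / 2) * V n + C * ((\<eta> n)\<^sup>2 / p n) * (1 + A n + V n)"
    and A: "\<And>n. n \<ge> 1 \<Longrightarrow> A (Suc n) \<le> (1 - 3 / 2 * \<mu> * \<eta> n + C * (\<eta> n)\<^sup>2) * A n + C * \<eta> n * V n + C * (\<eta> n)\<^sup>2"
  shows "\<exists>K\<ge>0. \<forall>n\<ge>1. A n \<le> K * \<eta> n \<and> V n \<le> K * \<eta> n"
proof -
  define r where "r n = sqrt (\<eta> n)" for n
  have r: "r n > 0" "\<eta> n = (r n)\<^sup>2" if "n \<ge> 1" for n using eta_pos[OF that] by (auto simp: r_def)
  \<comment> \<open>thresholds for \<open>sqrt (\<eta> n)\<close> that let each contraction absorb the perturbations next to it\<close>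
  define \<delta> where "\<delta> = min (min 1 (1 / \<gamma>)) (min (\<gamma> / (4 * (C / \<gamma> + C + \<mu> + 1))) (\<mu> / (4 * (C + C / \<gamma> + \<mu> * \<mu> + 1))))"
  have den: "C / \<gamma> + C + \<mu> + 1 > 0" "C + C / \<gamma> + \<mu> * \<mu> + 1 > 0" using C gamma mu by (auto intro!: add_nonneg_pos)
  then have "\<delta> > 0" using gamma mu by (simp add: \<delta>_def)
  then obtain N0 where N0: "N0 \<ge> 2" "\<And>n. n \<ge> N0 \<Longrightarrow> r n < \<delta>"
    using eventually_small_sqrt_eta unfolding r_def by blast
  obtain N1 where N1: "\<And>n. n \<ge> N1 \<Longrightarrow> 1 / real n \<le> \<mu> * \<eta> n / 2" using inverse_le_eta by blast
  define N where "N = max N0 N1"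
  have small: "0 < r n" "r n \<le> 1" "p n = \<gamma> * r n" "r n * (C / \<gamma> + C + \<mu> + 1) \<le> \<gamma> / 4"
    "r n * (C + C / \<gamma> + \<mu> * \<mu> + 1) \<le> \<mu> / 4" "n \<ge> 1" "\<eta> n = r n ^ 2" "(\<eta> n)\<^sup>2 / p n = r n ^ 3 / \<gamma>"
    "1 / real n \<le> \<mu> * \<eta> n / 2" if "n \<ge> N" for n
  proof -
    have n: "n \<ge> N0" "n \<ge> N1" "n \<ge> 1" using that N0(1) by (auto simp: N_def)
    have d: "r n < \<delta>" by (rule N0(2)[OF n(1)])
    then have d': "r n < 1" "r n < 1 / \<gamma>" "r n < \<gamma> / (4 * (C / \<gamma> + C + \<mu> + 1))"
      "r n < \<mu> / (4 * (C + C / \<gamma> + \<mu> * \<mu> + 1))" by (auto simp: \<delta>_def)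
    show "0 < r n" "n \<ge> 1" "r n \<le> 1" "\<eta> n = r n ^ 2" using r n d' by auto
    show pp: "p n = \<gamma> * r n" using p_small d'(2) by (simp add: r_def)
    show "r n * (C / \<gamma> + C + \<mu> + 1) \<le> \<gamma> / 4"
      using d'(3) den by (simp only: pos_less_divide_eq mult_pos_pos zero_less_numeral) (simp add: algebra_simps)
    show "r n * (C + C / \<gamma> + \<mu> * \<mu> + 1) \<le> \<mu> / 4"
      using d'(4) den by (simp only: pos_less_divide_eq mult_pos_pos zero_less_numeral) (simp add: algebra_simps)
    show "(\<eta> n)\<^sup>2 / p n = r n ^ 3 / \<gamma>"
      using r[OF n(3)] gamma by (simp add: pp power2_eq_square power3_eq_cube)
    show "1 / real n \<le> \<mu> * \<eta> n / 2" by (rule N1[OF n(2)])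
  qed
  have muN: "0 \<le> \<mu> * \<eta> n \<and> \<mu> * \<eta> n \<le> 1" if "n \<ge> N" for n
  proof -
    note s = small[OF that]
    have "r n * (\<mu> * \<mu>) \<le> r n * (C + C / \<gamma> + \<mu> * \<mu> + 1)"
      using s(1) C gamma by (intro mult_left_mono) auto
    then have "r n * \<mu> * \<mu> \<le> \<mu>" using s(5) mu by linarith
    then have "r n * \<mu> \<le> 1" using mu by simp
    moreover have "r n * r n * \<mu> \<le> r n * \<mu>" using s mu by (simp add: mult_left_le_one_le)
    ultimately have "r n * r n * \<mu> \<le> 1" by linarith
    then show ?thesis using s(1,7) mu by (simp add: power2_eq_square mult.commute)
  qed
  have slow_mu: "(1 - \<mu> * \<eta> n / 2) * \<eta> n \<le> \<eta> (Suc n)" if "n \<ge> N" for n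
  proof -
    note s = small[OF that]
    have "(1 - \<mu> * \<eta> n / 2) * \<eta> n \<le> (1 - 1 / real n) * \<eta> n"
      using s(9) eta_pos[OF s(6)] by (intro mult_right_mono) auto
    also have "\<dots> \<le> \<eta> (Suc n)" by (rule eta_ratio[OF s(6)])
    finally show ?thesis .
  qed
  \<comment> \<open>the sum contracts at the slower of the two rates, with an input of order \<open>\<eta>\<close>\<close>
  have "\<exists>K. \<forall>n\<ge>N. A n + V n \<le> K * 1"
  proof (rule recursive_inequality_bound[where c = "\<lambda>n. \<mu> * \<eta> n" and \<tau> = "\<lambda>_. 1" and ?K0.0 = "1 / 4"])
    fix n assume n: "n \<ge> N"
    note s = small[OF n]
    define q where "q = r n"
    have q: "0 < q" "q \<le> 1" using s by (auto simp: q_def)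
    have "A (Suc n) + V (Suc n) \<le>
       ((1 - 3 / 2 * \<mu> * q\<^sup>2 + C * (q\<^sup>2)\<^sup>2) * A n + C * q\<^sup>2 * V n + C * (q\<^sup>2)\<^sup>2)
       + ((1 - \<gamma> * q / 2) * V n + C * (q ^ 3 / \<gamma>) * (1 + A n + V n))"
      using A[OF s(6)] V[OF s(6)] unfolding s(8) unfolding s(3) unfolding s(7) q_def by linarith
    also have "\<dots> = (1 - q\<^sup>2 * (3 / 2 * \<mu> - C * q\<^sup>2 - C / \<gamma> * q)) * A n
        + (1 - q * (\<gamma> / 2 - C * q - C / \<gamma> * q\<^sup>2)) * V n + q\<^sup>2 * (C * q\<^sup>2 + C / \<gamma> * q)"
      by (simp add: algebra_simps power2_eq_square power3_eq_cube add_divide_distrib)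
    also have "\<dots> \<le> (1 - q\<^sup>2 * \<mu>) * A n + (1 - q\<^sup>2 * \<mu>) * V n + q\<^sup>2 * (1 * (\<mu> / 4))"
    proof (intro add_mono mult_right_mono mult_left_mono A0 V0 diff_left_mono)
      have qq: "C * q\<^sup>2 \<le> C * q" using q C by (intro mult_left_mono) (auto simp: power2_eq_square mult_left_le_one_le)
      have e: "C * q + C / \<gamma> * q \<le> \<mu> / 4"
      proof -
        have "C * q + C / \<gamma> * q \<le> q * (C + C / \<gamma> + \<mu> * \<mu> + 1)"
          using q mu by (simp add: algebra_simps add_nonneg_nonneg)
        then show ?thesis using s(5) by (simp add: q_def)
      qed
      show "\<mu> \<le> 3 / 2 * \<mu> - C * q\<^sup>2 - C / \<gamma> * q" using qq e mu by linarith
      show "C * q\<^sup>2 + C / \<gamma> * q \<le> 1 * (\<mu> / 4)" using qq e by linarith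
      have "C / \<gamma> * q\<^sup>2 \<le> C / \<gamma> * q" using q C gamma by (intro mult_left_mono) (auto simp: power2_eq_square mult_left_le_one_le)
      moreover have "q * (C / \<gamma> + C + \<mu> + 1) \<le> \<gamma> / 4" using s(4) by (simp add: q_def)
      moreover have "q * (C / \<gamma> + C + \<mu> + 1) = C / \<gamma> * q + C * q + q * \<mu> + q" by (simp add: algebra_simps)
      ultimately have "q * \<mu> \<le> \<gamma> / 2 - C * q - C / \<gamma> * q\<^sup>2" using q gamma by linarith
      then have "q * (q * \<mu>) \<le> q * (\<gamma> / 2 - C * q - C / \<gamma> * q\<^sup>2)" using q by (intro mult_left_mono) auto
      then show "q\<^sup>2 * \<mu> \<le> q * (\<gamma> / 2 - C * q - C / \<gamma> * q\<^sup>2)" by (simp add: power2_eq_square mult.assoc)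
    qed auto
    also have "\<dots> = (1 - \<mu> * \<eta> n) * (A n + V n) + 1 / 4 * (\<mu> * \<eta> n * 1)"
      using s(7) by (simp add: q_def algebra_simps)
    finally show "A (Suc n) + V (Suc n) \<le> (1 - \<mu> * \<eta> n) * (A n + V n) + 1 / 4 * (\<mu> * \<eta> n * 1)" .
  qed (use muN in auto)
  then obtain K1 where K1: "\<And>n. n \<ge> N \<Longrightarrow> A n + V n \<le> K1" by auto
  have K1_0: "K1 \<ge> 0" using K1[of N] A0[of N] V0[of N] by simp
  \<comment> \<open>as \<open>A + V\<close> is bounded, the inequality for \<open>V\<close> closes\<close>
  have "\<exists>K. \<forall>n\<ge>N. V n \<le> K * \<eta> n"
  proof (rule recursive_inequality_bound[where c = "\<lambda>n. \<gamma> * r n / 2" and ?K0.0 = "2 * C * (1 + K1) / \<gamma>\<^sup>2"])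
    fix n assume n: "n \<ge> N"
    note s = small[OF n]
    show c01: "0 \<le> \<gamma> * r n / 2 \<and> \<gamma> * r n / 2 \<le> 1"
      using p_bounds(2)[of n] s(1) gamma by (simp add: s(3))
    show "\<eta> n > 0" by (rule eta_pos[OF s(6)])
    have "C * (r n ^ 3 / \<gamma>) * (1 + A n + V n) \<le> C * (r n ^ 3 / \<gamma>) * (1 + K1)"
      using K1[OF n] C gamma s(1) by (intro mult_left_mono) auto
    also have "\<dots> = 2 * C * (1 + K1) / \<gamma>\<^sup>2 * (\<gamma> * r n / 2 * \<eta> n)"
      using gamma by (simp add: s(7) power2_eq_square power3_eq_cube field_simps)
    finally show "V (Suc n) \<le> (1 - \<gamma> * r n / 2) * V n + 2 * C * (1 + K1) / \<gamma>\<^sup>2 * (\<gamma> * r n / 2 * \<eta> n)"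
      using V[OF s(6)] unfolding s(8) unfolding s(3) by linarith
    have "\<mu> * \<eta> n / 2 \<le> \<gamma> * r n / 2 / 2"
    proof -
      have "r n * \<mu> \<le> r n * (C / \<gamma> + C + \<mu> + 1)" using s(1) C gamma by (intro mult_left_mono) auto
      then have "r n * \<mu> \<le> \<gamma> / 2" using s(4) gamma by linarith
      then have "r n * (r n * \<mu>) \<le> r n * (\<gamma> / 2)" using s(1) by (intro mult_left_mono) auto
      then show ?thesis by (simp add: s(7) power2_eq_square algebra_simps)
    qed
    then have "(1 - \<gamma> * r n / 2 / 2) * \<eta> n \<le> (1 - \<mu> * \<eta> n / 2) * \<eta> n"
      using eta_pos[OF s(6)] by (intro mult_right_mono) auto
    with slow_mu[OF n] show "(1 - \<gamma> * r n / 2 / 2) * \<eta> n \<le> \<eta> (Suc n)" by linarith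
  qed
  then obtain K2 where K2: "\<And>n. n \<ge> N \<Longrightarrow> V n \<le> K2 * \<eta> n" by auto
  \<comment> \<open>as \<open>V\<close> is of order \<open>\<eta>\<close>, the inequality for \<open>A\<close> closes\<close>
  have "\<exists>K. \<forall>n\<ge>N. A n \<le> K * \<eta> n"
  proof (rule recursive_inequality_bound[where c = "\<lambda>n. \<mu> * \<eta> n" and ?K0.0 = "C * (K2 + 1) / \<mu>"])
    fix n assume n: "n \<ge> N"
    note s = small[OF n]
    show "0 \<le> \<mu> * \<eta> n \<and> \<mu> * \<eta> n \<le> 1" by (rule muN[OF n])
    show "\<eta> n > 0" by (rule eta_pos[OF s(6)])
    show "(1 - \<mu> * \<eta> n / 2) * \<eta> n \<le> \<eta> (Suc n)" by (rule slow_mu[OF n])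
    have "C * \<eta> n \<le> \<mu> / 4"
    proof -
      have "C * \<eta> n \<le> C * r n" using s C by (intro mult_left_mono) (auto simp: power2_eq_square mult_left_le_one_le)
      also have "\<dots> = r n * C" by simp
      also have "\<dots> \<le> r n * (C + C / \<gamma> + \<mu> * \<mu> + 1)" using s(1) C gamma by (intro mult_left_mono) auto
      finally show ?thesis using s(5) by linarith
    qed
    then have "C * \<eta> n * \<eta> n \<le> \<mu> / 4 * \<eta> n" using eta_pos[OF s(6)] by (intro mult_right_mono) auto
    then have "C * (\<eta> n)\<^sup>2 \<le> 1 / 2 * \<mu> * \<eta> n"
      using mult_pos_pos[OF mu eta_pos[OF s(6)]] by (simp add: power2_eq_square algebra_simps)
    then have "(1 - 3 / 2 * \<mu> * \<eta> n + C * (\<eta> n)\<^sup>2) * A n \<le> (1 - \<mu> * \<eta> n) * A n"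
      using A0 by (intro mult_right_mono) auto
    moreover have "C * \<eta> n * V n \<le> C * \<eta> n * (K2 * \<eta> n)"
      using K2[OF n] C eta_pos[OF s(6)] by (intro mult_left_mono) auto
    moreover have "C * \<eta> n * (K2 * \<eta> n) + C * (\<eta> n)\<^sup>2 = C * (K2 + 1) / \<mu> * (\<mu> * \<eta> n * \<eta> n)"
      using mu by (simp add: power2_eq_square field_simps)
    ultimately show "A (Suc n) \<le> (1 - \<mu> * \<eta> n) * A n + C * (K2 + 1) / \<mu> * (\<mu> * \<eta> n * \<eta> n)"
      using A[OF s(6)] by linarith
  qed
  then obtain K3 where K3: "\<forall>n\<ge>N. A n \<le> K3 * \<eta> n" by auto
  obtain KA where KA: "KA \<ge> 0" "\<forall>n\<ge>1. A n \<le> KA * \<eta> n"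
    using eventually_bound_imp_bound[OF K3 eta_pos] by blast
  have "\<forall>n\<ge>N. V n \<le> K2 * \<eta> n" using K2 by blast
  from eventually_bound_imp_bound[OF this eta_pos]
  obtain KV where KV: "KV \<ge> 0" "\<forall>n\<ge>1. V n \<le> KV * \<eta> n" by blast
  show ?thesis
  proof (intro exI[of _ "KA + KV"] conjI allI impI)
    show "KA + KV \<ge> 0" using KA KV by simp
    fix n :: nat assume n: "n \<ge> 1"
    have "0 \<le> KA * \<eta> n" "0 \<le> KV * \<eta> n" using KA(1) KV(1) eta_pos[OF n] by auto
    then show "A n \<le> (KA + KV) * \<eta> n" "V n \<le> (KA + KV) * \<eta> n"
      using KA(2) KV(2) n by (auto simp: distrib_right intro: order_trans add_increasing add_increasing2)
  qed
qed

end

section \<open>Square-integrable random vectors\<close>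

lemma borel_measurable_matrix_vector_mult [measurable (raw)]:
  fixes B :: "real^'n^'m"
  assumes "f \<in> borel_measurable M"
  shows "(\<lambda>s. B *v f s) \<in> borel_measurable M"
  by (rule borel_measurable_continuous_on[OF _ assms])
    (intro linear_continuous_on matrix_vector_mul_bounded_linear)

context prob_space
begin

text \<open>
  Closed under the linear operations that define one step of the algorithm, so that integrability of all
  first- and second-order expressions is obtained compositionally.
\<close>

definition square_integrable :: "('a \<Rightarrow> 'b::{second_countable_topology,real_normed_vector}) \<Rightarrow> bool" where
  "square_integrable f \<longleftrightarrow> f \<in> borel_measurable M \<and> integrable M (\<lambda>s. (norm (f s))\<^sup>2)"

lemma square_integrable_dominated:
  fixes f :: "'a \<Rightarrow> 'b::{second_countable_topology,real_normed_vector}"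
    and g :: "'a \<Rightarrow> 'c::{second_countable_topology,real_normed_vector}"
  assumes g: "square_integrable g" and f: "f \<in> borel_measurable M"
    and le: "\<And>s. s \<in> space M \<Longrightarrow> norm (f s) \<le> a + b * norm (g s)"
  shows "square_integrable f"
  unfolding square_integrable_def
proof
  show "integrable M (\<lambda>s. (norm (f s))\<^sup>2)"
  proof (rule Bochner_Integration.integrable_bound)
    show "integrable M (\<lambda>s. 2 * a\<^sup>2 + 2 * b\<^sup>2 * (norm (g s))\<^sup>2)"
      using g by (auto simp: square_integrable_def)
    show "AE s in M. norm ((norm (f s))\<^sup>2) \<le> norm (2 * a\<^sup>2 + 2 * b\<^sup>2 * (norm (g s))\<^sup>2)"
    proof (rule AE_I2)
      fix s assume s: "s \<in> space M"
      have "(norm (f s))\<^sup>2 \<le> (a + b * norm (g s))\<^sup>2" using le[OF s] by (intro power_mono) auto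
      also have "\<dots> \<le> 2 * a\<^sup>2 + 2 * b\<^sup>2 * (norm (g s))\<^sup>2"
        using sum_squares_bound[of a "b * norm (g s)"] by (simp add: power2_sum power_mult_distrib)
      finally show "norm ((norm (f s))\<^sup>2) \<le> norm (2 * a\<^sup>2 + 2 * b\<^sup>2 * (norm (g s))\<^sup>2)" by simp
    qed
  qed (use f in measurable)
qed (rule f)

lemma square_integrable_add:
  fixes f g :: "'a \<Rightarrow> 'b::{second_countable_topology,real_normed_vector}"
  assumes f: "square_integrable f" and g: "square_integrable g"
  shows "square_integrable (\<lambda>s. f s + g s)"
  unfolding square_integrable_def
proof
  have m: "f \<in> borel_measurable M" "g \<in> borel_measurable M" using f g by (auto simp: square_integrable_def)
  then show fg: "(\<lambda>s. f s + g s) \<in> borel_measurable M" by simp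
  show "integrable M (\<lambda>s. (norm (f s + g s))\<^sup>2)"
  proof (rule Bochner_Integration.integrable_bound)
    show "integrable M (\<lambda>s. 2 * (norm (f s))\<^sup>2 + 2 * (norm (g s))\<^sup>2)"
      using f g by (auto simp: square_integrable_def)
    show "AE s in M. norm ((norm (f s + g s))\<^sup>2) \<le> norm (2 * (norm (f s))\<^sup>2 + 2 * (norm (g s))\<^sup>2)"
    proof (rule AE_I2)
      fix s
      have "(norm (f s + g s))\<^sup>2 \<le> (norm (f s) + norm (g s))\<^sup>2"
        by (intro power_mono norm_triangle_ineq) auto
      also have "\<dots> \<le> 2 * (norm (f s))\<^sup>2 + 2 * (norm (g s))\<^sup>2"
        using sum_squares_bound[of "norm (f s)" "norm (g s)"] by (simp add: power2_sum)
      finally show "norm ((norm (f s + g s))\<^sup>2) \<le> norm (2 * (norm (f s))\<^sup>2 + 2 * (norm (g s))\<^sup>2)" by simp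
    qed
  qed (use fg in measurable)
qed

lemma square_integrable_scaleR:
  fixes f :: "'a \<Rightarrow> 'b::{second_countable_topology,real_normed_vector}"
  assumes "square_integrable f"
  shows "square_integrable (\<lambda>s. c *\<^sub>R f s)"
  by (rule square_integrable_dominated[OF assms, of _ 0 "\<bar>c\<bar>"])
    (use assms in \<open>auto simp: square_integrable_def\<close>)

lemma square_integrable_const: "square_integrable (\<lambda>_. c)"
  by (simp add: square_integrable_def)

lemma square_integrable_diff:
  fixes f g :: "'a \<Rightarrow> 'b::{second_countable_topology,real_normed_vector}"
  assumes "square_integrable f" "square_integrable g"
  shows "square_integrable (\<lambda>s. f s - g s)"
  using square_integrable_add[OF assms(1) square_integrable_scaleR[OF assms(2), of "-1"]] by simp

lemma square_integrable_matrix: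
  fixes f :: "'a \<Rightarrow> real^'n" and B :: "real^'n^'m"
  assumes f: "square_integrable f"
  shows "square_integrable (\<lambda>s. B *v f s)"
  by (rule square_integrable_dominated[OF f, of _ 0 "spectral_norm B"])
    (use f norm_matrix_vector_mult_le_spectral_norm in \<open>auto simp: square_integrable_def\<close>)

lemma square_integrable_imp_integrable_mult:
  fixes f :: "'a \<Rightarrow> 'b::{second_countable_topology,real_normed_vector}"
    and g :: "'a \<Rightarrow> 'c::{second_countable_topology,real_normed_vector}"
    and h :: "'a \<Rightarrow> 'd::{banach,second_countable_topology}"
  assumes f: "square_integrable f" and g: "square_integrable g"
    and h: "h \<in> borel_measurable M" and le: "\<And>s. s \<in> space M \<Longrightarrow> norm (h s) \<le> norm (f s) * norm (g s)"
  shows "integrable M h"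
proof (rule Bochner_Integration.integrable_bound[OF _ h])
  show "integrable M (\<lambda>s. (norm (f s))\<^sup>2 + (norm (g s))\<^sup>2)"
    using f g by (auto simp: square_integrable_def)
  show "AE s in M. norm (h s) \<le> norm ((norm (f s))\<^sup>2 + (norm (g s))\<^sup>2)"
  proof (rule AE_I2)
    fix s assume "s \<in> space M"
    then have "norm (h s) \<le> norm (f s) * norm (g s)" by (rule le)
    also have "\<dots> \<le> (norm (f s))\<^sup>2 + (norm (g s))\<^sup>2"
      using sum_squares_bound[of "norm (f s)" "norm (g s)"]
        mult_nonneg_nonneg[OF norm_ge_zero[of "f s"] norm_ge_zero[of "g s"]] by linarith
    finally show "norm (h s) \<le> norm ((norm (f s))\<^sup>2 + (norm (g s))\<^sup>2)" by simp
  qed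
qed

lemma square_integrable_imp_integrable:
  fixes f :: "'a \<Rightarrow> 'b::{banach,second_countable_topology}"
  assumes f: "square_integrable f"
  shows "integrable M f"
proof (rule square_integrable_imp_integrable_mult[OF f square_integrable_const[of "1::real"]])
  show "f \<in> borel_measurable M" using f by (simp add: square_integrable_def)
qed simp

lemma square_integrable_inner:
  fixes f g :: "'a \<Rightarrow> 'b::euclidean_space"
  assumes "square_integrable f" "square_integrable g"
  shows "integrable M (\<lambda>s. f s \<bullet> g s)"
  by (rule square_integrable_imp_integrable_mult[OF assms])
    (use assms Cauchy_Schwarz_ineq2 in \<open>auto simp: square_integrable_def\<close>)

text \<open>
  The free weight \<open>c\<close> replaces the Cauchy--Schwarz inequality when the orders of the two factors are known.
\<close>

lemma expectation_mult_le:
  fixes f g :: "'a \<Rightarrow> real"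
  assumes f: "square_integrable f" and g: "square_integrable g" and c: "c > 0"
  shows "expectation (\<lambda>s. \<bar>f s\<bar> * \<bar>g s\<bar>) \<le> (c * expectation (\<lambda>s. (f s)\<^sup>2) + expectation (\<lambda>s. (g s)\<^sup>2) / c) / 2"
proof -
  have i: "integrable M (\<lambda>s. (f s)\<^sup>2)" "integrable M (\<lambda>s. (g s)\<^sup>2)"
    using f g by (auto simp: square_integrable_def)
  have "expectation (\<lambda>s. \<bar>f s\<bar> * \<bar>g s\<bar>) \<le> expectation (\<lambda>s. (c * (f s)\<^sup>2 + (g s)\<^sup>2 / c) / 2)"
  proof (rule integral_mono)
    show "integrable M (\<lambda>s. \<bar>f s\<bar> * \<bar>g s\<bar>)"
      by (rule square_integrable_imp_integrable_mult[OF f g]) (use f g in \<open>auto simp: square_integrable_def abs_mult\<close>)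
    show "integrable M (\<lambda>s. (c * (f s)\<^sup>2 + (g s)\<^sup>2 / c) / 2)" using i by auto
    fix s
    have "0 \<le> (c * \<bar>f s\<bar> - \<bar>g s\<bar>)\<^sup>2 / c" using c by simp
    also have "\<dots> = c * (f s)\<^sup>2 + (g s)\<^sup>2 / c - 2 * (\<bar>f s\<bar> * \<bar>g s\<bar>)"
      using c by (simp add: power2_diff field_simps power2_eq_square)
    finally show "\<bar>f s\<bar> * \<bar>g s\<bar> \<le> (c * (f s)\<^sup>2 + (g s)\<^sup>2 / c) / 2" by simp
  qed
  also have "\<dots> = (c * expectation (\<lambda>s. (f s)\<^sup>2) + expectation (\<lambda>s. (g s)\<^sup>2) / c) / 2"
    using i by simp
  finally show ?thesis .
qed

end

section \<open>The setting of the limit theorem\<close>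

text \<open>
  The hypotheses of the limit theorem in the form used below. \<open>P\<close> is any orthogonal projection, \<open>xs\<close> a point of
  its range at which the gradient is orthogonal to the range, strong convexity enters as strong monotonicity of
  the gradient, and the constant \<open>\<kappa>\<^sub>q\<close> bounds the \<open>q\<close>-th moments of the gradient noise.
\<close>

locale lpsa_clt = lpsa_chain D M P gF \<eta> p \<zeta> \<omega> x1 x + step_sizes \<eta> p \<eta>\<^sub>0 \<alpha> \<gamma> \<mu>
  for D :: "'z measure" and M :: "'w measure" and P :: "real^'d^'d" and gF \<eta> p \<zeta> \<omega> x1 x \<eta>\<^sub>0 \<alpha> \<gamma> \<mu> +
  fixes gf :: "real^'d \<Rightarrow> real^'d" and hess \<Sigma> :: "real^'d \<Rightarrow> real^'d^'d" and xs :: "real^'d" and L L' q \<kappa>\<^sub>q :: real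
  assumes P_sym: "transpose P = P" and P_idem: "\<And>y. P *v (P *v y) = P *v y"
    and P_xs: "P *v xs = xs" and P_gs: "P *v gf xs = 0"
    and unbiased: "\<And>y. integrable D (gF y)" "\<And>y. (\<integral>z. gF y z \<partial>D) = gf y"
    and gF_square: "\<And>y. integrable D (\<lambda>z. (norm (gF y z))\<^sup>2)"
    and Sigma: "\<And>y. \<Sigma> y = covariance_matrix D (gF y)"
    and smooth: "\<And>y z. norm (gf y - gf z) \<le> L * norm (y - z)" and L0: "L \<ge> 0"
    and hess: "\<And>y. (gf has_derivative (\<lambda>h. hess y *v h)) (at y)"
    and hess_lipschitz: "\<And>y z. spectral_norm (hess y - hess z) \<le> L' * norm (y - z)" and L'0: "L' \<ge> 0"
    and hess_sym: "transpose (hess xs) = hess xs"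
    and monotone: "\<And>y z. \<mu> * (norm (y - z))\<^sup>2 \<le> (gf y - gf z) \<bullet> (y - z)"
    and Sigma_lipschitz: "\<And>y z. spectral_norm (\<Sigma> y - \<Sigma> z) \<le> L * norm (y - z)"
    and q2: "q > 2" and kq: "\<kappa>\<^sub>q \<ge> 0"
    and noise: "\<And>n. n \<ge> 1 \<Longrightarrow>
      (\<integral>\<^sup>+ s. ennreal (norm (gf (x n s) - gF (x n s) (\<zeta> n s)) powr q) \<partial>M) \<le> ennreal \<kappa>\<^sub>q"
begin

abbreviation "G \<equiv> hess xs"
abbreviation "gs \<equiv> gf xs"
abbreviation "E \<equiv> M.expectation"
abbreviation mean_square :: "('w \<Rightarrow> real^'d) \<Rightarrow> real" where "mean_square f \<equiv> E (\<lambda>s. (norm (f s))\<^sup>2)"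
abbreviation mean_norm :: "('w \<Rightarrow> real^'d) \<Rightarrow> real" where "mean_norm f \<equiv> E (\<lambda>s. norm (f s))"

definition xi :: "nat \<Rightarrow> 'w \<Rightarrow> real^'d" where "xi n s = gf (x n s) - gF (x n s) (\<zeta> n s)"
definition Q :: "real^'d^'d" where "Q = mat 1 - P"
definition a :: "nat \<Rightarrow> 'w \<Rightarrow> real^'d" where "a n s = P *v x n s - xs"
definition v :: "nat \<Rightarrow> 'w \<Rightarrow> real^'d" where "v n s = Q *v x n s"

lemma Q_mult: "Q *v y = y - P *v y"
  by (simp add: Q_def matrix_vector_mult_diff_rdistrib)

lemma PQ: "P *v (Q *v y) = 0" "Q *v (P *v y) = 0"
  by (simp_all add: Q_mult P_idem matrix_vector_mult_diff_distrib)

lemma P_inner: "(P *v y) \<bullet> z = y \<bullet> (P *v z)"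
  by (rule inner_matrix_vector_symmetric[OF P_sym])

lemma G_inner: "(G *v y) \<bullet> z = y \<bullet> (G *v z)"
  by (rule inner_matrix_vector_symmetric[OF hess_sym])

lemma pythagoras: "(norm y)\<^sup>2 = (norm (P *v y))\<^sup>2 + (norm (Q *v y))\<^sup>2"
proof -
  have "(P *v y) \<bullet> (Q *v y) = 0" by (simp add: P_inner PQ)
  then show ?thesis
    using norm_add_Pythagorean[of "P *v y" "Q *v y"] by (simp add: orthogonal_def Q_mult)
qed

lemma norm_P: "norm (P *v y) \<le> norm y" and norm_Q: "norm (Q *v y) \<le> norm y"
proof -
  have "(norm (P *v y))\<^sup>2 \<le> (norm y)\<^sup>2" "(norm (Q *v y))\<^sup>2 \<le> (norm y)\<^sup>2"
    unfolding pythagoras[of y] by simp_all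
  then show "norm (P *v y) \<le> norm y" "norm (Q *v y) \<le> norm y"
    by (simp_all only: power2_le_imp_le[OF _ norm_ge_zero])
qed

lemma x_decomp: "x n s - xs = a n s + v n s"
  by (simp add: a_def v_def Q_mult)

lemma norm_x_decomp: "(norm (x n s - xs))\<^sup>2 = (norm (a n s))\<^sup>2 + (norm (v n s))\<^sup>2"
proof -
  have "P *v (x n s - xs) = a n s" "Q *v (x n s - xs) = v n s"
    by (simp_all add: a_def v_def Q_mult matrix_vector_mult_diff_distrib P_xs)
  then show ?thesis using pythagoras[of "x n s - xs"] by simp
qed

lemma P_a: "P *v a n s = a n s"
  by (simp add: a_def matrix_vector_mult_diff_distrib P_idem P_xs)

lemma Q_gs: "Q *v gs = gs"
  by (simp add: Q_mult P_gs)

lemma gf_continuous: "continuous_on UNIV gf"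
  using hess by (meson continuous_at_imp_continuous_on has_derivative_continuous)

lemma gf_measurable [measurable]: "gf \<in> borel_measurable borel"
  by (rule borel_measurable_continuous_onI[OF gf_continuous])

lemma x_measurable: "n \<ge> 1 \<Longrightarrow> x n \<in> borel_measurable M"
  by (rule iterate_measurable)

lemma gF_x_measurable: "n \<ge> 1 \<Longrightarrow> (\<lambda>s. gF (x n s) (\<zeta> n s)) \<in> borel_measurable M"
  using measurable_compose[OF measurable_Pair[OF x_measurable zeta_measurable] gF_measurable] by simp

lemma xi_measurable: "n \<ge> 1 \<Longrightarrow> xi n \<in> borel_measurable M"
  unfolding xi_def[abs_def] using x_measurable[of n] gF_x_measurable[of n] by measurable

text \<open>
  Bounds the moments of the gradient noise of every order up to \<open>q\<close>.
\<close>

definition \<kappa>\<^sub>2 :: real where "\<kappa>\<^sub>2 = 1 + \<kappa>\<^sub>q"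

lemma xi_powr_integrable:
  assumes n: "n \<ge> 1"
  shows "integrable M (\<lambda>s. norm (xi n s) powr q)" "E (\<lambda>s. norm (xi n s) powr q) \<le> \<kappa>\<^sub>q"
proof -
  have m: "(\<lambda>s. norm (xi n s) powr q) \<in> borel_measurable M" using xi_measurable[OF n] by measurable
  have le: "(\<integral>\<^sup>+ s. ennreal (norm (xi n s) powr q) \<partial>M) \<le> ennreal \<kappa>\<^sub>q"
    using noise[OF n] by (simp add: xi_def)
  show i: "integrable M (\<lambda>s. norm (xi n s) powr q)"
    by (rule integrableI_bounded[OF m]) (use le in \<open>auto simp: less_top[symmetric] top_unique\<close>)
  then show "E (\<lambda>s. norm (xi n s) powr q) \<le> \<kappa>\<^sub>q"
    using le kq by (simp add: nn_integral_eq_integral)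
qed

lemma xi_moment:
  assumes n: "n \<ge> 1" and r: "0 < r" "r \<le> q"
  shows "integrable M (\<lambda>s. norm (xi n s) powr r)" "E (\<lambda>s. norm (xi n s) powr r) \<le> \<kappa>\<^sub>2"
proof -
  have le: "norm (xi n s) powr r \<le> 1 + norm (xi n s) powr q" for s
  proof (cases "norm (xi n s) \<le> 1")
    case True
    then have "norm (xi n s) powr r \<le> 1" using r by (simp add: powr_le1)
    then show ?thesis by (simp add: add_increasing2)
  next
    case False
    then have "norm (xi n s) powr r \<le> norm (xi n s) powr q" using r by (intro powr_mono) auto
    then show ?thesis by simp
  qed
  have int: "integrable M (\<lambda>s. 1 + norm (xi n s) powr q)" using xi_powr_integrable[OF n] by simp
  have m: "(\<lambda>s. norm (xi n s) powr r) \<in> borel_measurable M" using xi_measurable[OF n] by measurable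
  show i: "integrable M (\<lambda>s. norm (xi n s) powr r)"
    by (rule Bochner_Integration.integrable_bound[OF int m]) (use le in \<open>auto simp: add_nonneg_nonneg\<close>)
  have "E (\<lambda>s. norm (xi n s) powr r) \<le> E (\<lambda>s. 1 + norm (xi n s) powr q)"
    by (rule integral_mono[OF i int]) (rule le)
  also have "\<dots> \<le> \<kappa>\<^sub>2" using xi_powr_integrable[OF n] by (simp add: \<kappa>\<^sub>2_def M.prob_space)
  finally show "E (\<lambda>s. norm (xi n s) powr r) \<le> \<kappa>\<^sub>2" .
qed

lemma xi_square:
  assumes n: "n \<ge> 1"
  shows "M.square_integrable (xi n)" "mean_square (xi n) \<le> \<kappa>\<^sub>2"
  using xi_moment[OF n, of 2] q2 xi_measurable[OF n] by (simp_all add: M.square_integrable_def)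

lemma kappa2: "\<kappa>\<^sub>2 \<ge> 1"
  using kq by (simp add: \<kappa>\<^sub>2_def)

lemma norm_gf: "norm (gf y) \<le> norm gs + L * norm (y - xs)"
  using norm_triangle_ineq[of gs "gf y - gs"] smooth[of y xs] by simp

lemma gf_square_integrable:
  assumes "M.square_integrable (x n)" "n \<ge> 1"
  shows "M.square_integrable (\<lambda>s. gf (x n s))"
proof (rule M.square_integrable_dominated)
  show "M.square_integrable (\<lambda>s. x n s - xs)"
    by (rule M.square_integrable_diff[OF assms(1) M.square_integrable_const])
  show "(\<lambda>s. gf (x n s)) \<in> borel_measurable M" using x_measurable[OF assms(2)] by measurable
  show "norm (gf (x n s)) \<le> norm gs + L * norm (x n s - xs)" for s by (rule norm_gf)
qed

lemma x_square_integrable: "n \<ge> 1 \<Longrightarrow> M.square_integrable (x n)"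
proof (induction n rule: nat_induct_at_least)
  case base
  have "integrable M (\<lambda>s. (norm (x 1 s))\<^sup>2) \<longleftrightarrow> integrable M (\<lambda>s. (norm x1)\<^sup>2)"
    by (rule Bochner_Integration.integrable_cong) (simp_all add: x_initial)
  then show ?case using x_measurable[of 1] by (simp add: M.square_integrable_def)
next
  case (Suc n)
  define half where "half s = x n s - \<eta> n *\<^sub>R (gf (x n s) - xi n s)" for s
  have "M.square_integrable half"
    unfolding half_def
    by (intro M.square_integrable_diff M.square_integrable_scaleR Suc.IH gf_square_integrable xi_square Suc.hyps)
  then show ?case
  proof (rule M.square_integrable_dominated[where a = 0 and b = 1])
    show "x (Suc n) \<in> borel_measurable M" using x_measurable[of "Suc n"] by simp
    fix s assume "s \<in> space M"
    then have "x (Suc n) s = (if \<omega> n s then P *v half s else half s)"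
      using x_step Suc.hyps by (simp add: half_def xi_def)
    then show "norm (x (Suc n) s) \<le> 0 + 1 * norm (half s)" using norm_P by simp
  qed
qed

lemmas gf_x_square = gf_square_integrable[OF x_square_integrable]

lemma a_square: "n \<ge> 1 \<Longrightarrow> M.square_integrable (a n)"
  unfolding a_def[abs_def]
  by (intro M.square_integrable_diff M.square_integrable_matrix x_square_integrable M.square_integrable_const)

lemma v_square: "n \<ge> 1 \<Longrightarrow> M.square_integrable (v n)"
  unfolding v_def[abs_def]
  by (intro M.square_integrable_matrix x_square_integrable)

text \<open>
  The orthogonal component after a noiseless step without projection.
\<close>

definition w :: "nat \<Rightarrow> 'w \<Rightarrow> real^'d" where "w n s = v n s - \<eta> n *\<^sub>R (Q *v gf (x n s))"

lemma w_square: "n \<ge> 1 \<Longrightarrow> M.square_integrable (w n)"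
  unfolding w_def[abs_def]
  by (intro M.square_integrable_diff M.square_integrable_scaleR M.square_integrable_matrix v_square gf_x_square)

lemma a_step: "n \<ge> 1 \<Longrightarrow> s \<in> space M \<Longrightarrow>
    a (Suc n) s = (a n s - \<eta> n *\<^sub>R (P *v gf (x n s))) + \<eta> n *\<^sub>R (P *v xi n s)"
  by (simp add: a_def x_step xi_def matrix_vector_mult_diff_distrib matrix_vector_mult_scaleR P_idem algebra_simps)

lemma v_step: "n \<ge> 1 \<Longrightarrow> s \<in> space M \<Longrightarrow>
    v (Suc n) s = (if \<omega> n s then 0 else w n s + \<eta> n *\<^sub>R (Q *v xi n s))"
  by (simp add: v_def w_def x_step xi_def matrix_vector_mult_diff_distrib matrix_vector_mult_scaleR PQ algebra_simps)

text \<open>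
  The gradient noise has mean zero given the iterate and is independent of the projection step. The general
  form, with values in a Banach space, covers both the real cross terms in the second moments and the complex ones in
  the characteristic functions.
\<close>

lemma noise_orthogonal:
  fixes T :: "real^'d \<Rightarrow> real^'d \<Rightarrow> 'b::{banach,second_countable_topology}"
  assumes n: "n \<ge> 1" and lin: "\<And>y. bounded_linear (T y)"
    and T: "(\<lambda>(y, u). T y u) \<in> borel_measurable (borel \<Otimes>\<^sub>M borel)"
    and int: "integrable M (\<lambda>s. \<psi> (\<omega> n s) *\<^sub>R T (x n s) (xi n s))"
  shows "(\<integral>s. \<psi> (\<omega> n s) *\<^sub>R T (x n s) (xi n s) \<partial>M) = 0"
proof -
  define h where "h y z b = \<psi> b *\<^sub>R T y (gf y - gF y z)" for y z b
  have h: "(\<lambda>(y, z). h y z b) \<in> borel_measurable (borel \<Otimes>\<^sub>M D)" for b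
  proof -
    have 1: "(\<lambda>w. gF (fst w) (snd w)) \<in> borel_measurable (borel \<Otimes>\<^sub>M D)"
      using gF_measurable by (simp add: case_prod_unfold)
    have "(\<lambda>w. (fst w, gf (fst w) - gF (fst w) (snd w))) \<in> measurable (borel \<Otimes>\<^sub>M D) (borel \<Otimes>\<^sub>M borel)"
      using 1 by measurable
    from measurable_compose[OF this T] show ?thesis by (simp add: h_def case_prod_unfold)
  qed
  have inner_zero: "(\<integral>z. p n *\<^sub>R h y z True + (1 - p n) *\<^sub>R h y z False \<partial>D) = 0" for y
  proof -
    have "(\<integral>z. T y (gf y - gF y z) \<partial>D) = T y (\<integral>z. gf y - gF y z \<partial>D)"
      by (rule integral_bounded_linear[OF lin]) (use unbiased in simp)
    also have "\<dots> = 0"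
      using unbiased bounded_linear.linear[OF lin, of y] by (simp add: D.prob_space linear_0)
    finally have 0: "(\<integral>z. T y (gf y - gF y z) \<partial>D) = 0" .
    have "(\<integral>z. p n *\<^sub>R h y z True + (1 - p n) *\<^sub>R h y z False \<partial>D)
       = (\<integral>z. (p n * \<psi> True + (1 - p n) * \<psi> False) *\<^sub>R T y (gf y - gF y z) \<partial>D)"
      by (simp add: h_def scaleR_add_left)
    also have "\<dots> = 0" using 0 by simp
    finally show ?thesis .
  qed
  have "(\<integral>s. h (x n s) (\<zeta> n s) (\<omega> n s) \<partial>M)
      = (\<integral>s. (\<integral>z. p n *\<^sub>R h (x n s) z True + (1 - p n) *\<^sub>R h (x n s) z False \<partial>D) \<partial>M)"
    by (rule expectation_step[OF n h]) (use int in \<open>simp add: h_def xi_def\<close>)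
  also have "\<dots> = 0" unfolding inner_zero by simp
  finally show ?thesis by (simp add: h_def xi_def)
qed

lemma projection_step_factor:
  fixes h :: "real^'d \<Rightarrow> 'z \<Rightarrow> 'b::{banach,second_countable_topology}"
  assumes n: "n \<ge> 1" and h: "(\<lambda>(y, z). h y z) \<in> borel_measurable (borel \<Otimes>\<^sub>M D)"
    and int: "integrable M (\<lambda>s. h (x n s) (\<zeta> n s))"
  shows "integrable M (\<lambda>s. \<psi> (\<omega> n s) *\<^sub>R h (x n s) (\<zeta> n s))"
    "(\<integral>s. \<psi> (\<omega> n s) *\<^sub>R h (x n s) (\<zeta> n s) \<partial>M)
      = (p n * \<psi> True + (1 - p n) * \<psi> False) *\<^sub>R (\<integral>s. h (x n s) (\<zeta> n s) \<partial>M)"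
proof -
  have wm: "(\<lambda>s. \<psi> (\<omega> n s)) \<in> borel_measurable M"
    using measurable_compose[OF omega_measurable[OF n], of \<psi> borel] by simp
  have hm: "(\<lambda>s. h (x n s) (\<zeta> n s)) \<in> borel_measurable M" using int by simp
  have b: "\<bar>\<psi> b\<bar> \<le> \<bar>\<psi> True\<bar> + \<bar>\<psi> False\<bar>" for b by (cases b) auto
  show i: "integrable M (\<lambda>s. \<psi> (\<omega> n s) *\<^sub>R h (x n s) (\<zeta> n s))"
  proof (rule Bochner_Integration.integrable_bound)
    show "integrable M (\<lambda>s. (\<bar>\<psi> True\<bar> + \<bar>\<psi> False\<bar>) *\<^sub>R h (x n s) (\<zeta> n s))" using int by simp
    show "(\<lambda>s. \<psi> (\<omega> n s) *\<^sub>R h (x n s) (\<zeta> n s)) \<in> borel_measurable M" using wm hm by measurable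
    show "AE s in M. norm (\<psi> (\<omega> n s) *\<^sub>R h (x n s) (\<zeta> n s)) \<le> norm ((\<bar>\<psi> True\<bar> + \<bar>\<psi> False\<bar>) *\<^sub>R h (x n s) (\<zeta> n s))"
      using b by (intro AE_I2) (auto intro!: mult_right_mono)
  qed
  have 1: "(\<integral>s. \<psi> (\<omega> n s) *\<^sub>R h (x n s) (\<zeta> n s) \<partial>M)
    = (\<integral>s. (\<integral>z. p n *\<^sub>R (\<psi> True *\<^sub>R h (x n s) z) + (1 - p n) *\<^sub>R (\<psi> False *\<^sub>R h (x n s) z) \<partial>D) \<partial>M)"
    by (rule expectation_step[OF n, of "\<lambda>y z b. \<psi> b *\<^sub>R h y z"]) (use h i in \<open>auto simp: case_prod_unfold\<close>)
  have 2: "(\<integral>s. h (x n s) (\<zeta> n s) \<partial>M) = (\<integral>s. (\<integral>z. p n *\<^sub>R h (x n s) z + (1 - p n) *\<^sub>R h (x n s) z \<partial>D) \<partial>M)"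
    by (rule expectation_step[OF n, of "\<lambda>y z b. h y z"]) (use h int in auto)
  show "(\<integral>s. \<psi> (\<omega> n s) *\<^sub>R h (x n s) (\<zeta> n s) \<partial>M)
      = (p n * \<psi> True + (1 - p n) * \<psi> False) *\<^sub>R (\<integral>s. h (x n s) (\<zeta> n s) \<partial>M)"
    unfolding 1 2 by (simp add: scaleR_add_left[symmetric])
qed

lemma covariance_quadratic:
  "(\<integral>z. (t \<bullet> (gf y - gF y z))\<^sup>2 \<partial>D) = t \<bullet> (\<Sigma> y *v t)"
proof -
  have sq: "D.square_integrable (\<lambda>z. gF y z - gf y)"
    by (intro D.square_integrable_diff D.square_integrable_const)
      (use gF_square unbiased in \<open>auto simp: D.square_integrable_def\<close>)
  have comp: "D.square_integrable (\<lambda>z. (gF y z - gf y) $ i)" for i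
  proof (rule D.square_integrable_dominated[OF sq, of _ 0 1])
    have "(\<lambda>z. (gF y z - gf y) \<bullet> axis i 1) \<in> borel_measurable D"
      using sq by (auto simp: D.square_integrable_def)
    then show "(\<lambda>z. (gF y z - gf y) $ i) \<in> borel_measurable D" by (simp add: inner_axis)
    show "norm ((gF y z - gf y) $ i) \<le> 0 + 1 * norm (gF y z - gf y)" for z
      using component_le_norm_cart[of "gF y z - gf y" i] by simp
  qed
  have int: "integrable D (\<lambda>z. (gF y z - gf y) $ i * (gF y z - gf y) $ j)" for i j
    by (rule D.square_integrable_imp_integrable_mult[OF comp[of i] comp[of j]])
      (use comp[of i] comp[of j] in \<open>auto simp: D.square_integrable_def abs_mult\<close>)
  have "(t \<bullet> (gf y - gF y z))\<^sup>2 = (\<Sum>i\<in>UNIV. \<Sum>j\<in>UNIV. t $ i * t $ j * ((gF y z - gf y) $ i * (gF y z - gf y) $ j))" for z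
  proof -
    have "(t \<bullet> (gf y - gF y z))\<^sup>2 = (t \<bullet> (gF y z - gf y))\<^sup>2"
      by (metis inner_minus_right minus_diff_eq power2_minus)
    also have "\<dots> = (\<Sum>i\<in>UNIV. \<Sum>j\<in>UNIV. (t $ i * (gF y z - gf y) $ i) * (t $ j * (gF y z - gf y) $ j))"
      unfolding power2_eq_square inner_vec_def by (simp add: sum_product)
    also have "\<dots> = (\<Sum>i\<in>UNIV. \<Sum>j\<in>UNIV. t $ i * t $ j * ((gF y z - gf y) $ i * (gF y z - gf y) $ j))"
      by (intro sum.cong refl) (simp add: mult_ac)
    finally show ?thesis .
  qed
  then have "(\<integral>z. (t \<bullet> (gf y - gF y z))\<^sup>2 \<partial>D)
     = (\<Sum>i\<in>UNIV. \<Sum>j\<in>UNIV. t $ i * t $ j * (\<integral>z. (gF y z - gf y) $ i * (gF y z - gf y) $ j \<partial>D))"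
    using int by (simp del: vector_minus_component)
  also have "\<dots> = t \<bullet> (\<Sigma> y *v t)"
    by (simp add: Sigma covariance_matrix_def unbiased inner_vec_def matrix_vector_mult_def sum_distrib_left mult_ac
        del: vector_minus_component)
  finally show ?thesis .
qed

end

section \<open>Second moments of the iterates\<close>

lemma norm_add_scaleR_square:
  fixes y z :: "'a::real_inner"
  shows "(norm (y + t *\<^sub>R z))\<^sup>2 = (norm y)\<^sup>2 + 2 * t * (y \<bullet> z) + t\<^sup>2 * (norm z)\<^sup>2"
  by (simp only: power2_norm_eq_inner inner_simps)
    (simp add: inner_commute power2_eq_square algebra_simps)

context lpsa_clt
begin

lemma eta_le: "n \<ge> 1 \<Longrightarrow> \<eta> n \<le> \<eta>\<^sub>0"
proof -
  assume "n \<ge> 1"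
  then have "real n powr (- \<alpha>) \<le> 1" using alpha by (simp add: powr_minus inverse_le_1_iff ge_one_powr_ge_zero)
  then show ?thesis using eta0(1) by (simp add: eta)
qed

lemma norm_gf_square: "(norm (gf (x n s)))\<^sup>2 \<le> 2 * (norm gs)\<^sup>2 + 2 * L\<^sup>2 * ((norm (a n s))\<^sup>2 + (norm (v n s))\<^sup>2)"
proof -
  have "(norm (gf (x n s)))\<^sup>2 \<le> (norm gs + L * norm (x n s - xs))\<^sup>2"
    using norm_gf by (intro power_mono) auto
  also have "\<dots> \<le> 2 * (norm gs)\<^sup>2 + 2 * (L * norm (x n s - xs))\<^sup>2"
    using sum_squares_bound[of "norm gs" "L * norm (x n s - xs)"] by (simp add: power2_sum)
  also have "(L * norm (x n s - xs))\<^sup>2 = L\<^sup>2 * ((norm (a n s))\<^sup>2 + (norm (v n s))\<^sup>2)"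
    by (simp add: power_mult_distrib norm_x_decomp)
  finally show ?thesis by simp
qed

lemma noise_cross_term_zero:
  assumes n: "n \<ge> 1" and c: "c \<in> borel_measurable borel" and sq: "M.square_integrable (\<lambda>s. c (x n s))"
  shows "E (\<lambda>s. c (x n s) \<bullet> (B *v xi n s)) = 0"
proof -
  have int: "integrable M (\<lambda>s. c (x n s) \<bullet> (B *v xi n s))"
    by (rule M.square_integrable_inner[OF sq M.square_integrable_matrix[OF xi_square(1)[OF n]]])
  have lin: "bounded_linear (\<lambda>u. c y \<bullet> (B *v u))" for y
    by (rule bounded_linear_compose[OF bounded_linear_inner_right matrix_vector_mul_bounded_linear])
  have "(\<integral>s. 1 *\<^sub>R (c (x n s) \<bullet> (B *v xi n s)) \<partial>M) = 0"
    by (rule noise_orthogonal[where \<psi> = "\<lambda>_. 1" and T = "\<lambda>y u. c y \<bullet> (B *v u)", OF n lin]) (use c int in \<open>simp_all add: case_prod_unfold\<close>)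
  then show ?thesis by simp
qed

lemma expected_square_plus_noise:
  assumes n: "n \<ge> 1" and c: "c \<in> borel_measurable borel" and sq: "M.square_integrable (\<lambda>s. c (x n s))"
    and B: "\<And>y. norm (B *v y) \<le> norm y"
  shows "integrable M (\<lambda>s. (norm (c (x n s) + \<eta> n *\<^sub>R (B *v xi n s)))\<^sup>2)"
    "E (\<lambda>s. (norm (c (x n s) + \<eta> n *\<^sub>R (B *v xi n s)))\<^sup>2) \<le> E (\<lambda>s. (norm (c (x n s)))\<^sup>2) + (\<eta> n)\<^sup>2 * \<kappa>\<^sub>2"
proof -
  have Bxi: "M.square_integrable (\<lambda>s. B *v xi n s)" by (rule M.square_integrable_matrix[OF xi_square(1)[OF n]])
  show "integrable M (\<lambda>s. (norm (c (x n s) + \<eta> n *\<^sub>R (B *v xi n s)))\<^sup>2)"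
    using M.square_integrable_add[OF sq M.square_integrable_scaleR[OF Bxi]] by (simp add: M.square_integrable_def)
  have i1: "integrable M (\<lambda>s. (norm (c (x n s)))\<^sup>2)" using sq by (simp add: M.square_integrable_def)
  have i2: "integrable M (\<lambda>s. c (x n s) \<bullet> (B *v xi n s))" by (rule M.square_integrable_inner[OF sq Bxi])
  have i3: "integrable M (\<lambda>s. (norm (B *v xi n s))\<^sup>2)" using Bxi by (simp add: M.square_integrable_def)
  have "(norm (c (x n s) + \<eta> n *\<^sub>R (B *v xi n s)))\<^sup>2
      = (norm (c (x n s)))\<^sup>2 + 2 * \<eta> n * (c (x n s) \<bullet> (B *v xi n s)) + (\<eta> n)\<^sup>2 * (norm (B *v xi n s))\<^sup>2" for s
    by (rule norm_add_scaleR_square)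
  then have "E (\<lambda>s. (norm (c (x n s) + \<eta> n *\<^sub>R (B *v xi n s)))\<^sup>2)
      = E (\<lambda>s. (norm (c (x n s)))\<^sup>2) + 2 * \<eta> n * E (\<lambda>s. c (x n s) \<bullet> (B *v xi n s)) + (\<eta> n)\<^sup>2 * E (\<lambda>s. (norm (B *v xi n s))\<^sup>2)"
    using i1 i2 i3 by simp
  also have "E (\<lambda>s. c (x n s) \<bullet> (B *v xi n s)) = 0" by (rule noise_cross_term_zero[OF n c sq])
  also have "E (\<lambda>s. (norm (B *v xi n s))\<^sup>2) \<le> mean_square (xi n)"
    by (rule integral_mono[OF i3]) (use xi_square[OF n] B in \<open>auto simp: M.square_integrable_def intro!: power_mono\<close>)
  also have "\<dots> \<le> \<kappa>\<^sub>2" by (rule xi_square(2)[OF n])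
  finally show "E (\<lambda>s. (norm (c (x n s) + \<eta> n *\<^sub>R (B *v xi n s)))\<^sup>2) \<le> E (\<lambda>s. (norm (c (x n s)))\<^sup>2) + (\<eta> n)\<^sup>2 * \<kappa>\<^sub>2"
    by (simp add: mult_left_mono)
qed

text \<open>
  In the constraint space the drift is \<open>a \<bullet> (\<nabla>f(x) - \<nabla>f(x\<^sup>\<star>))\<close>. Strong monotonicity is applied between
  \<open>x\<^sup>\<star>\<close> and the projected iterate; the Lipschitz constant pays for the orthogonal component, with a quarter of
  the contraction sacrificed to absorb the mixed term.
\<close>

lemma a_recursion:
  assumes n: "n \<ge> 1"
  shows "mean_square (a (Suc n)) \<le> (1 - 3 / 2 * \<mu> * \<eta> n + L\<^sup>2 * (\<eta> n)\<^sup>2) * mean_square (a n)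
     + (2 * L\<^sup>2 / \<mu> + L\<^sup>2 * \<eta>\<^sub>0) * \<eta> n * mean_square (v n) + \<kappa>\<^sub>2 * (\<eta> n)\<^sup>2"
proof -
  have e: "\<eta> n > 0" by (rule eta_pos[OF n])
  define c where "c y = (P *v y - xs) - \<eta> n *\<^sub>R (P *v gf y)" for y
  have c: "c \<in> borel_measurable borel" unfolding c_def[abs_def] by measurable
  have cx: "c (x n s) = a n s - \<eta> n *\<^sub>R (P *v gf (x n s))" for s by (simp add: c_def a_def)
  have sq: "M.square_integrable (\<lambda>s. c (x n s))" unfolding cx
    by (intro M.square_integrable_diff M.square_integrable_scaleR M.square_integrable_matrix a_square gf_x_square n)
  have ia: "integrable M (\<lambda>s. (norm (a n s))\<^sup>2)" "integrable M (\<lambda>s. (norm (v n s))\<^sup>2)"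
    using a_square[OF n] v_square[OF n] by (simp_all add: M.square_integrable_def)
  have pt: "(norm (c (x n s)))\<^sup>2 \<le> (1 - 3 / 2 * \<mu> * \<eta> n + L\<^sup>2 * (\<eta> n)\<^sup>2) * (norm (a n s))\<^sup>2
      + (2 * L\<^sup>2 / \<mu> + L\<^sup>2 * \<eta>\<^sub>0) * \<eta> n * (norm (v n s))\<^sup>2" for s
  proof -
    \<comment> \<open>the projected iterate\<close>
    define u where "u = xs + a n s"
    define A where "A = norm (a n s)"
    define V where "V = norm (v n s)"
    have ux: "x n s - u = v n s" "u - xs = a n s" using x_decomp[of n s] by (simp_all add: u_def algebra_simps)
    have agf: "a n s \<bullet> (P *v gf (x n s)) = a n s \<bullet> (gf (x n s) - gs)"
    proof -
      have "a n s \<bullet> (P *v gf (x n s)) = a n s \<bullet> gf (x n s)"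
        by (metis P_a P_inner)
      moreover have "a n s \<bullet> gs = 0" by (metis P_a P_gs P_inner inner_zero_right)
      ultimately show ?thesis by (simp add: inner_diff_right)
    qed
    have m1: "\<mu> * A\<^sup>2 \<le> a n s \<bullet> (gf u - gs)"
      using monotone[of u xs] by (simp add: ux A_def inner_commute)
    have "\<bar>a n s \<bullet> (gf (x n s) - gf u)\<bar> \<le> norm (a n s) * norm (gf (x n s) - gf u)"
      by (rule Cauchy_Schwarz_ineq2)
    also have "\<dots> \<le> A * (L * V)"
      using smooth[of "x n s" u] by (simp add: ux A_def V_def mult_left_mono)
    finally have m2: "\<bar>a n s \<bullet> (gf (x n s) - gf u)\<bar> \<le> A * (L * V)" .
    have m3: "A * (L * V) \<le> \<mu> / 4 * A\<^sup>2 + L\<^sup>2 / \<mu> * V\<^sup>2"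
    proof -
      have "0 \<le> (\<mu> / 2 * A - L * V)\<^sup>2 / \<mu>" using mu by simp
      also have "\<dots> = \<mu> / 4 * A\<^sup>2 + L\<^sup>2 / \<mu> * V\<^sup>2 - A * (L * V)"
        using mu by (simp add: power2_diff power_mult_distrib field_simps power2_eq_square)
      finally show ?thesis by simp
    qed
    have "a n s \<bullet> (gf (x n s) - gs) = a n s \<bullet> (gf u - gs) + a n s \<bullet> (gf (x n s) - gf u)"
      by (simp add: inner_diff_right)
    then have drift: "3 / 4 * \<mu> * A\<^sup>2 - L\<^sup>2 / \<mu> * V\<^sup>2 \<le> a n s \<bullet> (P *v gf (x n s))"
      using m1 m2 m3 agf by linarith
    have "norm (P *v gf (x n s)) = norm (P *v (gf (x n s) - gs))"
      by (simp add: matrix_vector_mult_diff_distrib P_gs)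
    also have "\<dots> \<le> L * norm (x n s - xs)" using norm_P smooth order_trans by blast
    finally have "(norm (P *v gf (x n s)))\<^sup>2 \<le> (L * norm (x n s - xs))\<^sup>2" by (rule power_mono) simp
    then have sqr: "(norm (P *v gf (x n s)))\<^sup>2 \<le> L\<^sup>2 * (A\<^sup>2 + V\<^sup>2)"
      by (simp add: power_mult_distrib norm_x_decomp A_def V_def)
    have "(norm (c (x n s)))\<^sup>2 = A\<^sup>2 - 2 * \<eta> n * (a n s \<bullet> (P *v gf (x n s))) + (\<eta> n)\<^sup>2 * (norm (P *v gf (x n s)))\<^sup>2"
      unfolding cx A_def
      using norm_add_scaleR_square[of "a n s" "- \<eta> n" "P *v gf (x n s)"] by simp
    also have "\<dots> \<le> A\<^sup>2 - 2 * \<eta> n * (3 / 4 * \<mu> * A\<^sup>2 - L\<^sup>2 / \<mu> * V\<^sup>2) + (\<eta> n)\<^sup>2 * (L\<^sup>2 * (A\<^sup>2 + V\<^sup>2))"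
      using drift sqr e by (intro add_mono diff_left_mono mult_left_mono) auto
    also have "\<dots> = (1 - 3 / 2 * \<mu> * \<eta> n + L\<^sup>2 * (\<eta> n)\<^sup>2) * A\<^sup>2 + 2 * L\<^sup>2 / \<mu> * \<eta> n * V\<^sup>2 + L\<^sup>2 * \<eta> n * \<eta> n * V\<^sup>2"
      by (simp add: algebra_simps power2_eq_square)
    also have "L\<^sup>2 * \<eta> n * \<eta> n * V\<^sup>2 \<le> L\<^sup>2 * \<eta>\<^sub>0 * \<eta> n * V\<^sup>2"
      using eta_le[OF n] e by (intro mult_right_mono mult_left_mono) auto
    finally show ?thesis unfolding A_def V_def by (simp add: algebra_simps)
  qed
  have "mean_square (a (Suc n)) = E (\<lambda>s. (norm (c (x n s) + \<eta> n *\<^sub>R (P *v xi n s)))\<^sup>2)"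
    by (rule Bochner_Integration.integral_cong) (simp_all add: a_step[OF n] cx)
  also have "\<dots> \<le> E (\<lambda>s. (norm (c (x n s)))\<^sup>2) + (\<eta> n)\<^sup>2 * \<kappa>\<^sub>2"
    by (rule expected_square_plus_noise(2)[OF n c sq norm_P])
  also have "E (\<lambda>s. (norm (c (x n s)))\<^sup>2) \<le> E (\<lambda>s. (1 - 3 / 2 * \<mu> * \<eta> n + L\<^sup>2 * (\<eta> n)\<^sup>2) * (norm (a n s))\<^sup>2
      + (2 * L\<^sup>2 / \<mu> + L\<^sup>2 * \<eta>\<^sub>0) * \<eta> n * (norm (v n s))\<^sup>2)"
    by (rule integral_mono) (use sq ia pt in \<open>auto simp: M.square_integrable_def\<close>)
  finally show ?thesis using ia by (simp add: mult.commute)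
qed

lemma w_norm_square:
  assumes n: "n \<ge> 1" and \<theta>: "\<theta> > 0"
  shows "(norm (w n s))\<^sup>2 \<le> (1 + \<theta>) * (norm (v n s))\<^sup>2 + (1 + 1 / \<theta>) * (\<eta> n)\<^sup>2 * (norm (gf (x n s)))\<^sup>2"
proof -
  define V where "V = norm (v n s)"
  define g where "g = \<eta> n * norm (gf (x n s))"
  have e: "\<eta> n > 0" by (rule eta_pos[OF n])
  have "norm (w n s) \<le> V + norm (\<eta> n *\<^sub>R (Q *v gf (x n s)))"
    unfolding w_def V_def by (rule norm_triangle_ineq4)
  also have "norm (\<eta> n *\<^sub>R (Q *v gf (x n s))) \<le> g" using e norm_Q by (simp add: g_def)
  finally have "(norm (w n s))\<^sup>2 \<le> (V + g)\<^sup>2" by (intro power_mono) auto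
  also have "\<dots> \<le> (1 + \<theta>) * V\<^sup>2 + (1 + 1 / \<theta>) * g\<^sup>2"
  proof -
    have "0 \<le> (\<theta> * V - g)\<^sup>2 / \<theta>" using \<theta> by simp
    also have "\<dots> = \<theta> * V\<^sup>2 + g\<^sup>2 / \<theta> - 2 * V * g" using \<theta> by (simp add: power2_diff field_simps power2_eq_square)
    finally show ?thesis by (simp add: power2_sum algebra_simps)
  qed
  finally show ?thesis by (simp add: V_def g_def power_mult_distrib mult.assoc)
qed

lemma w_xi_as_function:
  "w n s + \<eta> n *\<^sub>R (Q *v xi n s) = Q *v (x n s - \<eta> n *\<^sub>R gF (x n s) (\<zeta> n s))"
  by (simp add: w_def v_def xi_def matrix_vector_mult_diff_distrib matrix_vector_mult_scaleR algebra_simps)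

text \<open>
  With probability \<open>p\<close> the orthogonal component is reset to zero. Young's inequality with parameter \<open>p / 2\<close> lets half
  of this contraction survive, at the price of the factor \<open>1 / p\<close> on the push by the gradient.
\<close>

lemma v_recursion:
  assumes n: "n \<ge> 1"
  shows "mean_square (v (Suc n)) \<le> (1 - p n / 2) * mean_square (v n)
     + (6 * (norm gs)\<^sup>2 + 6 * L\<^sup>2 + \<kappa>\<^sub>2) * ((\<eta> n)\<^sup>2 / p n) * (1 + mean_square (a n) + mean_square (v n))"
proof -
  have e: "\<eta> n > 0" by (rule eta_pos[OF n])
  have pn: "0 < p n" "p n \<le> 1" using p_bounds n by auto
  define A where "A = mean_square (a n)"
  define V where "V = mean_square (v n)"
  have AV: "A \<ge> 0" "V \<ge> 0" by (simp_all add: A_def V_def)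
  have ia: "integrable M (\<lambda>s. (norm (a n s))\<^sup>2)" "integrable M (\<lambda>s. (norm (v n s))\<^sup>2)" "integrable M (\<lambda>s. (norm (w n s))\<^sup>2)"
    using a_square[OF n] v_square[OF n] w_square[OF n] by (simp_all add: M.square_integrable_def)
  define c where "c y = Q *v y - \<eta> n *\<^sub>R (Q *v gf y)" for y
  have c: "c \<in> borel_measurable borel" unfolding c_def[abs_def] by measurable
  have cx: "c (x n s) = w n s" for s by (simp add: c_def w_def v_def)
  have noisy: "integrable M (\<lambda>s. (norm (w n s + \<eta> n *\<^sub>R (Q *v xi n s)))\<^sup>2)"
    "E (\<lambda>s. (norm (w n s + \<eta> n *\<^sub>R (Q *v xi n s)))\<^sup>2) \<le> mean_square (w n) + (\<eta> n)\<^sup>2 * \<kappa>\<^sub>2"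
    using expected_square_plus_noise[OF n c _ norm_Q] w_square[OF n] by (simp_all add: cx)
  define h where "h y z = (norm (Q *v (y - \<eta> n *\<^sub>R gF y z)))\<^sup>2" for y z
  have h: "(\<lambda>(y, z). h y z) \<in> borel_measurable (borel \<Otimes>\<^sub>M D)"
    using gF_measurable unfolding h_def case_prod_unfold by measurable
  define \<psi> where "\<psi> b = (if b then 0 else 1 :: real)" for b :: bool
  have "mean_square (v (Suc n)) = (\<integral>s. \<psi> (\<omega> n s) *\<^sub>R h (x n s) (\<zeta> n s) \<partial>M)"
    by (rule Bochner_Integration.integral_cong) (simp_all add: v_step[OF n] w_xi_as_function h_def \<psi>_def)
  also have "\<dots> = (p n * \<psi> True + (1 - p n) * \<psi> False) *\<^sub>R (\<integral>s. h (x n s) (\<zeta> n s) \<partial>M)"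
    by (rule projection_step_factor(2)[OF n h]) (use noisy(1) in \<open>simp add: h_def w_xi_as_function\<close>)
  also have "\<dots> = (1 - p n) * E (\<lambda>s. (norm (w n s + \<eta> n *\<^sub>R (Q *v xi n s)))\<^sup>2)"
    by (simp add: \<psi>_def h_def w_xi_as_function)
  also have "\<dots> \<le> (1 - p n) * (mean_square (w n) + (\<eta> n)\<^sup>2 * \<kappa>\<^sub>2)"
    using noisy(2) pn by (intro mult_left_mono) auto
  also have "mean_square (w n) \<le> E (\<lambda>s. (1 + p n / 2) * (norm (v n s))\<^sup>2 + (1 + 2 / p n) * (\<eta> n)\<^sup>2 *
       (2 * (norm gs)\<^sup>2 + 2 * L\<^sup>2 * ((norm (a n s))\<^sup>2 + (norm (v n s))\<^sup>2)))"
  proof (rule integral_mono[OF ia(3)])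
    show "integrable M (\<lambda>s. (1 + p n / 2) * (norm (v n s))\<^sup>2 + (1 + 2 / p n) * (\<eta> n)\<^sup>2 *
       (2 * (norm gs)\<^sup>2 + 2 * L\<^sup>2 * ((norm (a n s))\<^sup>2 + (norm (v n s))\<^sup>2)))" using ia by auto
    fix s
    have "(norm (w n s))\<^sup>2 \<le> (1 + p n / 2) * (norm (v n s))\<^sup>2 + (1 + 2 / p n) * (\<eta> n)\<^sup>2 * (norm (gf (x n s)))\<^sup>2"
      using w_norm_square[OF n, of "p n / 2" s] pn by simp
    also have "\<dots> \<le> (1 + p n / 2) * (norm (v n s))\<^sup>2 + (1 + 2 / p n) * (\<eta> n)\<^sup>2 *
       (2 * (norm gs)\<^sup>2 + 2 * L\<^sup>2 * ((norm (a n s))\<^sup>2 + (norm (v n s))\<^sup>2))"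
      using norm_gf_square pn by (intro add_left_mono mult_left_mono) (auto intro!: mult_nonneg_nonneg)
    finally show "(norm (w n s))\<^sup>2 \<le> (1 + p n / 2) * (norm (v n s))\<^sup>2 + (1 + 2 / p n) * (\<eta> n)\<^sup>2 *
       (2 * (norm gs)\<^sup>2 + 2 * L\<^sup>2 * ((norm (a n s))\<^sup>2 + (norm (v n s))\<^sup>2))" .
  qed
  also have "\<dots> = (1 + p n / 2) * V + (1 + 2 / p n) * (\<eta> n)\<^sup>2 * (2 * (norm gs)\<^sup>2 + 2 * L\<^sup>2 * (A + V))"
    using ia by (simp add: A_def V_def M.prob_space)
  finally have "mean_square (v (Suc n)) \<le> (1 - p n) *
     ((1 + p n / 2) * V + (1 + 2 / p n) * (\<eta> n)\<^sup>2 * (2 * (norm gs)\<^sup>2 + 2 * L\<^sup>2 * (A + V)) + (\<eta> n)\<^sup>2 * \<kappa>\<^sub>2)"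
    using pn by (simp add: mult_left_mono)
  also have "\<dots> = ((1 - p n) * (1 + p n / 2)) * V
      + ((1 - p n) * (1 + 2 / p n)) * ((\<eta> n)\<^sup>2 * (2 * (norm gs)\<^sup>2 + 2 * L\<^sup>2 * (A + V))) + (1 - p n) * ((\<eta> n)\<^sup>2 * \<kappa>\<^sub>2)"
    by (simp add: algebra_simps)
  also have "\<dots> \<le> (1 - p n / 2) * V
      + (3 / p n) * ((\<eta> n)\<^sup>2 * (2 * (norm gs)\<^sup>2 + 2 * L\<^sup>2 * (A + V))) + (1 / p n) * ((\<eta> n)\<^sup>2 * \<kappa>\<^sub>2)"
  proof (intro add_mono mult_right_mono)
    show "(1 - p n) * (1 + p n / 2) \<le> 1 - p n / 2" using pn by (simp add: algebra_simps)
    have "(1 - p n) * (1 + 2 / p n) = 2 / p n - 1 - p n" using pn by (simp add: field_simps)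
    also have "\<dots> \<le> 3 / p n" using pn by (simp add: field_simps)
    finally show "(1 - p n) * (1 + 2 / p n) \<le> 3 / p n" .
    have "1 \<le> 1 / p n" using pn by simp
    then show "1 - p n \<le> 1 / p n" using pn by linarith
  qed (use AV kappa2 in auto)
  also have "\<dots> = (1 - p n / 2) * V + ((\<eta> n)\<^sup>2 / p n) * (6 * (norm gs)\<^sup>2 + 6 * L\<^sup>2 * (A + V) + \<kappa>\<^sub>2)"
    by (simp add: algebra_simps add_divide_distrib)
  also have "\<dots> \<le> (1 - p n / 2) * V + ((\<eta> n)\<^sup>2 / p n) * ((6 * (norm gs)\<^sup>2 + 6 * L\<^sup>2 + \<kappa>\<^sub>2) * (1 + A + V))"
  proof (intro add_left_mono mult_left_mono)
    have "0 \<le> (6 * (norm gs)\<^sup>2 + \<kappa>\<^sub>2) * (A + V) + 6 * L\<^sup>2" using AV kappa2 by simp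
    then show "6 * (norm gs)\<^sup>2 + 6 * L\<^sup>2 * (A + V) + \<kappa>\<^sub>2 \<le> (6 * (norm gs)\<^sup>2 + 6 * L\<^sup>2 + \<kappa>\<^sub>2) * (1 + A + V)"
      by (simp add: algebra_simps)
  qed (use pn in simp)
  finally show ?thesis unfolding A_def V_def by (simp add: mult_ac)
qed

lemma second_moments:
  "\<exists>K\<ge>0. \<forall>n\<ge>1. mean_square (a n) \<le> K * \<eta> n \<and> mean_square (v n) \<le> K * \<eta> n"
proof (rule coupled_recursion_bound)
  define C where "C = (6 * (norm gs)\<^sup>2 + 6 * L\<^sup>2 + \<kappa>\<^sub>2) + (2 * L\<^sup>2 / \<mu> + L\<^sup>2 * \<eta>\<^sub>0)"
  have Cs: "6 * (norm gs)\<^sup>2 + 6 * L\<^sup>2 + \<kappa>\<^sub>2 \<le> C" "2 * L\<^sup>2 / \<mu> + L\<^sup>2 * \<eta>\<^sub>0 \<le> C" "L\<^sup>2 \<le> C" "\<kappa>\<^sub>2 \<le> C" "C \<ge> 0"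
    using mu eta0(1) kappa2 by (auto simp: C_def add_increasing2 add_increasing)
  show "C \<ge> 0" by (rule Cs)
  fix n :: nat assume n: "n \<ge> 1"
  have e: "\<eta> n > 0" "p n > 0" using eta_pos[OF n] p_bounds(1)[OF n] by auto
  have AV: "mean_square (a n) \<ge> 0" "mean_square (v n) \<ge> 0" by simp_all
  show "mean_square (v (Suc n)) \<le> (1 - p n / 2) * mean_square (v n)
     + C * ((\<eta> n)\<^sup>2 / p n) * (1 + mean_square (a n) + mean_square (v n))"
    by (rule order_trans[OF v_recursion[OF n]], intro add_left_mono mult_right_mono Cs(1))
      (use e AV in auto)
  show "mean_square (a (Suc n)) \<le> (1 - 3 / 2 * \<mu> * \<eta> n + C * (\<eta> n)\<^sup>2) * mean_square (a n)
     + C * \<eta> n * mean_square (v n) + C * (\<eta> n)\<^sup>2"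
    by (rule order_trans[OF a_recursion[OF n]], intro add_mono mult_right_mono add_left_mono Cs)
      (use e AV in auto)
qed simp_all

end

section \<open>The corrected and normalised error\<close>

context lpsa_clt
begin

text \<open>
  \<open>e0\<close> is the limit of \<open>(rescaling n - 1) / \<eta> n\<close>, by which normalisation reduces the contraction, and \<open>drift\<close> is
  multiplication by \<open>P H P\<close>.
\<close>

definition e0 :: real where "e0 = of_bool (\<alpha> = 1) / (2 * \<eta>\<^sub>0)"
definition \<kappa> :: "nat \<Rightarrow> real" where "\<kappa> n = \<eta> n / p n"
definition r :: "nat \<Rightarrow> real" where "r n = sqrt (\<eta> n)"
definition B :: real where "B = spectral_norm G"
definition drift :: "real^'d \<Rightarrow> real^'d" where "drift y = P *v (G *v (P *v y)) - e0 *\<^sub>R (P *v y)"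
definition bias :: "real^'d" where "bias = (1 / \<gamma>) *\<^sub>R (P *v (G *v gs))"

text \<open>
  The normalised error with the corrector subtracted. Its index shift matches that of the theorem: \<open>U n\<close> is normalised by
  the step size of the previous step.
\<close>

definition U :: "nat \<Rightarrow> 'w \<Rightarrow> real^'d" where
  "U n s = (1 / r (n - 1)) *\<^sub>R (a n s - \<kappa> (n - 1) *\<^sub>R (P *v (G *v v n s)))"

text \<open>
  The innovation of the orthogonal component: its new value minus the conditional mean given \<open>x\<^sub>n\<close>.
\<close>

definition jump :: "nat \<Rightarrow> 'w \<Rightarrow> real^'d" where
  "jump n s = v (Suc n) s - (1 - p n) *\<^sub>R w n s"

definition grad_noise :: "nat \<Rightarrow> 'w \<Rightarrow> real^'d" where "grad_noise n s = r n *\<^sub>R (P *v xi n s)"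
definition reset_noise :: "nat \<Rightarrow> 'w \<Rightarrow> real^'d" where "reset_noise n s = - (\<kappa> n / r n) *\<^sub>R (P *v (G *v jump n s))"

definition predictable :: "nat \<Rightarrow> 'w \<Rightarrow> real^'d" where
  "predictable n s = U n s - \<eta> n *\<^sub>R drift (U n s) + \<eta> n *\<^sub>R bias"

definition remainder :: "nat \<Rightarrow> 'w \<Rightarrow> real^'d" where
  "remainder n s = U (Suc n) s - (predictable n s + grad_noise n s + reset_noise n s)"

lemma B_nonneg: "B \<ge> 0" and norm_PG: "norm (P *v (G *v y)) \<le> B * norm y"
proof -
  have G: "norm (G *v y) \<le> B * norm y" for y
    unfolding B_def by (rule norm_matrix_vector_mult_le_spectral_norm)
  show "B \<ge> 0"
    unfolding B_def spectral_norm_def by (rule onorm_pos_le[OF matrix_vector_mul_bounded_linear])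
  show "norm (P *v (G *v y)) \<le> B * norm y" using norm_P order_trans G by blast
qed

lemma r_pos: "n \<ge> 1 \<Longrightarrow> r n > 0" and r_square: "n \<ge> 1 \<Longrightarrow> r n * r n = \<eta> n"
  using eta_pos[of n] by (auto simp: r_def)

lemma rescaling_r: "rescaling n = r (n - 1) / r n"
  by (simp add: rescaling_def r_def)

lemma rescaling_ge_1: "n \<ge> 2 \<Longrightarrow> rescaling n \<ge> 1"
proof -
  assume n: "n \<ge> 2"
  then have "\<eta> (Suc (n - 1)) \<le> \<eta> (n - 1)" by (intro eta_decreasing) auto
  then have "\<eta> n \<le> \<eta> (n - 1)" using n by simp
  then show ?thesis using r_pos[of n] n by (simp add: rescaling_r r_def)
qed

lemma P_U: "P *v U n s = U n s"
  by (simp add: U_def matrix_vector_mult_scaleR matrix_vector_mult_diff_distrib P_a P_idem)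

definition linearization_error :: "nat \<Rightarrow> 'w \<Rightarrow> real^'d" where
  "linearization_error n s = gf (x n s) - gs - G *v (x n s - xs)"

lemma norm_linearization_error:
  "norm (linearization_error n s) \<le> L' * ((norm (a n s))\<^sup>2 + (norm (v n s))\<^sup>2)"
  using lipschitz_derivative_linearization[OF hess hess_lipschitz L'0, of "x n s" xs xs]
  unfolding linearization_error_def norm_x_decomp[symmetric]
  by (simp add: power2_eq_square mult_ac)

text \<open>
  The term \<open>\<eta>\<^sub>n P G v\<^sub>n\<close>, too large to be neglected, disappears. It is absorbed because
  \<open>\<kappa> n * p n = \<eta> n\<close>, so that \<open>\<eta> n v\<^sub>n\<close> and the decay \<open>\<kappa> n (1 - p n) v\<^sub>n\<close> of the corrector add up to
  \<open>\<kappa> n v\<^sub>n\<close>. What it leaves behind is the contribution of the mean push \<open>Q \<nabla>f(x\<^sub>n)\<close>, the source of \<open>m\<close>.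
\<close>

lemma corrected_step:
  assumes n: "n \<ge> 1" and s: "s \<in> space M"
  shows "a (Suc n) s - \<kappa> n *\<^sub>R (P *v (G *v v (Suc n) s))
    = a n s - \<kappa> n *\<^sub>R (P *v (G *v v n s)) - \<eta> n *\<^sub>R (P *v (G *v a n s))
      + (\<kappa> n * (1 - p n) * \<eta> n) *\<^sub>R (P *v (G *v (Q *v gf (x n s))))
      - \<eta> n *\<^sub>R (P *v linearization_error n s) + \<eta> n *\<^sub>R (P *v xi n s) - \<kappa> n *\<^sub>R (P *v (G *v jump n s))"
proof -
  have pn: "p n > 0" using p_bounds(1)[OF n] .
  have kp: "\<kappa> n * p n = \<eta> n" using pn by (simp add: \<kappa>_def)
  have gfx: "P *v gf (x n s) = P *v (G *v a n s) + P *v (G *v v n s) + P *v linearization_error n s"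
    by (simp add: linearization_error_def x_decomp matrix_vector_right_distrib matrix_vector_mult_diff_distrib P_gs)
  have vS: "v (Suc n) s = jump n s + (1 - p n) *\<^sub>R v n s - ((1 - p n) * \<eta> n) *\<^sub>R (Q *v gf (x n s))"
    by (simp add: jump_def w_def algebra_simps)
  have PGv: "\<kappa> n *\<^sub>R (P *v (G *v v (Suc n) s)) = \<kappa> n *\<^sub>R (P *v (G *v jump n s)) + (\<kappa> n - \<eta> n) *\<^sub>R (P *v (G *v v n s))
      - (\<kappa> n * (1 - p n) * \<eta> n) *\<^sub>R (P *v (G *v (Q *v gf (x n s))))"
  proof -
    have "\<kappa> n * (1 - p n) = \<kappa> n - \<eta> n" using kp by (simp add: right_diff_distrib)
    then show ?thesis unfolding vS
      by (simp add: matrix_vector_right_distrib matrix_vector_mult_diff_distrib matrix_vector_mult_scaleR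
          scaleR_add_right scaleR_diff_right mult.assoc[symmetric])
  qed
  show ?thesis
    unfolding a_step[OF n s] PGv gfx by (simp add: algebra_simps)
qed

lemma remainder_eq:
  assumes n: "n \<ge> 2" and s: "s \<in> space M"
  shows "remainder n s = (rescaling n - 1 - \<eta> n * e0) *\<^sub>R U n s
      - (\<eta> n * (rescaling n - 1)) *\<^sub>R (P *v (G *v U n s))
      - (r n * \<kappa> (n - 1)) *\<^sub>R (P *v (G *v (P *v (G *v v n s))))
      - ((\<kappa> n - \<kappa> (n - 1)) / r n) *\<^sub>R (P *v (G *v v n s))
      + ((r n * \<kappa> n * (1 - p n)) *\<^sub>R (P *v (G *v (Q *v gf (x n s)))) - \<eta> n *\<^sub>R bias)
      - r n *\<^sub>R (P *v linearization_error n s)"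
proof -
  have n1: "n \<ge> 1" "n - 1 \<ge> 1" using n by auto
  have rn: "r n > 0" "r (n - 1) > 0" using r_pos n1 by auto
  have e: "\<eta> n = r n * r n" using r_square[OF n1(1)] by simp
  have r': "r (n - 1) = rescaling n * r n" using rn by (simp add: rescaling_r)
  have an: "a n s = r (n - 1) *\<^sub>R U n s + \<kappa> (n - 1) *\<^sub>R (P *v (G *v v n s))"
    using rn by (simp add: U_def)
  have PGa: "P *v (G *v a n s) = r (n - 1) *\<^sub>R (P *v (G *v U n s)) + \<kappa> (n - 1) *\<^sub>R (P *v (G *v (P *v (G *v v n s))))"
    by (subst an) (simp add: matrix_vector_right_distrib matrix_vector_mult_scaleR)
  have US: "U (Suc n) s = (1 / r n) *\<^sub>R (a (Suc n) s - \<kappa> n *\<^sub>R (P *v (G *v v (Suc n) s)))"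
    by (simp add: U_def)
  have dr: "drift (U n s) = P *v (G *v U n s) - e0 *\<^sub>R U n s" by (simp add: drift_def P_U)
  define u where "u = U n s"
  define g1 where "g1 = P *v (G *v U n s)"
  define g2 where "g2 = P *v (G *v (P *v (G *v v n s)))"
  define g3 where "g3 = P *v (G *v v n s)"
  define g4 where "g4 = P *v (G *v (Q *v gf (x n s)))"
  define g5 where "g5 = P *v linearization_error n s"
  define g6 where "g6 = P *v xi n s"
  define g7 where "g7 = P *v (G *v jump n s)"
  define l where "l = rescaling n"
  have US2: "U (Suc n) s = (1 / r n) *\<^sub>R ((l * r n) *\<^sub>R u + \<kappa> (n - 1) *\<^sub>R g3 - \<kappa> n *\<^sub>R g3
       - (r n * r n) *\<^sub>R ((l * r n) *\<^sub>R g1 + \<kappa> (n - 1) *\<^sub>R g2) + (\<kappa> n * (1 - p n) * (r n * r n)) *\<^sub>R g4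
       - (r n * r n) *\<^sub>R g5 + (r n * r n) *\<^sub>R g6 - \<kappa> n *\<^sub>R g7)"
    unfolding US corrected_step[OF n1(1) s] unfolding PGa unfolding an
    unfolding u_def g1_def g2_def g3_def g4_def g5_def g6_def g7_def l_def r' e ..
  also have "\<dots> = l *\<^sub>R u + ((\<kappa> (n - 1) - \<kappa> n) / r n) *\<^sub>R g3 - (r n * (l * r n)) *\<^sub>R g1 - (r n * \<kappa> (n - 1)) *\<^sub>R g2
       + (\<kappa> n * (1 - p n) * r n) *\<^sub>R g4 - r n *\<^sub>R g5 + r n *\<^sub>R g6 - (\<kappa> n / r n) *\<^sub>R g7"
    using rn by (simp add: scaleR_add_right scaleR_diff_right scaleR_diff_left diff_divide_distrib)
  finally show ?thesis
    unfolding remainder_def predictable_def dr grad_noise_def reset_noise_def e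
    unfolding g1_def[symmetric] g2_def[symmetric]
    unfolding u_def[symmetric] g3_def[symmetric] g4_def[symmetric] g5_def[symmetric] g6_def[symmetric] g7_def[symmetric] l_def[symmetric]
    by (simp add: algebra_simps diff_divide_distrib)
qed

lemma norm_remainder:
  assumes n: "n \<ge> 2" and s: "s \<in> space M" and small: "r (n - 1) < 1 / \<gamma>"
  shows "norm (remainder n s) \<le> \<bar>rescaling n - 1 - \<eta> n * e0\<bar> * norm (U n s)
      + \<eta> n * (rescaling n - 1) * B * norm (U n s)
      + \<eta> n * (rescaling n / \<gamma> * B\<^sup>2) * norm (v n s)
      + (rescaling n - 1) / \<gamma> * B * norm (v n s)
      + \<eta> n / \<gamma> * B * (L * norm (a n s) + L * norm (v n s) + p n * norm gs)
      + r n * L' * ((norm (a n s))\<^sup>2 + (norm (v n s))\<^sup>2)"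
proof -
  have n1: "n \<ge> 1" "n - 1 \<ge> 1" using n by auto
  have rn: "r n > 0" "r (n - 1) > 0" using r_pos n1 by auto
  have e: "\<eta> n > 0" using eta_pos[OF n1(1)] .
  have l: "rescaling n \<ge> 1" by (rule rescaling_ge_1[OF n])
  have r': "r (n - 1) = rescaling n * r n" using rn by (simp add: rescaling_r)
  then have "r n \<le> r (n - 1)" using l rn by simp
  then have "r n < 1 / \<gamma>" using small by linarith
  then have "p n = \<gamma> * r n" "p (n - 1) = \<gamma> * r (n - 1)"
    using p_small[of n] p_small[of "n - 1"] small unfolding r_def by blast+
  then have k: "\<kappa> n = r n / \<gamma>" "\<kappa> (n - 1) = r (n - 1) / \<gamma>"
    using rn gamma r_square[OF n1(1)] r_square[OF n1(2)] by (auto simp: \<kappa>_def field_simps)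
  have pn: "0 \<le> p n" "p n \<le> 1" using p_bounds(1)[OF n1(1)] p_bounds(2)[of n] by auto
  note BG = B_nonneg norm_PG
  have t1: "norm ((rescaling n - 1 - \<eta> n * e0) *\<^sub>R U n s) \<le> \<bar>rescaling n - 1 - \<eta> n * e0\<bar> * norm (U n s)" by simp
  have t2: "norm ((\<eta> n * (rescaling n - 1)) *\<^sub>R (P *v (G *v U n s))) \<le> \<eta> n * (rescaling n - 1) * B * norm (U n s)"
    using e l norm_PG[of "U n s"] by (simp add: mult_left_mono mult.assoc)
  have t3: "norm ((r n * \<kappa> (n - 1)) *\<^sub>R (P *v (G *v (P *v (G *v v n s))))) \<le> \<eta> n * (rescaling n / \<gamma> * B\<^sup>2) * norm (v n s)"
  proof -
    have c: "r n * \<kappa> (n - 1) = \<eta> n * (rescaling n / \<gamma>)" 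
      unfolding k r' r_square[OF n1(1), symmetric] by simp
    have "norm (P *v (G *v (P *v (G *v v n s)))) \<le> B * (B * norm (v n s))"
      using BG(1) by (intro order_trans[OF norm_PG] mult_left_mono norm_PG)
    then have "\<eta> n * (rescaling n / \<gamma>) * norm (P *v (G *v (P *v (G *v v n s)))) \<le> \<eta> n * (rescaling n / \<gamma>) * (B * (B * norm (v n s)))"
      using e l gamma by (intro mult_left_mono) auto
    then show ?thesis using e l gamma unfolding norm_scaleR c
      by (simp add: abs_mult power2_eq_square mult_ac)
  qed
  have t4: "norm (((\<kappa> n - \<kappa> (n - 1)) / r n) *\<^sub>R (P *v (G *v v n s))) \<le> (rescaling n - 1) / \<gamma> * B * norm (v n s)"
  proof -
    have c: "(\<kappa> n - \<kappa> (n - 1)) / r n = - ((rescaling n - 1) / \<gamma>)"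
      unfolding k r' using rn(1) gamma by (simp add: field_simps)
    have "(rescaling n - 1) / \<gamma> * norm (P *v (G *v v n s)) \<le> (rescaling n - 1) / \<gamma> * (B * norm (v n s))"
      using l gamma by (intro mult_left_mono norm_PG) auto
    then show ?thesis using l gamma unfolding c by simp
  qed
  have t5: "norm ((r n * \<kappa> n * (1 - p n)) *\<^sub>R (P *v (G *v (Q *v gf (x n s)))) - \<eta> n *\<^sub>R bias)
      \<le> \<eta> n / \<gamma> * B * (L * norm (a n s) + L * norm (v n s) + p n * norm gs)"
  proof -
    have c: "r n * \<kappa> n * (1 - p n) = \<eta> n / \<gamma> * (1 - p n)" using r_square[OF n1(1)] by (simp add: k)
    have "(r n * \<kappa> n * (1 - p n)) *\<^sub>R (P *v (G *v (Q *v gf (x n s)))) - \<eta> n *\<^sub>R bias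
        = (\<eta> n / \<gamma>) *\<^sub>R (P *v (G *v ((1 - p n) *\<^sub>R (Q *v gf (x n s)) - gs)))"
      unfolding c bias_def by (simp add: matrix_vector_mult_diff_distrib matrix_vector_mult_scaleR scaleR_diff_right)
    also have "norm \<dots> = \<eta> n / \<gamma> * norm (P *v (G *v ((1 - p n) *\<^sub>R (Q *v gf (x n s)) - gs)))"
      using e gamma by simp
    also have "\<dots> \<le> \<eta> n / \<gamma> * (B * norm ((1 - p n) *\<^sub>R (Q *v gf (x n s)) - gs))"
      using e gamma by (intro mult_left_mono norm_PG) auto
    also have "\<dots> \<le> \<eta> n / \<gamma> * (B * (L * norm (a n s) + L * norm (v n s) + p n * norm gs))"
    proof (intro mult_left_mono)
      have "(1 - p n) *\<^sub>R (Q *v gf (x n s)) - gs = (1 - p n) *\<^sub>R (Q *v (gf (x n s) - gs)) - p n *\<^sub>R gs"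
        by (simp add: matrix_vector_mult_diff_distrib Q_gs algebra_simps)
      also have "norm \<dots> \<le> norm ((1 - p n) *\<^sub>R (Q *v (gf (x n s) - gs))) + norm (p n *\<^sub>R gs)"
        by (rule norm_triangle_ineq4)
      also have "norm ((1 - p n) *\<^sub>R (Q *v (gf (x n s) - gs))) \<le> norm (gf (x n s) - gs)"
      proof -
        have "(1 - p n) * norm (Q *v (gf (x n s) - gs)) \<le> 1 * norm (gf (x n s) - gs)"
          using pn norm_Q by (intro mult_mono) auto
        then show ?thesis using pn by simp
      qed
      also have "norm (gf (x n s) - gs) \<le> L * norm (a n s + v n s)"
        using smooth[of "x n s" xs] by (simp add: x_decomp)
      also have "\<dots> \<le> L * (norm (a n s) + norm (v n s))" by (intro mult_left_mono norm_triangle_ineq L0)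
      finally show "norm ((1 - p n) *\<^sub>R (Q *v gf (x n s)) - gs) \<le> L * norm (a n s) + L * norm (v n s) + p n * norm gs"
        using pn by (simp add: algebra_simps)
    qed (use e gamma BG(1) in auto)
    finally show ?thesis by (simp add: mult.assoc)
  qed
  have t6: "norm (r n *\<^sub>R (P *v linearization_error n s)) \<le> r n * L' * ((norm (a n s))\<^sup>2 + (norm (v n s))\<^sup>2)"
  proof -
    have "norm (P *v linearization_error n s) \<le> L' * ((norm (a n s))\<^sup>2 + (norm (v n s))\<^sup>2)"
      using norm_P norm_linearization_error order_trans by blast
    then have "r n * norm (P *v linearization_error n s) \<le> r n * (L' * ((norm (a n s))\<^sup>2 + (norm (v n s))\<^sup>2))"
      using rn by (intro mult_left_mono) auto
    then show ?thesis using rn by (simp add: mult.assoc)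
  qed
  show ?thesis unfolding remainder_eq[OF n s]
    by (intro order_trans[OF norm_triangle_ineq4] order_trans[OF norm_triangle_ineq] add_mono t1 t2 t3 t4 t5 t6)
qed

end

context lpsa_clt
begin

lemma first_moment_le:
  fixes f :: "'w \<Rightarrow> real^'d"
  assumes f: "M.square_integrable f" and n: "n \<ge> 1" and K: "mean_square f \<le> K * \<eta> n"
  shows "mean_norm f \<le> (K + 1) / 2 * r n"
proof -
  have rn: "r n > 0" by (rule r_pos[OF n])
  have nf: "M.square_integrable (\<lambda>s. norm (f s))" using f by (auto simp: M.square_integrable_def)
  have "E (\<lambda>s. \<bar>norm (f s)\<bar> * \<bar>1\<bar>) \<le> (1 / r n * mean_square f + E (\<lambda>s. 1\<^sup>2) / (1 / r n)) / 2"
    by (rule M.expectation_mult_le[OF nf M.square_integrable_const]) (use rn in simp)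
  also have "\<dots> = (mean_square f / r n + r n) / 2" by (simp add: M.prob_space)
  also have "\<dots> \<le> (K * \<eta> n / r n + r n) / 2"
    using K rn by (intro divide_right_mono add_right_mono) auto
  also have "K * \<eta> n / r n = K * r n" using rn r_square[OF n, symmetric] by simp
  finally show ?thesis by (simp add: algebra_simps)
qed

lemma r_tendsto: "r \<longlonglongrightarrow> 0"
  using sqrt_eta_tendsto by (simp add: r_def[abs_def])

lemma rescaling_limit: "(\<lambda>n. (rescaling n - 1) / \<eta> n) \<longlonglongrightarrow> e0"
  using rescaling_tendsto by (simp add: e0_def)

lemma rescaling_tendsto_1: "(\<lambda>n. rescaling n - 1) \<longlonglongrightarrow> 0"
proof -
  have "(\<lambda>n. (rescaling n - 1) / \<eta> n * \<eta> n) \<longlonglongrightarrow> e0 * 0"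
    by (rule tendsto_mult[OF rescaling_limit eta_tendsto])
  moreover have "\<forall>\<^sub>F n in sequentially. (rescaling n - 1) / \<eta> n * \<eta> n = rescaling n - 1"
    using eventually_ge_at_top[of 1] by eventually_elim (use eta_pos in force)
  ultimately show ?thesis by (simp add: tendsto_cong)
qed

lemma U_square: "n \<ge> 2 \<Longrightarrow> M.square_integrable (U n)"
  unfolding U_def[abs_def]
  by (intro M.square_integrable_scaleR M.square_integrable_diff M.square_integrable_matrix a_square v_square) auto

lemma jump_square: "n \<ge> 1 \<Longrightarrow> M.square_integrable (jump n)"
  unfolding jump_def[abs_def]
  by (intro M.square_integrable_scaleR M.square_integrable_diff w_square v_square) auto

lemma grad_noise_square: "n \<ge> 1 \<Longrightarrow> M.square_integrable (grad_noise n)"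
  unfolding grad_noise_def[abs_def] by (intro M.square_integrable_scaleR M.square_integrable_matrix xi_square)

lemma reset_noise_square: "n \<ge> 1 \<Longrightarrow> M.square_integrable (reset_noise n)"
  unfolding reset_noise_def[abs_def] by (intro M.square_integrable_scaleR M.square_integrable_matrix jump_square)

lemma drift_matrix: "drift y = (P ** G ** P - e0 *\<^sub>R P) *v y"
  by (simp add: drift_def matrix_vector_mult_diff_rdistrib matrix_vector_mul_assoc[symmetric]
      scaleR_matrix_vector_assoc)

lemma predictable_square: "n \<ge> 2 \<Longrightarrow> M.square_integrable (predictable n)"
  unfolding predictable_def[abs_def] drift_matrix
  by (intro M.square_integrable_add M.square_integrable_diff M.square_integrable_scaleR M.square_integrable_matrix
     U_square M.square_integrable_const)

lemma remainder_square: "n \<ge> 2 \<Longrightarrow> M.square_integrable (remainder n)"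
  unfolding remainder_def[abs_def]
  by (intro M.square_integrable_add M.square_integrable_diff U_square predictable_square grad_noise_square reset_noise_square) auto

lemma first_moments:
  "\<exists>K1\<ge>0. \<forall>n\<ge>1. mean_norm (a n) \<le> K1 * r n \<and> mean_norm (v n) \<le> K1 * r n"
proof -
  obtain K where K: "K \<ge> 0" "\<And>n. n \<ge> 1 \<Longrightarrow> mean_square (a n) \<le> K * \<eta> n"
    "\<And>n. n \<ge> 1 \<Longrightarrow> mean_square (v n) \<le> K * \<eta> n"
    using second_moments by blast
  then show ?thesis
    using first_moment_le[OF a_square] first_moment_le[OF v_square] by (intro exI[of _ "(K + 1) / 2"]) auto
qed

lemma reset_probability_threshold:
  "\<exists>N\<ge>2. \<forall>n\<ge>N. r (n - 1) < 1 / \<gamma> \<and> r n \<le> 1 \<and> p n = \<gamma> * r n"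
proof -
  obtain N0 where N0: "N0 \<ge> 2" "\<And>n. n \<ge> N0 \<Longrightarrow> sqrt (\<eta> n) < min 1 (1 / \<gamma>)"
    using eventually_small_sqrt_eta[of "min 1 (1 / \<gamma>)"] gamma by auto
  have "r (n - 1) < 1 / \<gamma>" "r n \<le> 1" "p n = \<gamma> * r n" if "n \<ge> Suc N0" for n
    using N0(2)[of n] N0(2)[of "n - 1"] that p_small[of n] by (auto simp: r_def)
  then show ?thesis using N0(1) by (intro exI[of _ "Suc N0"]) auto
qed

lemma normalized_error_moment:
  "\<exists>KU\<ge>0. \<exists>N. \<forall>n\<ge>N. mean_norm (U n) \<le> KU"
proof -
  obtain K1 where K1: "K1 \<ge> 0" "\<And>n. n \<ge> 1 \<Longrightarrow> mean_norm (a n) \<le> K1 * r n" "\<And>n. n \<ge> 1 \<Longrightarrow> mean_norm (v n) \<le> K1 * r n"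
    using first_moments by blast
  obtain N0 where N0: "N0 \<ge> 2" "\<And>n. n \<ge> N0 \<Longrightarrow> r (n - 1) < 1 / \<gamma>"
    using reset_probability_threshold by blast
  define KU where "KU = K1 * (1 + B / \<gamma>\<^sup>2)"
  have KU: "mean_norm (U n) \<le> KU" if n: "n \<ge> N0" for n
  proof -
    have n1: "n \<ge> 2" "n \<ge> 1" "n - 1 \<ge> 1" using n N0 by auto
    have rn: "r (n - 1) > 0" "r n > 0" using r_pos n1 by auto
    have "\<eta> (Suc (n - 1)) \<le> \<eta> (n - 1)" using n1 by (intro eta_decreasing) auto
    then have rle: "r n \<le> r (n - 1)" using n1 by (simp add: r_def)
    have "p (n - 1) = \<gamma> * r (n - 1)" using p_small[of "n - 1"] N0(2)[OF n] unfolding r_def by blast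
    then have k: "\<kappa> (n - 1) = r (n - 1) / \<gamma>"
      using rn(1) gamma r_square[OF n1(3), symmetric] by (simp add: \<kappa>_def)
    have kle: "0 \<le> \<kappa> (n - 1)" "\<kappa> (n - 1) \<le> 1 / \<gamma>\<^sup>2"
    proof -
      show "0 \<le> \<kappa> (n - 1)" unfolding k using rn gamma by simp
      have "r (n - 1) / \<gamma> \<le> (1 / \<gamma>) / \<gamma>" using N0(2)[OF n] gamma by (intro divide_right_mono) auto
      then show "\<kappa> (n - 1) \<le> 1 / \<gamma>\<^sup>2" unfolding k by (simp add: power2_eq_square)
    qed
    have int: "integrable M (\<lambda>s. norm (a n s))" "integrable M (\<lambda>s. norm (v n s))" "integrable M (\<lambda>s. norm (U n s))"
      using M.square_integrable_imp_integrable a_square[OF n1(2)] v_square[OF n1(2)] U_square[OF n1(1)]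
      by (blast intro: integrable_norm)+
    have pt: "norm (U n s) \<le> (1 / r (n - 1)) * (norm (a n s) + 1 / \<gamma>\<^sup>2 * (B * norm (v n s)))" for s
    proof -
      have "norm (a n s - \<kappa> (n - 1) *\<^sub>R (P *v (G *v v n s))) \<le> norm (a n s) + \<kappa> (n - 1) * norm (P *v (G *v v n s))"
        using norm_triangle_ineq4[of "a n s" "\<kappa> (n - 1) *\<^sub>R (P *v (G *v v n s))"] kle(1) by simp
      also have "\<kappa> (n - 1) * norm (P *v (G *v v n s)) \<le> 1 / \<gamma>\<^sup>2 * (B * norm (v n s))"
        using kle norm_PG by (intro mult_mono) auto
      finally show ?thesis using rn(1) by (simp add: U_def divide_right_mono)
    qed
    have "mean_norm (U n) \<le> E (\<lambda>s. (1 / r (n - 1)) * (norm (a n s) + 1 / \<gamma>\<^sup>2 * (B * norm (v n s))))"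
      using int by (intro integral_mono pt) auto
    also have "\<dots> = (1 / r (n - 1)) * (mean_norm (a n) + 1 / \<gamma>\<^sup>2 * (B * mean_norm (v n)))"
      using int by simp
    also have "\<dots> \<le> (1 / r (n - 1)) * (K1 * r (n - 1) + 1 / \<gamma>\<^sup>2 * (B * (K1 * r (n - 1))))"
    proof (intro mult_left_mono add_mono)
      show "mean_norm (a n) \<le> K1 * r (n - 1)" "mean_norm (v n) \<le> K1 * r (n - 1)"
        using K1(2,3)[OF n1(2)] mult_left_mono[OF rle K1(1)] by linarith+
    qed (use rn B_nonneg in auto)
    also have "\<dots> = KU" using rn by (simp add: KU_def field_simps)
    finally show ?thesis .
  qed
  have "KU \<ge> 0" using K1(1) B_nonneg by (simp add: KU_def)
  with KU show ?thesis by blast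
qed

text \<open>
  Each term of the remainder is a product of \<open>\<eta> n\<close> and a null sequence: normalisation is expanded to first order,
  the linearisation error is quadratic in an error of order \<open>sqrt (\<eta> n)\<close>, and the corrector varies slowly.
\<close>

lemma remainder_negligible:
  "\<exists>\<delta> N. \<delta> \<longlonglongrightarrow> 0 \<and> (\<forall>n\<ge>N. mean_norm (remainder n) \<le> \<eta> n * \<delta> n)"
proof -
  obtain K where K: "K \<ge> 0" and sq: "\<And>n. n \<ge> 1 \<Longrightarrow> mean_square (a n) \<le> K * \<eta> n \<and> mean_square (v n) \<le> K * \<eta> n"
    using second_moments by blast
  obtain K1 where fm: "\<And>n. n \<ge> 1 \<Longrightarrow> mean_norm (a n) \<le> K1 * r n \<and> mean_norm (v n) \<le> K1 * r n"
    using first_moments by blast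
  obtain KU N0 where um: "\<And>n. n \<ge> N0 \<Longrightarrow> mean_norm (U n) \<le> KU"
    using normalized_error_moment by blast
  obtain i1 where i1: "i1 \<ge> 2" and small: "\<And>n. n \<ge> i1 \<Longrightarrow> r (n - 1) < 1 / \<gamma>"
    using reset_probability_threshold by blast
  define \<delta> where "\<delta> n = \<bar>(rescaling n - 1) / \<eta> n - e0\<bar> * KU + (rescaling n - 1) * B * KU
     + ((rescaling n - 1) + 1) / \<gamma> * B\<^sup>2 * (K1 * r n) + (rescaling n - 1) / \<eta> n / \<gamma> * B * (K1 * r n)
     + 1 / \<gamma> * B * (L * (K1 * r n) + L * (K1 * r n) + p n * norm gs) + L' * (K + K) * r n" for n
  have "\<delta> \<longlonglongrightarrow> \<bar>e0 - e0\<bar> * KU + 0 * B * KU + (0 + 1) / \<gamma> * B\<^sup>2 * (K1 * 0) + e0 / \<gamma> * B * (K1 * 0)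
     + 1 / \<gamma> * B * (L * (K1 * 0) + L * (K1 * 0) + 0 * norm gs) + L' * (K + K) * 0"
    unfolding \<delta>_def using gamma
    by (intro tendsto_add tendsto_mult tendsto_divide tendsto_rabs tendsto_diff tendsto_const
        rescaling_limit rescaling_tendsto_1 r_tendsto p_tendsto) auto
  then have "\<delta> \<longlonglongrightarrow> 0" by simp
  moreover have "mean_norm (remainder n) \<le> \<eta> n * \<delta> n" if n: "n \<ge> max N0 i1" for n
  proof -
    have n1: "n \<ge> 2" "n \<ge> 1" using n i1 by auto
    have e: "\<eta> n > 0" by (rule eta_pos[OF n1(2)])
    have l: "rescaling n \<ge> 1" by (rule rescaling_ge_1[OF n1(1)])
    have pn: "p n > 0" by (rule p_bounds(1)[OF n1(2)])
    have rn: "r n > 0" by (rule r_pos[OF n1(2)])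
    have int: "integrable M (\<lambda>s. norm (a n s))" "integrable M (\<lambda>s. norm (v n s))" "integrable M (\<lambda>s. norm (U n s))"
      "integrable M (\<lambda>s. norm (remainder n s))"
      using M.square_integrable_imp_integrable a_square[OF n1(2)] v_square[OF n1(2)] U_square[OF n1(1)] remainder_square[OF n1(1)]
      by (blast intro: integrable_norm)+
    have int2: "integrable M (\<lambda>s. (norm (a n s))\<^sup>2)" "integrable M (\<lambda>s. (norm (v n s))\<^sup>2)"
      using a_square[OF n1(2)] v_square[OF n1(2)] by (simp_all add: M.square_integrable_def)
    have "mean_norm (remainder n) \<le> E (\<lambda>s. \<bar>rescaling n - 1 - \<eta> n * e0\<bar> * norm (U n s)
      + \<eta> n * (rescaling n - 1) * B * norm (U n s)
      + \<eta> n * (rescaling n / \<gamma> * B\<^sup>2) * norm (v n s)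
      + (rescaling n - 1) / \<gamma> * B * norm (v n s)
      + \<eta> n / \<gamma> * B * (L * norm (a n s) + L * norm (v n s) + p n * norm gs)
      + r n * L' * ((norm (a n s))\<^sup>2 + (norm (v n s))\<^sup>2))"
      using int int2 norm_remainder[OF n1(1)] small[of n] n by (intro integral_mono) auto
    also have "\<dots> = \<bar>rescaling n - 1 - \<eta> n * e0\<bar> * mean_norm (U n)
      + \<eta> n * (rescaling n - 1) * B * mean_norm (U n)
      + \<eta> n * (rescaling n / \<gamma> * B\<^sup>2) * mean_norm (v n)
      + (rescaling n - 1) / \<gamma> * B * mean_norm (v n)
      + \<eta> n / \<gamma> * B * (L * mean_norm (a n) + L * mean_norm (v n) + p n * norm gs)
      + r n * L' * (mean_square (a n) + mean_square (v n))"
      using int int2 by (simp add: M.prob_space)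
    also have "\<dots> \<le> \<bar>rescaling n - 1 - \<eta> n * e0\<bar> * KU
      + \<eta> n * (rescaling n - 1) * B * KU
      + \<eta> n * (rescaling n / \<gamma> * B\<^sup>2) * (K1 * r n)
      + (rescaling n - 1) / \<gamma> * B * (K1 * r n)
      + \<eta> n / \<gamma> * B * (L * (K1 * r n) + L * (K1 * r n) + p n * norm gs)
      + r n * L' * (K * \<eta> n + K * \<eta> n)"
      using um[of n] n fm[OF n1(2)] sq[OF n1(2)] e l pn gamma L0 L'0 B_nonneg rn
      by (intro add_mono mult_left_mono) auto
    also have "\<bar>rescaling n - 1 - \<eta> n * e0\<bar> = \<eta> n * \<bar>(rescaling n - 1) / \<eta> n - e0\<bar>"
    proof -
      have "rescaling n - 1 - \<eta> n * e0 = \<eta> n * ((rescaling n - 1) / \<eta> n - e0)" using e by (simp add: field_simps)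
      then show ?thesis using e by (simp add: abs_mult)
    qed
    also have "(rescaling n - 1) / \<gamma> * B * (K1 * r n) = \<eta> n * ((rescaling n - 1) / \<eta> n / \<gamma> * B * (K1 * r n))"
      using e by simp
    finally show ?thesis unfolding \<delta>_def by (simp add: algebra_simps)
  qed
  ultimately show ?thesis by blast
qed

lemma grad_noise_moment: "n \<ge> 1 \<Longrightarrow> mean_square (grad_noise n) \<le> \<eta> n * \<kappa>\<^sub>2"
proof -
  assume n: "n \<ge> 1"
  have e: "\<eta> n > 0" by (rule eta_pos[OF n])
  have "mean_square (grad_noise n) \<le> E (\<lambda>s. \<eta> n * (norm (xi n s))\<^sup>2)"
  proof (rule integral_mono)
    show "integrable M (\<lambda>s. (norm (grad_noise n s))\<^sup>2)" using grad_noise_square[OF n] by (simp add: M.square_integrable_def)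
    show "integrable M (\<lambda>s. \<eta> n * (norm (xi n s))\<^sup>2)" using xi_square[OF n] by (simp add: M.square_integrable_def)
    fix s
    have "(norm (grad_noise n s))\<^sup>2 = \<eta> n * (norm (P *v xi n s))\<^sup>2"
      using r_square[OF n] by (simp add: grad_noise_def power_mult_distrib power2_eq_square[of "r n"])
    also have "\<dots> \<le> \<eta> n * (norm (xi n s))\<^sup>2"
      using e norm_P by (intro mult_left_mono power_mono) auto
    finally show "(norm (grad_noise n s))\<^sup>2 \<le> \<eta> n * (norm (xi n s))\<^sup>2" .
  qed
  also have "\<dots> \<le> \<eta> n * \<kappa>\<^sub>2" using xi_square[OF n] e by (simp add: mult_left_mono)
  finally show ?thesis .
qed

lemma jump_eq:
  assumes n: "n \<ge> 1" and s: "s \<in> space M"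
  shows "jump n s = (if \<omega> n s then - (1 - p n) else p n) *\<^sub>R w n s + (if \<omega> n s then 0 else 1) *\<^sub>R (\<eta> n *\<^sub>R (Q *v xi n s))"
  by (simp add: jump_def v_step[OF n s] algebra_simps)

definition w_fun :: "nat \<Rightarrow> real^'d \<Rightarrow> real^'d" where "w_fun n y = Q *v y - \<eta> n *\<^sub>R (Q *v gf y)"

lemma w_fun: "w n s = w_fun n (x n s)"
  by (simp add: w_fun_def w_def v_def)

lemma w_fun_measurable [measurable]: "w_fun n \<in> borel_measurable borel"
  unfolding w_fun_def[abs_def] by measurable

text \<open>
  A reset, of probability \<open>p\<close>, changes the orthogonal component by its full size; otherwise it only moves by a
  fraction \<open>p\<close> away from its mean. Hence the factor \<open>p\<close> that makes this noise negligible.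
\<close>

lemma jump_moment:
  assumes n: "n \<ge> 1"
  shows "mean_square (jump n) \<le> 4 * p n * mean_square (w n) + 2 * (\<eta> n)\<^sup>2 * \<kappa>\<^sub>2"
proof -
  have pn: "0 < p n" "p n \<le> 1" using p_bounds(1)[OF n] p_bounds(2) by auto
  define \<psi> where "\<psi> b = (if b then (1 - p n)\<^sup>2 else (p n)\<^sup>2)" for b
  have iw: "integrable M (\<lambda>s. (norm (w n s))\<^sup>2)" using w_square[OF n] by (simp add: M.square_integrable_def)
  have ix: "integrable M (\<lambda>s. (norm (xi n s))\<^sup>2)" using xi_square[OF n] by (simp add: M.square_integrable_def)
  have fac: "integrable M (\<lambda>s. \<psi> (\<omega> n s) *\<^sub>R (norm (w n s))\<^sup>2)"
    "(\<integral>s. \<psi> (\<omega> n s) *\<^sub>R (norm (w n s))\<^sup>2 \<partial>M) = (p n * \<psi> True + (1 - p n) * \<psi> False) *\<^sub>R mean_square (w n)"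
    using projection_step_factor[OF n, of "\<lambda>y z. (norm (w_fun n y))\<^sup>2" \<psi>] iw
    by (simp_all add: w_fun[symmetric] case_prod_unfold)
  have "mean_square (jump n) \<le> E (\<lambda>s. 2 * (\<psi> (\<omega> n s) *\<^sub>R (norm (w n s))\<^sup>2) + 2 * (\<eta> n)\<^sup>2 * (norm (xi n s))\<^sup>2)"
  proof (rule integral_mono)
    show "integrable M (\<lambda>s. (norm (jump n s))\<^sup>2)" using jump_square[OF n] by (simp add: M.square_integrable_def)
    show "integrable M (\<lambda>s. 2 * (\<psi> (\<omega> n s) *\<^sub>R (norm (w n s))\<^sup>2) + 2 * (\<eta> n)\<^sup>2 * (norm (xi n s))\<^sup>2)"
      using fac(1) ix by auto
    fix s assume s: "s \<in> space M"
    define c where "c = (if \<omega> n s then - (1 - p n) else p n)"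
    define d where "d = \<eta> n *\<^sub>R (Q *v xi n s)"
    have "norm (jump n s) \<le> norm (c *\<^sub>R w n s) + norm d"
      unfolding jump_eq[OF n s] c_def[symmetric] d_def[symmetric]
      by (rule order_trans[OF norm_triangle_ineq]) auto
    then have "(norm (jump n s))\<^sup>2 \<le> (norm (c *\<^sub>R w n s) + norm d)\<^sup>2" by (intro power_mono) auto
    also have "\<dots> \<le> 2 * (norm (c *\<^sub>R w n s))\<^sup>2 + 2 * (norm d)\<^sup>2"
      using sum_squares_bound[of "norm (c *\<^sub>R w n s)" "norm d"] by (simp add: power2_sum)
    also have "(norm (c *\<^sub>R w n s))\<^sup>2 = \<psi> (\<omega> n s) *\<^sub>R (norm (w n s))\<^sup>2"
    proof -
      have "c\<^sup>2 = \<psi> (\<omega> n s)" by (simp add: c_def \<psi>_def power2_eq_square algebra_simps)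
      then show ?thesis by (simp add: power_mult_distrib)
    qed
    also have "(norm d)\<^sup>2 \<le> (\<eta> n)\<^sup>2 * (norm (xi n s))\<^sup>2"
      using norm_Q by (simp add: d_def power_mult_distrib mult_left_mono power_mono)
    finally show "(norm (jump n s))\<^sup>2 \<le> 2 * (\<psi> (\<omega> n s) *\<^sub>R (norm (w n s))\<^sup>2) + 2 * (\<eta> n)\<^sup>2 * (norm (xi n s))\<^sup>2"
      by simp
  qed
  also have "\<dots> = 2 * ((p n * \<psi> True + (1 - p n) * \<psi> False) * mean_square (w n)) + 2 * (\<eta> n)\<^sup>2 * mean_square (xi n)"
    using fac ix by simp
  also have "\<dots> \<le> 2 * ((2 * p n) * mean_square (w n)) + 2 * (\<eta> n)\<^sup>2 * \<kappa>\<^sub>2"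
  proof (intro add_mono mult_left_mono mult_right_mono)
    have "p n * (1 - p n)\<^sup>2 \<le> p n * 1" using pn by (intro mult_left_mono) (auto simp: power_le_one)
    moreover have "(1 - p n) * (p n)\<^sup>2 \<le> 1 * p n" using pn by (intro mult_mono) (auto simp: power2_eq_square mult_left_le_one_le)
    ultimately show "p n * \<psi> True + (1 - p n) * \<psi> False \<le> 2 * p n" by (simp add: \<psi>_def)
  qed (use xi_square(2)[OF n] in auto)
  finally show ?thesis by simp
qed

text \<open>
  Against the variance \<open>\<eta> n\<close> of the gradient noise, the noise of the resets has variance of order
  \<open>\<eta> n * sqrt (\<eta> n)\<close>: the innovations have variance \<open>p n * \<eta> n\<close> and the corrector contributes a bounded factor.
\<close>

lemma reset_noise_moment:
  "\<exists>C N. C \<ge> 0 \<and> (\<forall>n\<ge>N. mean_square (reset_noise n) \<le> \<eta> n * (C * r n))"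
proof -
  obtain K where K: "K \<ge> 0" and sq: "\<And>n. n \<ge> 1 \<Longrightarrow> mean_square (a n) \<le> K * \<eta> n \<and> mean_square (v n) \<le> K * \<eta> n"
    using second_moments by blast
  obtain N where N: "N \<ge> 2" and small: "\<And>n. n \<ge> N \<Longrightarrow> r n \<le> 1 \<and> p n = \<gamma> * r n"
    using reset_probability_threshold by blast
  define Cw where "Cw = 2 * K + 2 * (2 * (norm gs)\<^sup>2 + 2 * L\<^sup>2 * (K + K))"
  define C where "C = (B / \<gamma>)\<^sup>2 * (4 * \<gamma> * Cw + 2 * \<kappa>\<^sub>2)"
  have Cw: "Cw \<ge> 0" using K by (simp add: Cw_def)
  have "C \<ge> 0" using Cw gamma kappa2 by (simp add: C_def)
  moreover have "mean_square (reset_noise n) \<le> \<eta> n * (C * r n)" if n: "n \<ge> N" for n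
  proof -
    have n1: "n \<ge> 1" using n N by auto
    have e: "\<eta> n > 0" by (rule eta_pos[OF n1])
    have rn: "0 < r n" "r n \<le> 1" "p n = \<gamma> * r n" using r_pos[OF n1] small[OF n] by auto
    have e1: "\<eta> n \<le> 1" using rn r_square[OF n1, symmetric] by (simp add: mult_le_one)
    have ia: "integrable M (\<lambda>s. (norm (a n s))\<^sup>2)" "integrable M (\<lambda>s. (norm (v n s))\<^sup>2)" "integrable M (\<lambda>s. (norm (w n s))\<^sup>2)"
      using a_square[OF n1] v_square[OF n1] w_square[OF n1] by (simp_all add: M.square_integrable_def)
    have Ew: "mean_square (w n) \<le> Cw * \<eta> n"
    proof -
      have "mean_square (w n) \<le> E (\<lambda>s. 2 * (norm (v n s))\<^sup>2 + 2 * (\<eta> n)\<^sup>2 *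
          (2 * (norm gs)\<^sup>2 + 2 * L\<^sup>2 * ((norm (a n s))\<^sup>2 + (norm (v n s))\<^sup>2)))"
      proof (rule integral_mono[OF ia(3)])
        fix s
        have "(norm (w n s))\<^sup>2 \<le> 2 * (norm (v n s))\<^sup>2 + 2 * (\<eta> n)\<^sup>2 * (norm (gf (x n s)))\<^sup>2"
          using w_norm_square[OF n1, of 1 s] by simp
        also have "\<dots> \<le> 2 * (norm (v n s))\<^sup>2 + 2 * (\<eta> n)\<^sup>2 * (2 * (norm gs)\<^sup>2 + 2 * L\<^sup>2 * ((norm (a n s))\<^sup>2 + (norm (v n s))\<^sup>2))"
          by (intro add_left_mono mult_left_mono norm_gf_square) auto
        finally show "(norm (w n s))\<^sup>2 \<le> 2 * (norm (v n s))\<^sup>2 + 2 * (\<eta> n)\<^sup>2 * (2 * (norm gs)\<^sup>2 + 2 * L\<^sup>2 * ((norm (a n s))\<^sup>2 + (norm (v n s))\<^sup>2))" .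
      qed (use ia in auto)
      also have "\<dots> = 2 * mean_square (v n) + 2 * (\<eta> n)\<^sup>2 * (2 * (norm gs)\<^sup>2 + 2 * L\<^sup>2 * (mean_square (a n) + mean_square (v n)))"
        using ia by (simp add: M.prob_space)
      also have "\<dots> \<le> 2 * (K * \<eta> n) + 2 * (\<eta> n * 1) * (2 * (norm gs)\<^sup>2 + 2 * L\<^sup>2 * (K * 1 + K * 1))"
      proof (intro add_mono mult_mono mult_left_mono order_refl)
        show "mean_square (v n) \<le> K * \<eta> n" using sq[OF n1] by simp
        show "(\<eta> n)\<^sup>2 \<le> \<eta> n * 1" using e e1 by (simp add: power2_eq_square mult_left_le_one_le)
        show "mean_square (a n) \<le> K * 1" "mean_square (v n) \<le> K * 1"
          using sq[OF n1] mult_left_mono[OF e1 K] by linarith+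
      qed (use e K in auto)
      also have "\<dots> = Cw * \<eta> n" by (simp add: Cw_def algebra_simps)
      finally show ?thesis .
    qed
    have k: "\<kappa> n / r n = 1 / \<gamma>" using rn gamma r_square[OF n1, symmetric] by (simp add: \<kappa>_def)
    have "mean_square (reset_noise n) \<le> E (\<lambda>s. (B / \<gamma>)\<^sup>2 * (norm (jump n s))\<^sup>2)"
    proof (rule integral_mono)
      show "integrable M (\<lambda>s. (norm (reset_noise n s))\<^sup>2)" using reset_noise_square[OF n1] by (simp add: M.square_integrable_def)
      show "integrable M (\<lambda>s. (B / \<gamma>)\<^sup>2 * (norm (jump n s))\<^sup>2)" using jump_square[OF n1] by (simp add: M.square_integrable_def)
      fix s
      have "norm (reset_noise n s) \<le> B / \<gamma> * norm (jump n s)"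
        using norm_PG[of "jump n s"] gamma by (simp add: reset_noise_def k divide_right_mono)
      then have "(norm (reset_noise n s))\<^sup>2 \<le> (B / \<gamma> * norm (jump n s))\<^sup>2" by (intro power_mono) auto
      then show "(norm (reset_noise n s))\<^sup>2 \<le> (B / \<gamma>)\<^sup>2 * (norm (jump n s))\<^sup>2" by (simp only: power_mult_distrib)
    qed
    also have "\<dots> = (B / \<gamma>)\<^sup>2 * mean_square (jump n)" by simp
    also have "\<dots> \<le> (B / \<gamma>)\<^sup>2 * (4 * (\<gamma> * r n) * (Cw * \<eta> n) + 2 * (\<eta> n * r n) * \<kappa>\<^sub>2)"
    proof (intro mult_left_mono order_trans[OF jump_moment[OF n1]] add_mono mult_mono mult_right_mono)
      show "(\<eta> n)\<^sup>2 \<le> \<eta> n * r n"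
      proof -
        have "\<eta> n \<le> r n" using rn r_square[OF n1, symmetric] by (simp add: mult_left_le_one_le)
        then show ?thesis using e by (simp add: power2_eq_square mult_left_mono)
      qed
    qed (use rn Ew gamma Cw kappa2 e in auto)
    also have "\<dots> = \<eta> n * (C * r n)" by (simp add: C_def algebra_simps)
    finally show ?thesis .
  qed
  ultimately show ?thesis by blast
qed

end

section \<open>The one-step recursion of the characteristic functions\<close>

lemma powr_between_square_and_cube:
  fixes y :: real
  assumes y: "0 \<le> y" and q: "2 \<le> q" "q \<le> 3"
  shows "min (y\<^sup>2) (y ^ 3) \<le> y powr q"
proof (cases "y = 0")
  case False
  then have y0: "y > 0" using y by simp
  show ?thesis
  proof (cases "y \<le> 1")
    case True
    have "y ^ 3 = y powr 3" using y0 powr_realpow[of y 3] by simp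
    also have "\<dots> \<le> y powr q" using True y0 q by (intro powr_mono') auto
    finally show ?thesis by simp
  next
    case False
    have "y\<^sup>2 = y powr 2" using y0 powr_realpow[of y 2] by simp
    also have "\<dots> \<le> y powr q" using False y0 q by (intro powr_mono) auto
    finally show ?thesis by simp
  qed
qed simp

text \<open>
  Second-order expansion in the main increment \<open>y\<close>, first-order in the smaller increment \<open>z\<close>, and none in the
  remainder \<open>e\<close>. The power \<open>q\<close> between 2 and 3 interpolates the quadratic and cubic bounds of the Taylor
  remainder, so that moments of order slightly above 2 suffice.
\<close>

lemma cis_increment_approx:
  fixes x y z e q :: real
  assumes q: "2 \<le> q" "q \<le> 3"
  shows "cmod (cis (x + y + z + e) - cis x * (1 + \<i> * y - y\<^sup>2 / 2 + \<i> * z))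
    \<le> \<bar>e\<bar> + \<bar>y\<bar> powr q + z\<^sup>2 + \<bar>y\<bar> * \<bar>z\<bar>"
proof -
  have cis_exp: "cis t = iexp t" for t by (simp add: cis_conv_exp)
  have one: "cmod (cis t - 1) \<le> \<bar>t\<bar>" for t
    using iexp_approx1[of t 0] by (simp add: cis_exp)
  have two: "cmod (cis t - (1 + \<i> * t)) \<le> t\<^sup>2 / 2" for t
    using iexp_approx1[of t 1] by (simp add: cis_exp numeral_2_eq_2 algebra_simps)
  have three: "cmod (cis t - (1 + \<i> * t - t\<^sup>2 / 2)) \<le> \<bar>t\<bar> powr q" for t
  proof -
    have s: "(\<Sum>k\<le>2. (\<i> * complex_of_real t) ^ k / fact k) = 1 + \<i> * t - t\<^sup>2 / 2"
      by (simp add: numeral_2_eq_2 power2_eq_square algebra_simps)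
    have "cmod (cis t - (1 + \<i> * t - t\<^sup>2 / 2)) \<le> \<bar>t\<bar> ^ 3 / 6"
      using iexp_approx1[of t 2] unfolding s by (simp add: cis_exp fact_numeral)
    also have "\<dots> \<le> \<bar>t\<bar> ^ 3" by simp
    finally have 3: "cmod (cis t - (1 + \<i> * t - t\<^sup>2 / 2)) \<le> \<bar>t\<bar> ^ 3" .
    have "cmod (cis t - (1 + \<i> * t - t\<^sup>2 / 2)) \<le> \<bar>t\<bar>\<^sup>2"
      using iexp_approx2[of t 2] unfolding s by (simp add: cis_exp fact_numeral)
    with 3 show ?thesis using powr_between_square_and_cube[of "\<bar>t\<bar>" q] q by linarith
  qed
  have "cis (x + y + z + e) = cis x * (cis (y + z) * cis e)"
    by (simp add: cis_mult algebra_simps)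
  then have "cis (x + y + z + e) - cis x * (1 + \<i> * y - y\<^sup>2 / 2 + \<i> * z)
      = cis x * (cis (y + z) * (cis e - 1) + (cis y - (1 + \<i> * y - y\<^sup>2 / 2)) + (cis z - (1 + \<i> * z)) + (cis y - 1) * (cis z - 1))"
    by (simp add: algebra_simps cis_mult)
  also have "cmod \<dots> = cmod (cis (y + z) * (cis e - 1) + (cis y - (1 + \<i> * y - y\<^sup>2 / 2)) + (cis z - (1 + \<i> * z)) + (cis y - 1) * (cis z - 1))"
    by (simp add: norm_mult)
  also have "\<dots> \<le> \<bar>e\<bar> + \<bar>y\<bar> powr q + z\<^sup>2 / 2 + \<bar>y\<bar> * \<bar>z\<bar>"
    using one[of e] three[of y] two[of z] one[of y] one[of z]
    by (intro order_trans[OF norm_triangle_ineq] add_mono) (auto simp: norm_mult intro!: mult_mono)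
  also have "\<dots> \<le> \<bar>e\<bar> + \<bar>y\<bar> powr q + z\<^sup>2 + \<bar>y\<bar> * \<bar>z\<bar>" by simp
  finally show ?thesis .
qed

context lpsa_clt
begin

definition \<phi> :: "nat \<Rightarrow> real^'d \<Rightarrow> complex" where "\<phi> n t = (\<integral>s. cis (t \<bullet> U n s) \<partial>M)"

text \<open>
  The second-order expansion of the characteristic function of the gradient noise of one step.
\<close>

abbreviation "damping n t \<equiv> 1 - complex_of_real (\<eta> n / 2 * (t \<bullet> (\<Sigma> xs *v t)))"

text \<open>
  The noise has moments of some order above 2; the expansion can exploit at most three of them.
\<close>

definition qq :: real where "qq = min q 3"

lemma qq: "2 < qq" "qq \<le> 3" "qq \<le> q"
  using q2 by (auto simp: qq_def)

definition U_fun :: "nat \<Rightarrow> real^'d \<Rightarrow> real^'d" where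
  "U_fun n y = (1 / r (n - 1)) *\<^sub>R ((P *v y - xs) - \<kappa> (n - 1) *\<^sub>R (P *v (G *v (Q *v y))))"

definition drifted :: "nat \<Rightarrow> real^'d \<Rightarrow> real^'d" where
  "drifted n y = U_fun n y - \<eta> n *\<^sub>R drift (U_fun n y) + \<eta> n *\<^sub>R bias"

lemma U_fun: "U n s = U_fun n (x n s)" and drifted: "predictable n s = drifted n (x n s)"
  by (simp_all add: U_def U_fun_def predictable_def drifted_def a_def v_def)

lemma U_fun_measurable [measurable]: "U_fun n \<in> borel_measurable borel"
  unfolding U_fun_def[abs_def] by measurable

lemma drifted_measurable [measurable]: "drifted n \<in> borel_measurable borel"
  unfolding drifted_def[abs_def] drift_matrix by measurable

lemma cis_inner_measurable [measurable (raw)]: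
  fixes f :: "'a \<Rightarrow> real^'d"
  assumes "f \<in> borel_measurable N"
  shows "(\<lambda>s. cis (t \<bullet> f s)) \<in> borel_measurable N"
  unfolding cis_conv_exp
  by (rule borel_measurable_continuous_on[OF _ assms]) (intro continuous_intros)

lemma integrable_cis_mult:
  fixes h :: "'w \<Rightarrow> real" and f :: "'w \<Rightarrow> real^'d"
  assumes h: "integrable M h" and f: "f \<in> borel_measurable M"
  shows "integrable M (\<lambda>s. cis (t \<bullet> f s) * complex_of_real (h s))"
proof (rule Bochner_Integration.integrable_bound[OF h])
  show "(\<lambda>s. cis (t \<bullet> f s) * complex_of_real (h s)) \<in> borel_measurable M"
    using borel_measurable_integrable[OF h] f by measurable
qed (simp add: norm_mult)

lemma integrable_cis:
  fixes f :: "'w \<Rightarrow> real^'d"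
  assumes f: "f \<in> borel_measurable M"
  shows "integrable M (\<lambda>s. cis (t \<bullet> f s))"
  using integrable_cis_mult[OF _ f, of "\<lambda>_. 1"] by simp

lemma drift_symmetric: "t \<bullet> drift y = drift t \<bullet> y"
  by (simp add: drift_def inner_diff_left inner_diff_right P_inner[symmetric] G_inner[symmetric])

lemma predictable_char:
  assumes n: "n \<ge> 2"
  shows "(\<integral>s. cis (t \<bullet> predictable n s) \<partial>M) = \<phi> n (t - \<eta> n *\<^sub>R drift t) * cis (\<eta> n * (t \<bullet> bias))"
proof -
  have "t \<bullet> predictable n s = (t - \<eta> n *\<^sub>R drift t) \<bullet> U n s + \<eta> n * (t \<bullet> bias)" for s
    by (simp add: predictable_def inner_simps drift_symmetric)
  then have "cis (t \<bullet> predictable n s) = cis ((t - \<eta> n *\<^sub>R drift t) \<bullet> U n s) * cis (\<eta> n * (t \<bullet> bias))" for s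
    by (simp add: cis_mult)
  then show ?thesis by (simp add: \<phi>_def)
qed

lemma grad_noise_orthogonal:
  assumes n: "n \<ge> 2"
  shows "(\<integral>s. cis (t \<bullet> predictable n s) * complex_of_real (t \<bullet> grad_noise n s) \<partial>M) = 0"
proof -
  have n1: "n \<ge> 1" using n by simp
  define T where "T y u = cis (t \<bullet> drifted n y) * complex_of_real (t \<bullet> (r n *\<^sub>R (P *v u)))" for y u
  have lin: "bounded_linear (T y)" for y
  proof -
    have "bounded_linear (\<lambda>u. t \<bullet> (r n *\<^sub>R (P *v u)))"
      by (intro bounded_linear_compose[OF bounded_linear_inner_right] bounded_linear_compose[OF bounded_linear_scaleR_right]
          matrix_vector_mul_bounded_linear)
    then have "bounded_linear (\<lambda>u. complex_of_real (t \<bullet> (r n *\<^sub>R (P *v u))))"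
      by (rule bounded_linear_compose[OF bounded_linear_of_real])
    then show ?thesis unfolding T_def[abs_def] by (rule bounded_linear_const_mult)
  qed
  have Tm: "(\<lambda>(y, u). T y u) \<in> borel_measurable (borel \<Otimes>\<^sub>M borel)"
    unfolding T_def case_prod_unfold by measurable
  have "integrable M (\<lambda>s. t \<bullet> grad_noise n s)"
    using M.square_integrable_imp_integrable[OF grad_noise_square[OF n1]] by simp
  then have int: "integrable M (\<lambda>s. cis (t \<bullet> predictable n s) * complex_of_real (t \<bullet> grad_noise n s))"
    using predictable_square[OF n] by (intro integrable_cis_mult) (auto simp: M.square_integrable_def)
  have eq: "T (x n s) (xi n s) = cis (t \<bullet> predictable n s) * complex_of_real (t \<bullet> grad_noise n s)" for s
    by (simp add: T_def drifted grad_noise_def)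
  have "(\<integral>s. 1 *\<^sub>R T (x n s) (xi n s) \<partial>M) = 0"
    by (rule noise_orthogonal[where \<psi> = "\<lambda>_. 1", OF n1 lin Tm]) (simp add: eq int)
  then show ?thesis by (simp add: eq)
qed

lemma reset_noise_orthogonal:
  assumes n: "n \<ge> 2"
  shows "(\<integral>s. cis (t \<bullet> predictable n s) * complex_of_real (t \<bullet> reset_noise n s) \<partial>M) = 0"
proof -
  have n1: "n \<ge> 1" using n by simp
  define l where "l = - (\<kappa> n / r n) *\<^sub>R (G *v (P *v t))"
  have tN2: "t \<bullet> reset_noise n s = l \<bullet> jump n s" for s
    by (simp add: reset_noise_def l_def inner_simps P_inner[symmetric] G_inner[symmetric])
  \<comment> \<open>the innovation as a combination of a reset part and a noise part\<close>
  define \<psi>1 where "\<psi>1 b = (if b then - (1 - p n) else p n)" for b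
  define \<psi>2 where "\<psi>2 b = (if b then 0 else 1 :: real)" for b :: bool
  define h where "h y = cis (t \<bullet> drifted n y) * complex_of_real (l \<bullet> w_fun n y)" for y
  define T where "T y u = cis (t \<bullet> drifted n y) * complex_of_real (l \<bullet> (\<eta> n *\<^sub>R (Q *v u)))" for y u
  have pm: "predictable n \<in> borel_measurable M" using predictable_square[OF n] by (simp add: M.square_integrable_def)
  have heq: "h (x n s) = cis (t \<bullet> predictable n s) * complex_of_real (l \<bullet> w n s)" for s
    by (simp add: h_def drifted w_fun)
  have hm: "h \<in> borel_measurable borel" unfolding h_def[abs_def] by measurable
  have hint: "integrable M (\<lambda>s. h (x n s))"
    unfolding heq using M.square_integrable_imp_integrable[OF w_square[OF n1]] pm
    by (intro integrable_cis_mult) auto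
  have h1: "integrable M (\<lambda>s. \<psi>1 (\<omega> n s) *\<^sub>R h (x n s))"
    "(\<integral>s. \<psi>1 (\<omega> n s) *\<^sub>R h (x n s) \<partial>M) = (p n * \<psi>1 True + (1 - p n) * \<psi>1 False) *\<^sub>R (\<integral>s. h (x n s) \<partial>M)"
    using projection_step_factor[OF n1, of "\<lambda>y z. h y" \<psi>1] hint hm by (simp_all add: case_prod_unfold)
  have h0: "(\<integral>s. \<psi>1 (\<omega> n s) *\<^sub>R h (x n s) \<partial>M) = 0" unfolding h1(2) by (simp add: \<psi>1_def algebra_simps)
  have lin: "bounded_linear (T y)" for y
  proof -
    have "bounded_linear (\<lambda>u. l \<bullet> (\<eta> n *\<^sub>R (Q *v u)))"
      by (intro bounded_linear_compose[OF bounded_linear_inner_right] bounded_linear_compose[OF bounded_linear_scaleR_right]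
          matrix_vector_mul_bounded_linear)
    then have "bounded_linear (\<lambda>u. complex_of_real (l \<bullet> (\<eta> n *\<^sub>R (Q *v u))))"
      by (rule bounded_linear_compose[OF bounded_linear_of_real])
    then show ?thesis unfolding T_def[abs_def] by (rule bounded_linear_const_mult)
  qed
  have Tm: "(\<lambda>(y, u). T y u) \<in> borel_measurable (borel \<Otimes>\<^sub>M borel)"
    unfolding T_def case_prod_unfold by measurable
  have jump_int: "integrable M (\<lambda>s. cis (t \<bullet> predictable n s) * complex_of_real (l \<bullet> jump n s))"
    using M.square_integrable_imp_integrable[OF jump_square[OF n1]] pm
    by (intro integrable_cis_mult) auto
  have dec: "\<psi>2 (\<omega> n s) *\<^sub>R T (x n s) (xi n s)
      = cis (t \<bullet> predictable n s) * complex_of_real (l \<bullet> jump n s) - \<psi>1 (\<omega> n s) *\<^sub>R h (x n s)" if "s \<in> space M" for s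
    unfolding heq jump_eq[OF n1 that]
    by (simp add: T_def drifted \<psi>1_def \<psi>2_def inner_simps algebra_simps
        scaleR_conv_of_real[of _ "_ :: complex"])
  have Tint: "integrable M (\<lambda>s. \<psi>2 (\<omega> n s) *\<^sub>R T (x n s) (xi n s))"
  proof -
    have "integrable M (\<lambda>s. cis (t \<bullet> predictable n s) * complex_of_real (l \<bullet> jump n s) - \<psi>1 (\<omega> n s) *\<^sub>R h (x n s))"
      using jump_int h1(1) by simp
    then show ?thesis using dec by (simp cong: Bochner_Integration.integrable_cong)
  qed
  have T0: "(\<integral>s. \<psi>2 (\<omega> n s) *\<^sub>R T (x n s) (xi n s) \<partial>M) = 0"
    by (rule noise_orthogonal[OF n1 lin Tm Tint])
  have "(\<integral>s. cis (t \<bullet> predictable n s) * complex_of_real (l \<bullet> jump n s) \<partial>M)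
      = (\<integral>s. \<psi>2 (\<omega> n s) *\<^sub>R T (x n s) (xi n s) + \<psi>1 (\<omega> n s) *\<^sub>R h (x n s) \<partial>M)"
    by (rule Bochner_Integration.integral_cong) (simp_all add: dec)
  also have "\<dots> = 0" using Tint h1(1) T0 h0 by simp
  finally show ?thesis by (simp add: tN2)
qed

lemma abs_quadratic_Sigma:
  "\<bar>t \<bullet> (\<Sigma> y *v t) - t \<bullet> (\<Sigma> z *v t)\<bar> \<le> (norm t)\<^sup>2 * (L * norm (y - z))"
proof -
  have "t \<bullet> (\<Sigma> y *v t) - t \<bullet> (\<Sigma> z *v t) = t \<bullet> ((\<Sigma> y - \<Sigma> z) *v t)"
    by (simp add: matrix_vector_mult_diff_rdistrib inner_diff_right)
  also have "\<bar>\<dots>\<bar> \<le> norm t * norm ((\<Sigma> y - \<Sigma> z) *v t)" by (rule Cauchy_Schwarz_ineq2)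
  also have "\<dots> \<le> norm t * (L * norm (y - z) * norm t)"
  proof (rule mult_left_mono)
    have "norm ((\<Sigma> y - \<Sigma> z) *v t) \<le> spectral_norm (\<Sigma> y - \<Sigma> z) * norm t"
      by (rule norm_matrix_vector_mult_le_spectral_norm)
    also have "\<dots> \<le> L * norm (y - z) * norm t" by (intro mult_right_mono Sigma_lipschitz) auto
    finally show "norm ((\<Sigma> y - \<Sigma> z) *v t) \<le> L * norm (y - z) * norm t" .
  qed simp
  finally show ?thesis by (simp add: power2_eq_square mult_ac)
qed

lemma noise_covariance:
  assumes n: "n \<ge> 2" and t: "P *v t = t"
  shows "cmod ((\<integral>s. cis (t \<bullet> predictable n s) * complex_of_real ((t \<bullet> grad_noise n s)\<^sup>2) \<partial>M)
      - complex_of_real (\<eta> n * (t \<bullet> (\<Sigma> xs *v t))) * (\<integral>s. cis (t \<bullet> predictable n s) \<partial>M))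
    \<le> \<eta> n * ((norm t)\<^sup>2 * (L * E (\<lambda>s. norm (x n s - xs))))"
proof -
  have n1: "n \<ge> 1" using n by simp
  have e: "\<eta> n > 0" by (rule eta_pos[OF n1])
  have pm: "predictable n \<in> borel_measurable M" using predictable_square[OF n] by (simp add: M.square_integrable_def)
  have tN1: "(t \<bullet> grad_noise n s)\<^sup>2 = \<eta> n * (t \<bullet> xi n s)\<^sup>2" for s
    using r_square[OF n1] t by (simp add: grad_noise_def P_inner[symmetric] power_mult_distrib power2_eq_square[of "r n"])
  have txi: "integrable M (\<lambda>s. (t \<bullet> xi n s)\<^sup>2)"
  proof -
    have "M.square_integrable (\<lambda>s. t \<bullet> xi n s)"
      by (rule M.square_integrable_dominated[OF xi_square(1)[OF n1], of _ 0 "norm t"])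
        (use xi_measurable[OF n1] Cauchy_Schwarz_ineq2 in auto)
    then show ?thesis by (simp add: M.square_integrable_def)
  qed
  define h where "h y z = cis (t \<bullet> drifted n y) * complex_of_real ((t \<bullet> (gf y - gF y z))\<^sup>2)" for y z
  have gFm: "(\<lambda>w. gF (fst w) (snd w)) \<in> borel_measurable (borel \<Otimes>\<^sub>M D)"
    using gF_measurable by (simp add: case_prod_unfold)
  have hm: "(\<lambda>(y, z). h y z) \<in> borel_measurable (borel \<Otimes>\<^sub>M D)"
    unfolding h_def case_prod_unfold using gFm by measurable
  have heq: "h (x n s) (\<zeta> n s) = cis (t \<bullet> predictable n s) * complex_of_real ((t \<bullet> xi n s)\<^sup>2)" for s
    by (simp add: h_def drifted xi_def)
  have hint: "integrable M (\<lambda>s. h (x n s) (\<zeta> n s))" unfolding heq by (rule integrable_cis_mult[OF txi pm])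
  have "(\<integral>s. h (x n s) (\<zeta> n s) \<partial>M) = (\<integral>s. (\<integral>z. p n *\<^sub>R h (x n s) z + (1 - p n) *\<^sub>R h (x n s) z \<partial>D) \<partial>M)"
    by (rule expectation_step[OF n1, of "\<lambda>y z b. h y z"]) (use hm hint in auto)
  also have "\<dots> = (\<integral>s. (\<integral>z. h (x n s) z \<partial>D) \<partial>M)" by (simp add: scaleR_add_left[symmetric])
  also have "\<dots> = (\<integral>s. cis (t \<bullet> predictable n s) * complex_of_real (t \<bullet> (\<Sigma> (x n s) *v t)) \<partial>M)"
    unfolding h_def by (simp add: covariance_quadratic drifted del: of_real_power)
  finally have I1: "(\<integral>s. cis (t \<bullet> predictable n s) * complex_of_real ((t \<bullet> xi n s)\<^sup>2) \<partial>M)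
      = (\<integral>s. cis (t \<bullet> predictable n s) * complex_of_real (t \<bullet> (\<Sigma> (x n s) *v t)) \<partial>M)" by (simp add: heq)
  define d where "d s = t \<bullet> (\<Sigma> (x n s) *v t) - t \<bullet> (\<Sigma> xs *v t)" for s
  have xint: "integrable M (\<lambda>s. norm (x n s - xs))"
    by (intro integrable_norm M.square_integrable_imp_integrable M.square_integrable_diff x_square_integrable n1 M.square_integrable_const)
  have dle: "\<bar>d s\<bar> \<le> (norm t)\<^sup>2 * (L * norm (x n s - xs))" for s
    unfolding d_def by (rule abs_quadratic_Sigma)
  have dm: "d \<in> borel_measurable M"
  proof -
    have "(\<lambda>y. \<integral>z. (t \<bullet> (gf y - gF y z))\<^sup>2 \<partial>D) \<in> borel_measurable borel"
      by (rule D.borel_measurable_lebesgue_integral) (use gFm in \<open>unfold case_prod_unfold, measurable\<close>)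
    then have "(\<lambda>y. t \<bullet> (\<Sigma> y *v t)) \<in> borel_measurable borel" by (simp add: covariance_quadratic)
    from measurable_compose[OF x_measurable[OF n1] this] show ?thesis unfolding d_def[abs_def] by simp
  qed
  have dint: "integrable M d"
    by (rule Bochner_Integration.integrable_bound[of _ "\<lambda>s. (norm t)\<^sup>2 * (L * norm (x n s - xs))"])
      (use xint dm dle in \<open>auto intro!: AE_I2 order_trans[OF dle abs_ge_self]\<close>)
  have cint: "integrable M (\<lambda>s. cis (t \<bullet> predictable n s) * complex_of_real (d s))" by (rule integrable_cis_mult[OF dint pm])
  have cint0: "integrable M (\<lambda>s. cis (t \<bullet> predictable n s))" by (rule integrable_cis[OF pm])
  have split: "cis (t \<bullet> predictable n s) * complex_of_real (t \<bullet> (\<Sigma> (x n s) *v t))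
      = cis (t \<bullet> predictable n s) * complex_of_real (d s) + complex_of_real (t \<bullet> (\<Sigma> xs *v t)) * cis (t \<bullet> predictable n s)" for s
    by (simp add: d_def algebra_simps)
  have I2: "(\<integral>s. cis (t \<bullet> predictable n s) * complex_of_real (t \<bullet> (\<Sigma> (x n s) *v t)) \<partial>M)
      = (\<integral>s. cis (t \<bullet> predictable n s) * complex_of_real (d s) \<partial>M)
        + complex_of_real (t \<bullet> (\<Sigma> xs *v t)) * (\<integral>s. cis (t \<bullet> predictable n s) \<partial>M)"
    unfolding split using cint cint0 by simp
  have "(\<integral>s. cis (t \<bullet> predictable n s) * complex_of_real ((t \<bullet> grad_noise n s)\<^sup>2) \<partial>M)
      = complex_of_real (\<eta> n) * (\<integral>s. cis (t \<bullet> predictable n s) * complex_of_real ((t \<bullet> xi n s)\<^sup>2) \<partial>M)"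
  proof -
    have "cis (t \<bullet> predictable n s) * complex_of_real ((t \<bullet> grad_noise n s)\<^sup>2)
      = complex_of_real (\<eta> n) * (cis (t \<bullet> predictable n s) * complex_of_real ((t \<bullet> xi n s)\<^sup>2))" for s
      unfolding tN1 by simp
    then show ?thesis by (simp only: integral_mult_right_zero)
  qed
  then have "(\<integral>s. cis (t \<bullet> predictable n s) * complex_of_real ((t \<bullet> grad_noise n s)\<^sup>2) \<partial>M)
      - complex_of_real (\<eta> n * (t \<bullet> (\<Sigma> xs *v t))) * (\<integral>s. cis (t \<bullet> predictable n s) \<partial>M)
     = complex_of_real (\<eta> n) * (\<integral>s. cis (t \<bullet> predictable n s) * complex_of_real (d s) \<partial>M)"
    unfolding I1 I2 by (simp add: algebra_simps)
  also have "cmod \<dots> = \<eta> n * cmod (\<integral>s. cis (t \<bullet> predictable n s) * complex_of_real (d s) \<partial>M)"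
    using e by (simp add: norm_mult)
  also have "\<dots> \<le> \<eta> n * E (\<lambda>s. cmod (cis (t \<bullet> predictable n s) * complex_of_real (d s)))"
    using e by (intro mult_left_mono integral_norm_bound) auto
  also have "\<dots> \<le> \<eta> n * E (\<lambda>s. (norm t)\<^sup>2 * (L * norm (x n s - xs)))"
    using e dint xint dle by (intro mult_left_mono integral_mono) (auto simp: norm_mult)
  finally show ?thesis by simp
qed

text \<open>
  The terms linear in the two noises vanish in the mean by orthogonality; the quadratic term of the gradient noise
  is replaced by its conditional covariance and then by the covariance at \<open>x\<^sup>\<star>\<close>.
\<close>

lemma char_one_step:
  assumes n: "n \<ge> 2" and t: "P *v t = t"
  shows "cmod (\<phi> (Suc n) t
      - \<phi> n (t - \<eta> n *\<^sub>R drift t) * cis (\<eta> n * (t \<bullet> bias)) * (damping n t))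
    \<le> norm t * mean_norm (remainder n) + norm t powr qq * (r n powr qq * \<kappa>\<^sub>2)
      + (norm t)\<^sup>2 * mean_square (reset_noise n) + (norm t)\<^sup>2 * E (\<lambda>s. norm (grad_noise n s) * norm (reset_noise n s))
      + \<eta> n / 2 * ((norm t)\<^sup>2 * (L * E (\<lambda>s. norm (x n s - xs))))"
proof -
  have n1: "n \<ge> 1" using n by simp
  have rn: "r n > 0" by (rule r_pos[OF n1])
  define C where "C s = cis (t \<bullet> predictable n s)" for s
  define y where "y s = t \<bullet> grad_noise n s" for s
  define z where "z s = t \<bullet> reset_noise n s" for s
  define e where "e s = t \<bullet> remainder n s" for s
  have US: "t \<bullet> U (Suc n) s = t \<bullet> predictable n s + y s + z s + e s" for s
    by (simp add: y_def z_def e_def remainder_def inner_simps)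
  have pm: "predictable n \<in> borel_measurable M" using predictable_square[OF n] by (simp add: M.square_integrable_def)
  have Um: "U (Suc n) \<in> borel_measurable M" using U_square[of "Suc n"] n by (simp add: M.square_integrable_def)
  have sq: "M.square_integrable y" "M.square_integrable z"
    unfolding y_def[abs_def] z_def[abs_def]
    by (rule M.square_integrable_dominated[OF grad_noise_square[OF n1], of _ 0 "norm t"]
        M.square_integrable_dominated[OF reset_noise_square[OF n1], of _ 0 "norm t"];
        use grad_noise_square[OF n1] reset_noise_square[OF n1] Cauchy_Schwarz_ineq2 in \<open>auto simp: M.square_integrable_def\<close>)+
  have iy: "integrable M y" "integrable M z" "integrable M (\<lambda>s. (y s)\<^sup>2)"
    using M.square_integrable_imp_integrable[OF sq(1)] M.square_integrable_imp_integrable[OF sq(2)] sq(1)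
    by (simp_all add: M.square_integrable_def)
  have iC: "integrable M C" "integrable M (\<lambda>s. C s * complex_of_real (y s))"
    "integrable M (\<lambda>s. C s * complex_of_real (z s))" "integrable M (\<lambda>s. C s * complex_of_real ((y s)\<^sup>2))"
    unfolding C_def[abs_def] by (intro integrable_cis_mult integrable_cis iy pm)+
  have iN: "integrable M (\<lambda>s. (norm (reset_noise n s))\<^sup>2)" "integrable M (\<lambda>s. norm (grad_noise n s) * norm (reset_noise n s))"
    "integrable M (\<lambda>s. norm (remainder n s))"
  proof -
    show "integrable M (\<lambda>s. (norm (reset_noise n s))\<^sup>2)" using reset_noise_square[OF n1] by (simp add: M.square_integrable_def)
    show "integrable M (\<lambda>s. norm (grad_noise n s) * norm (reset_noise n s))"
      by (rule M.square_integrable_imp_integrable_mult[OF grad_noise_square[OF n1] reset_noise_square[OF n1]])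
        (use grad_noise_square[OF n1] reset_noise_square[OF n1] in \<open>auto simp: M.square_integrable_def intro!: borel_measurable_times\<close>)
    show "integrable M (\<lambda>s. norm (remainder n s))"
      by (rule integrable_norm[OF M.square_integrable_imp_integrable[OF remainder_square[OF n]]])
  qed
  define A where "A s = C s * (1 + \<i> * y s - (y s)\<^sup>2 / 2 + \<i> * z s)" for s
  have A_eq: "A s = C s + \<i> * (C s * complex_of_real (y s)) - (1 / 2) * (C s * complex_of_real ((y s)\<^sup>2)) + \<i> * (C s * complex_of_real (z s))" for s
    by (simp add: A_def algebra_simps)
  have iA: "integrable M A" unfolding A_eq[abs_def] using iC by simp
  have EA: "(\<integral>s. A s \<partial>M) = (\<integral>s. C s \<partial>M) - (1 / 2) * (\<integral>s. C s * complex_of_real ((y s)\<^sup>2) \<partial>M)"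
  proof -
    have lin: "(\<integral>s. f1 s + \<i> * f2 s - (1 / 2) * f3 s + \<i> * f4 s \<partial>M)
        = (\<integral>s. f1 s \<partial>M) + \<i> * (\<integral>s. f2 s \<partial>M) - (1 / 2) * (\<integral>s. f3 s \<partial>M) + \<i> * (\<integral>s. f4 s \<partial>M)"
      if "integrable M f1" "integrable M f2" "integrable M f3" "integrable M f4" for f1 f2 f3 f4 :: "'w \<Rightarrow> complex"
      using that by simp
    have "(\<integral>s. C s * complex_of_real (y s) \<partial>M) = 0" "(\<integral>s. C s * complex_of_real (z s) \<partial>M) = 0"
      unfolding C_def y_def z_def by (rule grad_noise_orthogonal[OF n] reset_noise_orthogonal[OF n])+
    then show ?thesis unfolding A_eq lin[OF iC(1,2,4,3)] by simp
  qed
  have pq: "integrable M (\<lambda>s. norm (xi n s) powr qq)" "E (\<lambda>s. norm (xi n s) powr qq) \<le> \<kappa>\<^sub>2"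
    using xi_moment[OF n1, of qq] qq by auto
  have pt: "cmod (cis (t \<bullet> U (Suc n) s) - A s) \<le> norm t * norm (remainder n s)
      + norm t powr qq * (r n powr qq * norm (xi n s) powr qq) + (norm t)\<^sup>2 * (norm (reset_noise n s))\<^sup>2
      + (norm t)\<^sup>2 * (norm (grad_noise n s) * norm (reset_noise n s))" for s
  proof -
    have "cmod (cis (t \<bullet> U (Suc n) s) - A s) \<le> \<bar>e s\<bar> + \<bar>y s\<bar> powr qq + (z s)\<^sup>2 + \<bar>y s\<bar> * \<bar>z s\<bar>"
      unfolding US A_def C_def using cis_increment_approx[of qq] qq by simp
    also have "\<dots> \<le> norm t * norm (remainder n s) + norm t powr qq * (r n powr qq * norm (xi n s) powr qq)
        + (norm t)\<^sup>2 * (norm (reset_noise n s))\<^sup>2 + (norm t)\<^sup>2 * (norm (grad_noise n s) * norm (reset_noise n s))"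
    proof (intro add_mono)
      show "\<bar>e s\<bar> \<le> norm t * norm (remainder n s)" unfolding e_def by (rule Cauchy_Schwarz_ineq2)
      have zz: "\<bar>z s\<bar> \<le> norm t * norm (reset_noise n s)" and yy: "\<bar>y s\<bar> \<le> norm t * norm (grad_noise n s)"
        unfolding z_def y_def by (rule Cauchy_Schwarz_ineq2)+
      have "\<bar>z s\<bar>\<^sup>2 \<le> (norm t * norm (reset_noise n s))\<^sup>2" using zz by (intro power_mono) auto
      then show "(z s)\<^sup>2 \<le> (norm t)\<^sup>2 * (norm (reset_noise n s))\<^sup>2" by (simp add: power_mult_distrib)
      have "\<bar>y s\<bar> * \<bar>z s\<bar> \<le> (norm t * norm (grad_noise n s)) * (norm t * norm (reset_noise n s))"
        using yy zz by (intro mult_mono) auto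
      then show "\<bar>y s\<bar> * \<bar>z s\<bar> \<le> (norm t)\<^sup>2 * (norm (grad_noise n s) * norm (reset_noise n s))" by (simp add: power2_eq_square mult_ac)
      have "norm (grad_noise n s) \<le> r n * norm (xi n s)" using rn norm_P by (simp add: grad_noise_def)
      then have "\<bar>y s\<bar> \<le> norm t * (r n * norm (xi n s))" using yy by (meson mult_left_mono norm_ge_zero order_trans)
      then have "\<bar>y s\<bar> powr qq \<le> (norm t * (r n * norm (xi n s))) powr qq" using qq by (intro powr_mono2) auto
      also have "\<dots> = norm t powr qq * (r n powr qq * norm (xi n s) powr qq)"
        using rn by (simp add: powr_mult)
      finally show "\<bar>y s\<bar> powr qq \<le> norm t powr qq * (r n powr qq * norm (xi n s) powr qq)" .
    qed
    finally show ?thesis .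
  qed
  have iU: "integrable M (\<lambda>s. cis (t \<bullet> U (Suc n) s))" by (rule integrable_cis[OF Um])
  have step1: "cmod (\<phi> (Suc n) t - (\<integral>s. A s \<partial>M)) \<le> norm t * mean_norm (remainder n) + norm t powr qq * (r n powr qq * \<kappa>\<^sub>2)
      + (norm t)\<^sup>2 * mean_square (reset_noise n) + (norm t)\<^sup>2 * E (\<lambda>s. norm (grad_noise n s) * norm (reset_noise n s))"
  proof -
    have "\<phi> (Suc n) t - (\<integral>s. A s \<partial>M) = (\<integral>s. cis (t \<bullet> U (Suc n) s) - A s \<partial>M)"
      using iU iA by (simp add: \<phi>_def)
    also have "cmod \<dots> \<le> E (\<lambda>s. cmod (cis (t \<bullet> U (Suc n) s) - A s))" by (rule integral_norm_bound)
    also have "\<dots> \<le> E (\<lambda>s. norm t * norm (remainder n s)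
      + norm t powr qq * (r n powr qq * norm (xi n s) powr qq) + (norm t)\<^sup>2 * (norm (reset_noise n s))\<^sup>2
      + (norm t)\<^sup>2 * (norm (grad_noise n s) * norm (reset_noise n s)))"
      using iU iA iN pq(1) by (intro integral_mono pt) auto
    also have "\<dots> = norm t * mean_norm (remainder n) + norm t powr qq * (r n powr qq * E (\<lambda>s. norm (xi n s) powr qq))
      + (norm t)\<^sup>2 * mean_square (reset_noise n) + (norm t)\<^sup>2 * E (\<lambda>s. norm (grad_noise n s) * norm (reset_noise n s))"
      using iN pq(1) by simp
    also have "\<dots> \<le> norm t * mean_norm (remainder n) + norm t powr qq * (r n powr qq * \<kappa>\<^sub>2)
      + (norm t)\<^sup>2 * mean_square (reset_noise n) + (norm t)\<^sup>2 * E (\<lambda>s. norm (grad_noise n s) * norm (reset_noise n s))"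
      using pq(2) by (intro add_mono mult_left_mono order_refl) auto
    finally show ?thesis .
  qed
  define S where "S = complex_of_real (\<eta> n * (t \<bullet> (\<Sigma> xs *v t)))"
  define c where "c = (\<integral>s. C s \<partial>M)"
  define c2 where "c2 = (\<integral>s. C s * complex_of_real ((y s)\<^sup>2) \<partial>M)"
  have cov: "cmod (c2 - S * c) \<le> \<eta> n * ((norm t)\<^sup>2 * (L * E (\<lambda>s. norm (x n s - xs))))"
    using noise_covariance[OF n t] by (simp add: c2_def S_def c_def C_def y_def)
  have target: "\<phi> n (t - \<eta> n *\<^sub>R drift t) * cis (\<eta> n * (t \<bullet> bias)) * (damping n t)
      = c - (1 / 2) * (S * c)"
    using predictable_char[OF n, of t] by (simp add: c_def C_def S_def algebra_simps)
  have "\<phi> (Suc n) t - (c - (1 / 2) * (S * c)) = (\<phi> (Suc n) t - (\<integral>s. A s \<partial>M)) - (1 / 2) * (c2 - S * c)"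
    unfolding EA c_def[symmetric] c2_def[symmetric] by (simp add: field_simps)
  also have "cmod \<dots> \<le> cmod (\<phi> (Suc n) t - (\<integral>s. A s \<partial>M)) + cmod ((1 / 2) * (c2 - S * c))"
    by (rule norm_triangle_ineq4)
  also have "cmod ((1 / 2) * (c2 - S * c)) = cmod (c2 - S * c) / 2" by (simp add: norm_mult)
  finally have "cmod (\<phi> (Suc n) t - (c - (1 / 2) * (S * c))) \<le> cmod (\<phi> (Suc n) t - (\<integral>s. A s \<partial>M)) + cmod (c2 - S * c) / 2" .
  then show ?thesis unfolding target using step1 cov by linarith
qed

end

text \<open>
  The error made when the Gaussian factor \<open>exp (- u)\<close> of one step is replaced by \<open>1 - u\<close>, with a further
  factor \<open>exp (- w)\<close> of second order.
\<close>

lemma exp_times_linear_bound: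
  fixes u w :: real
  assumes u: "0 \<le> u" "u \<le> 1" and w: "0 \<le> w"
  shows "\<bar>1 - exp (u - w) * (1 - u)\<bar> \<le> u\<^sup>2 + w"
proof -
  define y where "y = exp u * (1 - u)"
  have "y \<le> exp u * exp (- u)" unfolding y_def using exp_ge_add_one_self[of "- u"] by (intro mult_left_mono) auto
  then have y1: "y \<le> 1" by (simp add: exp_minus)
  have "(1 + u) * (1 - u) \<le> y" unfolding y_def using u by (intro mult_right_mono) auto
  then have y2: "1 - u\<^sup>2 \<le> y" by (simp add: power2_eq_square algebra_simps)
  have y0: "y \<ge> 0" using u by (simp add: y_def)
  have ew: "1 - w \<le> exp (- w)" "exp (- w) \<le> 1" using exp_ge_add_one_self[of "- w"] w by auto
  have eq: "exp (u - w) * (1 - u) = y * exp (- w)" by (simp add: y_def exp_diff exp_minus field_simps)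
  have "y * exp (- w) \<le> 1 * 1" using y0 y1 ew by (intro mult_mono) auto
  moreover have "y - w \<le> y * exp (- w)"
  proof -
    have "y * (1 - exp (- w)) \<le> 1 * w" using y0 y1 ew by (intro mult_mono) auto
    then show ?thesis by (simp add: algebra_simps)
  qed
  ultimately show ?thesis unfolding eq using y2 by linarith
qed

lemma cmod_cis_minus_1: "cmod (cis t - 1) \<le> \<bar>t\<bar>"
  using iexp_approx1[of t 0] by (simp add: cis_conv_exp)

lemma cmod_cis_diff: "cmod (cis t - cis u) \<le> \<bar>t - u\<bar>"
proof -
  have "cis t - cis u = cis u * (cis (t - u) - 1)" by (simp add: algebra_simps cis_mult)
  then show ?thesis using cmod_cis_minus_1[of "t - u"] by (simp add: norm_mult)
qed

context lpsa_clt
begin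

lemma hess_positive: "\<mu> * (norm y)\<^sup>2 \<le> y \<bullet> (G *v y)"
proof -
  have "((\<lambda>h. gf (xs + h *\<^sub>R y)) has_derivative (\<lambda>h. G *v (h *\<^sub>R y))) (at 0)"
    by (rule has_derivative_compose[where g = gf]) (auto intro!: derivative_eq_intros hess[of xs, simplified])
  then have "((\<lambda>h. gf (xs + h *\<^sub>R y) \<bullet> y) has_derivative (\<lambda>h. (G *v (h *\<^sub>R y)) \<bullet> y)) (at 0)"
    by (rule has_derivative_inner_left)
  then have "((\<lambda>h. gf (xs + h *\<^sub>R y) \<bullet> y) has_real_derivative (G *v y) \<bullet> y) (at 0)"
    by (simp add: has_field_derivative_def matrix_vector_mult_scaleR mult_commute_abs)
  then have "((\<lambda>h. (gf (xs + (0 + h) *\<^sub>R y) \<bullet> y - gf (xs + 0 *\<^sub>R y) \<bullet> y) / h) \<longlongrightarrow> (G *v y) \<bullet> y) (at 0)"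
    unfolding DERIV_def .
  then have "((\<lambda>h. (gf (xs + (0 + h) *\<^sub>R y) \<bullet> y - gf (xs + 0 *\<^sub>R y) \<bullet> y) / h) \<longlongrightarrow> (G *v y) \<bullet> y) (at_right 0)"
    unfolding filterlim_at_split by blast
  then have lim: "((\<lambda>h. (gf (xs + h *\<^sub>R y) \<bullet> y - gs \<bullet> y) / h) \<longlongrightarrow> (G *v y) \<bullet> y) (at_right 0)"
    by simp
  have "\<mu> * (norm y)\<^sup>2 \<le> (G *v y) \<bullet> y"
  proof (rule tendsto_lowerbound[OF lim])
    show "\<forall>\<^sub>F h in at_right 0. \<mu> * (norm y)\<^sup>2 \<le> (gf (xs + h *\<^sub>R y) \<bullet> y - gs \<bullet> y) / h"
      unfolding eventually_at_right_field
    proof (intro exI[of _ 1] conjI allI impI)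
      fix h :: real assume h: "0 < h" "h < 1"
      have "\<mu> * (norm (h *\<^sub>R y))\<^sup>2 \<le> (gf (xs + h *\<^sub>R y) - gs) \<bullet> (h *\<^sub>R y)"
        using monotone[of "xs + h *\<^sub>R y" xs] by simp
      then have "h * (h * (\<mu> * (norm y)\<^sup>2)) \<le> h * (gf (xs + h *\<^sub>R y) \<bullet> y - gs \<bullet> y)"
        using h by (simp add: power_mult_distrib inner_diff_left power2_eq_square mult_ac)
      then have "h * (\<mu> * (norm y)\<^sup>2) \<le> gf (xs + h *\<^sub>R y) \<bullet> y - gs \<bullet> y" using h by simp
      then show "\<mu> * (norm y)\<^sup>2 \<le> (gf (xs + h *\<^sub>R y) \<bullet> y - gs \<bullet> y) / h" using h by (simp add: field_simps)
    qed simp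
  qed simp
  then show ?thesis by (simp add: inner_commute)
qed

lemma e0_bounds: "0 \<le> e0" "e0 \<le> \<mu> / 4"
proof -
  show "0 \<le> e0" using eta0 by (simp add: e0_def)
  show "e0 \<le> \<mu> / 4"
  proof (cases "\<alpha> = 1")
    case True
    then have "2 / \<mu> < \<eta>\<^sub>0" using eta0(2) by simp
    then have "2 < \<eta>\<^sub>0 * \<mu>" using mu by (simp add: field_simps)
    then have "1 / (2 * \<eta>\<^sub>0) \<le> \<mu> / 4" using eta0(1) by (simp add: field_simps)
    moreover have "e0 = 1 / (2 * \<eta>\<^sub>0)" unfolding e0_def using True by simp
    ultimately show ?thesis by simp
  qed (use mu in \<open>simp add: e0_def\<close>)
qed

lemma drift_bounds:
  assumes t: "P *v t = t"
  shows "3 / 4 * \<mu> * (norm t)\<^sup>2 \<le> t \<bullet> drift t" "norm (drift t) \<le> (B + e0) * norm t" "P *v drift t = drift t"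
proof -
  have dr: "drift t = P *v (G *v t) - e0 *\<^sub>R t" by (simp add: drift_def t)
  have "t \<bullet> drift t = t \<bullet> (G *v t) - e0 * (norm t)\<^sup>2"
    using P_inner[of t "G *v t"] by (simp add: dr inner_diff_right t power2_norm_eq_inner)
  moreover have "e0 * (norm t)\<^sup>2 \<le> \<mu> / 4 * (norm t)\<^sup>2" using e0_bounds by (intro mult_right_mono) auto
  ultimately show "3 / 4 * \<mu> * (norm t)\<^sup>2 \<le> t \<bullet> drift t" using hess_positive[of t] by linarith
  have "norm (drift t) \<le> norm (P *v (G *v t)) + norm (e0 *\<^sub>R t)" unfolding dr by (rule norm_triangle_ineq4)
  also have "\<dots> \<le> B * norm t + e0 * norm t" using norm_PG[of t] e0_bounds by (intro add_mono) auto
  finally show "norm (drift t) \<le> (B + e0) * norm t" by (simp add: distrib_right)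
  show "P *v drift t = drift t"
    by (simp add: dr matrix_vector_mult_diff_distrib matrix_vector_mult_scaleR P_idem t)
qed

lemma drift_contraction:
  assumes t: "P *v t = t" and e: "0 < e" "e * (B + e0)\<^sup>2 \<le> \<mu> / 2" "\<mu> / 2 * e \<le> 1"
  shows "norm (t - e *\<^sub>R drift t) \<le> (1 - \<mu> / 2 * e) * norm t"
proof (rule power2_le_imp_le)
  have "(norm (t - e *\<^sub>R drift t))\<^sup>2 = (norm t)\<^sup>2 - 2 * e * (t \<bullet> drift t) + e\<^sup>2 * (norm (drift t))\<^sup>2"
    using norm_add_scaleR_square[of t "- e" "drift t"] by simp
  also have "\<dots> \<le> (norm t)\<^sup>2 - 2 * e * (3 / 4 * \<mu> * (norm t)\<^sup>2) + e\<^sup>2 * ((B + e0) * norm t)\<^sup>2"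
    using drift_bounds[OF t] e(1) by (intro add_mono diff_left_mono mult_left_mono power_mono) auto
  also have "\<dots> = (norm t)\<^sup>2 * (1 - 3 / 2 * \<mu> * e) + e * (norm t)\<^sup>2 * (e * (B + e0)\<^sup>2)"
    by (simp add: power_mult_distrib power2_eq_square algebra_simps)
  also have "\<dots> \<le> (norm t)\<^sup>2 * (1 - 3 / 2 * \<mu> * e) + e * (norm t)\<^sup>2 * (\<mu> / 2)"
    using e by (intro add_left_mono mult_left_mono) auto
  also have "\<dots> = (1 - \<mu> * e) * (norm t)\<^sup>2" by (simp add: algebra_simps)
  also have "\<dots> \<le> (1 - \<mu> / 2 * e)\<^sup>2 * (norm t)\<^sup>2"
    using zero_le_power2[of "\<mu> / 2 * e"] by (intro mult_right_mono) (simp_all add: power2_diff)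
  also have "\<dots> = ((1 - \<mu> / 2 * e) * norm t)\<^sup>2" by (simp add: power_mult_distrib)
  finally show "(norm (t - e *\<^sub>R drift t))\<^sup>2 \<le> ((1 - \<mu> / 2 * e) * norm t)\<^sup>2" .
  show "0 \<le> (1 - \<mu> / 2 * e) * norm t" using e by simp
qed

text \<open>
  All errors carry a factor \<open>norm t\<close> besides a null sequence times \<open>\<eta> n\<close>; this is what the contraction argument
  needs.
\<close>

lemma char_one_step_uniform:
  assumes R: "R \<ge> 1"
  shows "\<exists>\<epsilon> N. \<epsilon> \<longlonglongrightarrow> 0 \<and> (\<forall>n\<ge>N. \<forall>t. P *v t = t \<longrightarrow> norm t \<le> R \<longrightarrow>
    cmod (\<phi> (Suc n) t - \<phi> n (t - \<eta> n *\<^sub>R drift t) * cis (\<eta> n * (t \<bullet> bias))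
        * (damping n t)) \<le> \<epsilon> n * \<eta> n * norm t)"
proof -
  obtain \<delta> N0 where \<delta>: "\<delta> \<longlonglongrightarrow> 0" "\<And>n. n \<ge> N0 \<Longrightarrow> mean_norm (remainder n) \<le> \<eta> n * \<delta> n"
    using remainder_negligible by blast
  obtain C i1 where C: "C \<ge> 0" "\<And>n. n \<ge> i1 \<Longrightarrow> mean_square (reset_noise n) \<le> \<eta> n * (C * r n)"
    using reset_noise_moment by blast
  obtain K1 where K1: "K1 \<ge> 0" and fm: "\<And>n. n \<ge> 1 \<Longrightarrow> mean_norm (a n) \<le> K1 * r n \<and> mean_norm (v n) \<le> K1 * r n"
    using first_moments by blast
  define \<epsilon> where "\<epsilon> n = \<delta> n + R powr (qq - 1) * (\<kappa>\<^sub>2 * r n powr (qq - 2)) + R * (C * r n)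
    + R * (sqrt (r n) * ((\<kappa>\<^sub>2 + C) / 2)) + R * (L * (K1 * r n))" for n
  have "\<epsilon> \<longlonglongrightarrow> 0 + R powr (qq - 1) * (\<kappa>\<^sub>2 * 0) + R * (C * 0) + R * (0 * ((\<kappa>\<^sub>2 + C) / 2)) + R * (L * (K1 * 0))"
    unfolding \<epsilon>_def
  proof (intro tendsto_add tendsto_mult tendsto_const \<delta>(1) r_tendsto)
    show "(\<lambda>n. sqrt (r n)) \<longlonglongrightarrow> 0" using tendsto_real_sqrt[OF r_tendsto] by simp
    have r0: "0 \<le> r n" for n using eta0 by (simp add: r_def eta)
    show "(\<lambda>n. r n powr (qq - 2)) \<longlonglongrightarrow> 0"
      using tendsto_powr'[OF r_tendsto tendsto_const[of "qq - 2"]] qq(1) r0 by auto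
  qed
  then have lim: "\<epsilon> \<longlonglongrightarrow> 0" by simp
  define N where "N = Max {2, N0, i1}"
  have "cmod (\<phi> (Suc n) t - \<phi> n (t - \<eta> n *\<^sub>R drift t) * cis (\<eta> n * (t \<bullet> bias))
        * (damping n t)) \<le> \<epsilon> n * \<eta> n * norm t"
    if n: "n \<ge> N" and t: "P *v t = t" "norm t \<le> R" for n t
  proof -
    have nn: "n \<ge> N0" "n \<ge> i1" "n \<ge> 2" "n \<ge> 1" using n by (auto simp: N_def)
    have e: "\<eta> n > 0" by (rule eta_pos[OF nn(4)])
    have rn: "r n > 0" by (rule r_pos[OF nn(4)])
    define T where "T = norm t"
    have T: "0 \<le> T" "T \<le> R" using t(2) by (auto simp: T_def)
    have TT: "T\<^sup>2 \<le> T * R" using T by (simp add: power2_eq_square mult_left_mono)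
    have b1: "T * mean_norm (remainder n) \<le> T * (\<eta> n * \<delta> n)"
      using \<delta>(2)[OF nn(1)] T by (intro mult_left_mono) auto
    have b2: "T powr qq * (r n powr qq * \<kappa>\<^sub>2) \<le> (T * R powr (qq - 1)) * (\<eta> n * r n powr (qq - 2) * \<kappa>\<^sub>2)"
    proof -
      have "r n powr qq = r n powr 2 * r n powr (qq - 2)" by (simp add: powr_add[symmetric])
      also have "r n powr 2 = \<eta> n" using rn r_square[OF nn(4)] powr_realpow[of "r n" 2] by (simp add: power2_eq_square)
      finally have r: "r n powr qq = \<eta> n * r n powr (qq - 2)" .
      have "T powr qq \<le> T * R powr (qq - 1)"
      proof (cases "T = 0")
        case False
        then have T0: "T > 0" using T by simp
        have "T powr qq = T powr (1 + (qq - 1))" by simp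
        also have "\<dots> = T * T powr (qq - 1)" using T0 by (simp only: powr_add powr_one)
        also have "\<dots> \<le> T * R powr (qq - 1)" using T qq by (intro mult_left_mono powr_mono2) auto
        finally show ?thesis .
      qed simp
      then show ?thesis unfolding r using e kappa2 by (intro mult_right_mono) auto
    qed
    have b3: "T\<^sup>2 * mean_square (reset_noise n) \<le> (T * R) * (\<eta> n * (C * r n))"
      using C(2)[OF nn(2)] TT T by (intro mult_mono) auto
    have b4: "T\<^sup>2 * E (\<lambda>s. norm (grad_noise n s) * norm (reset_noise n s)) \<le> (T * R) * (\<eta> n * (sqrt (r n) * ((\<kappa>\<^sub>2 + C) / 2)))"
    proof (intro mult_mono TT)
      have s1: "M.square_integrable (\<lambda>s. norm (grad_noise n s))" "M.square_integrable (\<lambda>s. norm (reset_noise n s))"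
        using grad_noise_square[OF nn(4)] reset_noise_square[OF nn(4)] by (auto simp: M.square_integrable_def)
      \<comment> \<open>the weight that balances the orders \<open>\<eta> n\<close> and \<open>\<eta> n * r n\<close> of the two variances\<close>
      have sr: "sqrt (r n) > 0" using rn by simp
      have "E (\<lambda>s. norm (grad_noise n s) * norm (reset_noise n s))
          \<le> (sqrt (r n) * mean_square (grad_noise n) + mean_square (reset_noise n) / sqrt (r n)) / 2"
        using M.expectation_mult_le[OF s1 sr] by simp
      also have "\<dots> \<le> (sqrt (r n) * (\<eta> n * \<kappa>\<^sub>2) + (\<eta> n * (C * r n)) / sqrt (r n)) / 2"
        using grad_noise_moment[OF nn(4)] C(2)[OF nn(2)] sr
        by (intro divide_right_mono add_mono mult_left_mono) auto
      also have "(\<eta> n * (C * r n)) / sqrt (r n) = \<eta> n * (C * sqrt (r n))"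
      proof -
        have "r n / sqrt (r n) = sqrt (r n)" using rn by (intro real_div_sqrt) simp
        moreover have "\<eta> n * (C * r n) / sqrt (r n) = \<eta> n * (C * (r n / sqrt (r n)))"
          by (simp only: times_divide_eq_right)
        ultimately show ?thesis by (simp only:)
      qed
      finally show "E (\<lambda>s. norm (grad_noise n s) * norm (reset_noise n s)) \<le> \<eta> n * (sqrt (r n) * ((\<kappa>\<^sub>2 + C) / 2))"
        by (simp add: algebra_simps)
    qed (use T R in auto)
    have b5: "\<eta> n / 2 * (T\<^sup>2 * (L * E (\<lambda>s. norm (x n s - xs)))) \<le> \<eta> n / 2 * ((T * R) * (L * (2 * (K1 * r n))))"
    proof (intro mult_left_mono mult_mono TT)
      have i: "integrable M (\<lambda>s. norm (a n s))" "integrable M (\<lambda>s. norm (v n s))"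
        by (intro integrable_norm M.square_integrable_imp_integrable a_square v_square nn(4))+
      have "integrable M (\<lambda>s. norm (x n s - xs))"
        by (intro integrable_norm M.square_integrable_imp_integrable M.square_integrable_diff
            x_square_integrable nn(4) M.square_integrable_const)
      then have "E (\<lambda>s. norm (x n s - xs)) \<le> E (\<lambda>s. norm (a n s) + norm (v n s))"
        using i by (intro integral_mono) (auto simp: x_decomp intro: norm_triangle_ineq)
      then show "E (\<lambda>s. norm (x n s - xs)) \<le> 2 * (K1 * r n)" using i fm[OF nn(4)] by simp
    qed (use T R L0 e in auto)
    have "T * (\<eta> n * \<delta> n) + (T * R powr (qq - 1)) * (\<eta> n * r n powr (qq - 2) * \<kappa>\<^sub>2) + (T * R) * (\<eta> n * (C * r n))
        + (T * R) * (\<eta> n * (sqrt (r n) * ((\<kappa>\<^sub>2 + C) / 2))) + \<eta> n / 2 * ((T * R) * (L * (2 * (K1 * r n))))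
        = \<epsilon> n * \<eta> n * T"
      unfolding \<epsilon>_def by (simp add: distrib_right distrib_left mult_ac)
    then show ?thesis
      using char_one_step[OF nn(3) t(1)] b1 b2 b3 b4 b5 unfolding T_def by linarith
  qed
  with lim show ?thesis by blast
qed

end

section \<open>Convergence to the Gaussian law\<close>

context lpsa_clt
begin

context
  fixes S :: "real^'d^'d" and m :: "real^'d"
  assumes S: "projected_lyapunov_solution P (G - e0 *\<^sub>R mat 1) (\<Sigma> xs) S"
    and drift_m: "drift m = bias" and P_m: "P *v m = m"
begin

text \<open>
  The characteristic function of the limit law.
\<close>

definition \<psi> :: "real^'d \<Rightarrow> complex" where
  "\<psi> t = cis (t \<bullet> m) * of_real (exp (- (t \<bullet> (S *v t)) / 2))"

lemma S_sym: "transpose S = S" and S_pos: "0 \<le> t \<bullet> (S *v t)" and PS: "P *v (S *v t) = S *v t"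
  using S by (auto simp: projected_lyapunov_solution_def positive_semidefinite_def matrix_vector_mul_assoc)

lemma S_inner: "(S *v y) \<bullet> z = y \<bullet> (S *v z)"
  by (rule inner_matrix_vector_symmetric[OF S_sym])

lemma SP: "S *v (P *v t) = S *v t"
proof -
  have "(S *v (P *v t)) \<bullet> y = (S *v t) \<bullet> y" for y
    by (simp add: S_inner P_inner PS)
  then show ?thesis by (metis vector_eq_ldot inner_commute)
qed

lemma lyapunov_quadratic:
  assumes t: "P *v t = t"
  shows "2 * (drift t \<bullet> (S *v t)) = t \<bullet> (\<Sigma> xs *v t)"
proof -
  define H where "H = G - e0 *\<^sub>R mat 1"
  have Hv: "H *v y = G *v y - e0 *\<^sub>R y" for y
    by (simp add: H_def matrix_vector_mult_diff_rdistrib flip: scaleR_matrix_vector_assoc)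
  have dr: "drift y = P *v (H *v (P *v y))" for y
    by (simp add: drift_def Hv matrix_vector_mult_diff_distrib matrix_vector_mult_scaleR P_idem)
  have "(P ** H ** P) ** S + S ** (P ** H ** P) = P ** \<Sigma> xs ** P"
    using S by (simp add: projected_lyapunov_solution_def H_def)
  then have "((P ** H ** P) ** S + S ** (P ** H ** P)) *v t = (P ** \<Sigma> xs ** P) *v t" by simp
  then have "drift (S *v t) + S *v drift t = P *v (\<Sigma> xs *v t)"
    by (simp add: matrix_vector_mult_add_rdistrib dr t flip: matrix_vector_mul_assoc)
  then have "t \<bullet> drift (S *v t) + t \<bullet> (S *v drift t) = t \<bullet> (P *v (\<Sigma> xs *v t))"
    by (metis inner_add_right)
  moreover have "t \<bullet> (S *v drift t) = drift t \<bullet> (S *v t)" by (metis S_inner inner_commute)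
  moreover have "t \<bullet> (P *v (\<Sigma> xs *v t)) = t \<bullet> (\<Sigma> xs *v t)" using P_inner[of t] t by simp
  ultimately show ?thesis by (simp add: drift_symmetric)
qed

text \<open>
  Under \<open>t \<mapsto> t - \<eta> drift t\<close> the phase of the Gaussian characteristic function changes by exactly the bias,
  because \<open>drift m = bias\<close>, and by the Lyapunov equation its quadratic form changes by \<open>- \<eta> (t \<bullet> \<Sigma> t)\<close> up to
  second order.
\<close>

lemma gaussian_one_step:
  assumes R: "R \<ge> 1"
  shows "\<exists>C N. C \<ge> 0 \<and> (\<forall>n\<ge>N. \<forall>t. P *v t = t \<longrightarrow> norm t \<le> R \<longrightarrow>
    cmod (\<psi> t - \<psi> (t - \<eta> n *\<^sub>R drift t) * cis (\<eta> n * (t \<bullet> bias))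
        * (damping n t)) \<le> (C * \<eta> n) * \<eta> n * norm t
    \<and> cmod (damping n t) \<le> 1)"
proof -
  define D1 where "D1 = 2 * (B + e0) * spectral_norm S"
  define D2 where "D2 = (B + e0)\<^sup>2 * spectral_norm S"
  have Sn: "spectral_norm S \<ge> 0" unfolding spectral_norm_def by (rule onorm_pos_le[OF matrix_vector_mul_bounded_linear])
  have D: "D1 \<ge> 0" "D2 \<ge> 0" using B_nonneg e0_bounds Sn by (auto simp: D1_def D2_def)
  have c: "0 \<le> t \<bullet> (\<Sigma> xs *v t)" "t \<bullet> (\<Sigma> xs *v t) \<le> D1 * (norm t)\<^sup>2"
      "drift t \<bullet> (S *v drift t) \<le> D2 * (norm t)\<^sup>2" if t: "P *v t = t" for t
  proof -
    have "0 \<le> (\<integral>z. (t \<bullet> (gf xs - gF xs z))\<^sup>2 \<partial>D)" by simp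
    then show "0 \<le> t \<bullet> (\<Sigma> xs *v t)" by (simp add: covariance_quadratic)
    have Sv: "norm (S *v y) \<le> spectral_norm S * norm y" for y by (rule norm_matrix_vector_mult_le_spectral_norm)
    note db = drift_bounds(2)[OF t]
    have "drift t \<bullet> (S *v t) \<le> norm (drift t) * norm (S *v t)" by (rule norm_cauchy_schwarz)
    also have "\<dots> \<le> ((B + e0) * norm t) * (spectral_norm S * norm t)"
      using db Sv B_nonneg e0_bounds by (intro mult_mono) auto
    also have "\<dots> = D1 / 2 * (norm t)\<^sup>2" by (simp add: D1_def power2_eq_square)
    finally show "t \<bullet> (\<Sigma> xs *v t) \<le> D1 * (norm t)\<^sup>2"
      using lyapunov_quadratic[OF t] by linarith
    have "drift t \<bullet> (S *v drift t) \<le> norm (drift t) * norm (S *v drift t)" by (rule norm_cauchy_schwarz)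
    also have "\<dots> \<le> norm (drift t) * (spectral_norm S * norm (drift t))" by (intro mult_left_mono Sv) auto
    also have "\<dots> = spectral_norm S * (norm (drift t))\<^sup>2" by (simp add: power2_eq_square)
    also have "\<dots> \<le> spectral_norm S * ((B + e0) * norm t)\<^sup>2" using db Sn by (intro mult_left_mono power_mono) auto
    finally show "drift t \<bullet> (S *v drift t) \<le> D2 * (norm t)\<^sup>2" by (simp add: D2_def power_mult_distrib mult_ac)
  qed
  define C where "C = D1\<^sup>2 * R ^ 3 / 4 + D2 * R / 2"
  have C: "C \<ge> 0" using D R by (simp add: C_def)
  have "\<forall>\<^sub>F n in sequentially. \<eta> n < 1 / (D1 * R\<^sup>2 + 1)"
    by (rule order_tendstoD(2)[OF eta_tendsto]) (use D in \<open>simp add: add_nonneg_pos\<close>)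
  then obtain N where N: "\<And>n. n \<ge> N \<Longrightarrow> \<eta> n < 1 / (D1 * R\<^sup>2 + 1)" unfolding eventually_sequentially by blast
  have main: "cmod (\<psi> t - \<psi> (t - \<eta> n *\<^sub>R drift t) * cis (\<eta> n * (t \<bullet> bias))
        * (damping n t)) \<le> (C * \<eta> n) * \<eta> n * norm t"
    "cmod (damping n t) \<le> 1"
    if n: "n \<ge> max 1 N" and t: "P *v t = t" "norm t \<le> R" for n t
  proof -
    define e where "e = \<eta> n"
    have e: "e > 0" using n eta_pos[of n] by (simp add: e_def)
    define u where "u = e / 2 * (t \<bullet> (\<Sigma> xs *v t))"
    define w where "w = e\<^sup>2 / 2 * (drift t \<bullet> (S *v drift t))"
    have tR: "(norm t)\<^sup>2 \<le> R\<^sup>2" using t(2) by (intro power_mono) auto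
    have "e * (D1 * R\<^sup>2 + 1) < 1"
      using N[of n] n D by (simp add: e_def pos_less_divide_eq add_nonneg_pos)
    then have eD: "e * (D1 * R\<^sup>2) \<le> 1" using e by (simp add: algebra_simps)
    have u0: "0 \<le> u" using c(1)[OF t(1)] e by (simp add: u_def)
    have w0: "0 \<le> w" using S_pos by (simp add: w_def)
    have ule: "u \<le> e / 2 * (D1 * (norm t)\<^sup>2)" unfolding u_def using c(2)[OF t(1)] e by (intro mult_left_mono) auto
    have wle: "w \<le> e\<^sup>2 / 2 * (D2 * (norm t)\<^sup>2)" unfolding w_def using c(3)[OF t(1)] by (intro mult_left_mono) auto
    have "e / 2 * (D1 * (norm t)\<^sup>2) \<le> e / 2 * (D1 * R\<^sup>2)" using tR e D by (intro mult_left_mono) auto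
    then have u1: "u \<le> 1" using ule eD by linarith
    show "cmod (damping n t) \<le> 1"
    proof -
      have "damping n t = complex_of_real (1 - u)" by (simp add: u_def e_def)
      then show ?thesis using u0 u1 by (simp only: norm_of_real)
    qed
    have phase: "(t - e *\<^sub>R drift t) \<bullet> m + e * (t \<bullet> bias) = t \<bullet> m"
      using drift_symmetric[of t m] by (simp add: inner_diff_left drift_m)
    have quad: "(t - e *\<^sub>R drift t) \<bullet> (S *v (t - e *\<^sub>R drift t)) = t \<bullet> (S *v t) - 2 * u + 2 * w"
    proof -
      have "t \<bullet> (S *v drift t) = drift t \<bullet> (S *v t)" by (metis S_inner inner_commute)
      moreover have "2 * (drift t \<bullet> (S *v t)) = t \<bullet> (\<Sigma> xs *v t)" by (rule lyapunov_quadratic[OF t(1)])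
      ultimately show ?thesis
        by (simp add: matrix_vector_mult_diff_distrib matrix_vector_mult_scaleR inner_diff_left inner_diff_right
            u_def w_def power2_eq_square algebra_simps)
    qed
    have "\<psi> (t - e *\<^sub>R drift t) * cis (e * (t \<bullet> bias)) * (1 - complex_of_real u)
        = cis (t \<bullet> m) * complex_of_real (exp (- (t \<bullet> (S *v t)) / 2) * (exp (u - w) * (1 - u)))"
    proof -
      have "cis ((t - e *\<^sub>R drift t) \<bullet> m) * cis (e * (t \<bullet> bias)) = cis (t \<bullet> m)" by (simp add: cis_mult phase)
      moreover have "exp (- ((t - e *\<^sub>R drift t) \<bullet> (S *v (t - e *\<^sub>R drift t))) / 2) = exp (- (t \<bullet> (S *v t)) / 2) * exp (u - w)"
        unfolding quad by (simp add: exp_add[symmetric] field_simps)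
      ultimately show ?thesis unfolding \<psi>_def by (simp add: mult_ac)
    qed
    then have "\<psi> t - \<psi> (t - e *\<^sub>R drift t) * cis (e * (t \<bullet> bias)) * (1 - complex_of_real u)
        = cis (t \<bullet> m) * complex_of_real (exp (- (t \<bullet> (S *v t)) / 2) * (1 - exp (u - w) * (1 - u)))"
      by (simp add: \<psi>_def algebra_simps)
    also have "cmod \<dots> = exp (- (t \<bullet> (S *v t)) / 2) * \<bar>1 - exp (u - w) * (1 - u)\<bar>"
      by (simp only: norm_mult norm_cis norm_of_real abs_mult abs_exp_cancel mult_1)
    also have "\<dots> \<le> 1 * (u\<^sup>2 + w)"
      using S_pos[of t] exp_times_linear_bound[OF u0 u1 w0] by (intro mult_mono) auto
    also have "1 * (u\<^sup>2 + w) \<le> (e / 2 * (D1 * (norm t)\<^sup>2))\<^sup>2 + e\<^sup>2 / 2 * (D2 * (norm t)\<^sup>2)"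
      using power_mono[OF ule u0, of 2] wle by simp
    also have "\<dots> = e\<^sup>2 * norm t * (D1\<^sup>2 * (norm t) ^ 3 / 4 + D2 * norm t / 2)"
      by (simp add: power2_eq_square power3_eq_cube algebra_simps)
    also have "\<dots> \<le> e\<^sup>2 * norm t * C"
      unfolding C_def using D t(2)
      by (intro mult_left_mono add_mono divide_right_mono power_mono) auto
    finally show "cmod (\<psi> t - \<psi> (t - \<eta> n *\<^sub>R drift t) * cis (\<eta> n * (t \<bullet> bias))
        * (damping n t)) \<le> (C * \<eta> n) * \<eta> n * norm t"
      unfolding u_def e_def by (simp add: power2_eq_square mult_ac)
  qed
  show ?thesis by (intro exI[of _ C] exI[of _ "max 1 N"] conjI allI impI C main)
qed

text \<open>
  By induction \<open>cmod (\<phi> n t - \<psi> t) \<le> d n * norm t\<close> on a ball of the constraint space. The vector to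
  which the induction hypothesis is applied is shorter than \<open>t\<close> by the contraction factor, and this factor is
  inherited by \<open>d\<close>.
\<close>

lemma char_tendsto_range:
  assumes t0: "P *v t0 = t0"
  shows "(\<lambda>n. \<phi> n t0) \<longlonglongrightarrow> \<psi> t0"
proof -
  define R where "R = max 1 (norm t0)"
  have R: "R \<ge> 1" "norm t0 \<le> R" by (auto simp: R_def)
  obtain \<epsilon> i1 where \<epsilon>: "\<epsilon> \<longlonglongrightarrow> 0" and step: "\<And>n t. n \<ge> i1 \<Longrightarrow> P *v t = t \<Longrightarrow> norm t \<le> R \<Longrightarrow>
    cmod (\<phi> (Suc n) t - \<phi> n (t - \<eta> n *\<^sub>R drift t) * cis (\<eta> n * (t \<bullet> bias))
        * (damping n t)) \<le> \<epsilon> n * \<eta> n * norm t"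
    using char_one_step_uniform[OF R(1)] by blast
  obtain C i2 where C: "C \<ge> 0" and gstep: "\<And>n t. n \<ge> i2 \<Longrightarrow> P *v t = t \<Longrightarrow> norm t \<le> R \<Longrightarrow>
    cmod (\<psi> t - \<psi> (t - \<eta> n *\<^sub>R drift t) * cis (\<eta> n * (t \<bullet> bias))
        * (damping n t)) \<le> (C * \<eta> n) * \<eta> n * norm t
    \<and> cmod (damping n t) \<le> 1"
    using gaussian_one_step[OF R(1)] by blast
  \<comment> \<open>below this step size one step contracts\<close>
  define b where "b = min (\<mu> / 2 / ((B + e0)\<^sup>2 + 1)) (2 / \<mu>)"
  have b: "b > 0" using mu by (auto simp: b_def add_nonneg_pos)
  obtain i3 where N3: "\<And>n. n \<ge> i3 \<Longrightarrow> \<eta> n < b"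
    using order_tendstoD(2)[OF eta_tendsto b] unfolding eventually_sequentially by blast
  define N where "N = Max {2, i1, i2, i3}"
  have N: "n \<ge> 2" "n \<ge> i1" "n \<ge> i2" "n \<ge> i3" if "n \<ge> N" for n using that by (auto simp: N_def)
  have eta: "0 < \<eta> n" "\<eta> n * (B + e0)\<^sup>2 \<le> \<mu> / 2" "\<mu> / 2 * \<eta> n \<le> 1" if "n \<ge> N" for n
  proof -
    have "n \<ge> 1" using N(1)[OF that] by simp
    then show e: "0 < \<eta> n" by (rule eta_pos)
    have lt: "\<eta> n < \<mu> / 2 / ((B + e0)\<^sup>2 + 1)" "\<eta> n < 2 / \<mu>" using N3[OF N(4)[OF that]] by (auto simp: b_def)
    have "0 < (B + e0)\<^sup>2 + 1" by (simp add: add_nonneg_pos)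
    from lt(1)[unfolded pos_less_divide_eq[OF this]]
    have "\<eta> n * ((B + e0)\<^sup>2 + 1) < \<mu> / 2" .
    then show "\<eta> n * (B + e0)\<^sup>2 \<le> \<mu> / 2" using e by (simp add: algebra_simps)
    show "\<mu> / 2 * \<eta> n \<le> 1" using lt(2) mu by (simp add: field_simps)
  qed
  define \<epsilon>' where "\<epsilon>' n = \<bar>\<epsilon> n\<bar> + C * \<eta> n" for n
  have \<epsilon>': "\<epsilon>' \<longlonglongrightarrow> 0"
    unfolding \<epsilon>'_def using tendsto_add[OF tendsto_rabs[OF \<epsilon>] tendsto_mult[OF tendsto_const[of C] eta_tendsto]] by simp
  define d0 where "d0 = mean_norm (U N) + norm m + R * spectral_norm S"
  have Sn: "spectral_norm S \<ge> 0" unfolding spectral_norm_def by (rule onorm_pos_le[OF matrix_vector_mul_bounded_linear])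
  have d0: "d0 \<ge> 0" using R Sn by (simp add: d0_def)
  \<comment> \<open>a majorant of the supremum of \<open>cmod (\<phi> n t - \<psi> t) / norm t\<close> over the ball\<close>
  \<comment> \<open>of radius \<open>R\<close> in the constraint space, started at time \<open>N\<close>\<close>
  define d where "d = rec_nat d0 (\<lambda>n y. if n < N then d0 else (1 - \<mu> / 2 * \<eta> n) * y + \<epsilon>' n * \<eta> n)"
  have dS: "d (Suc n) = (if n < N then d0 else (1 - \<mu> / 2 * \<eta> n) * d n + \<epsilon>' n * \<eta> n)" for n by (simp add: d_def)
  have dN: "d N = d0" by (cases N) (simp_all add: d_def)
  have dpos: "d n \<ge> 0" for n
  proof (induction n)
    case 0
    then show ?case using d0 by (simp add: d_def)
  next
    case (Suc n)
    show ?case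
    proof (cases "n < N")
      case False
      then have "n \<ge> N" by simp
      then have "0 \<le> \<epsilon>' n" using C eta(1)[of n] by (simp add: \<epsilon>'_def)
      then show ?thesis using Suc.IH eta[OF \<open>n \<ge> N\<close>] False by (simp add: dS)
    qed (use d0 in \<open>simp add: dS\<close>)
  qed
  have d_lim: "d \<longlonglongrightarrow> 0"
  proof (rule recursive_inequality_tendsto_zero[where N = N and c = "\<mu> / 2", OF _ dpos _ _ eta_divergent \<epsilon>'])
    show "n \<ge> N \<Longrightarrow> d (Suc n) \<le> (1 - \<mu> / 2 * \<eta> n) * d n + \<epsilon>' n * \<eta> n" for n by (simp add: dS)
    show "n \<ge> N \<Longrightarrow> 0 \<le> \<eta> n \<and> \<mu> / 2 * \<eta> n \<le> 1" for n using eta[of n] by simp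
  qed (use mu in simp)
  have bound: "\<forall>t. P *v t = t \<longrightarrow> norm t \<le> R \<longrightarrow> cmod (\<phi> n t - \<psi> t) \<le> d n * norm t" if "n \<ge> N" for n
    using that
  proof (induction n rule: nat_induct_at_least)
    case base
    show ?case
    proof (intro allI impI)
      fix t assume t: "P *v t = t" "norm t \<le> R"
      have Um: "M.square_integrable (U N)" by (rule U_square) (use N(1)[of N] in simp)
      have Umeas: "U N \<in> borel_measurable M" using Um by (simp add: M.square_integrable_def)
      have Ui: "integrable M (\<lambda>s. norm (U N s))" by (rule integrable_norm[OF M.square_integrable_imp_integrable[OF Um]])
      have "\<phi> N t - 1 = (\<integral>s. cis (t \<bullet> U N s) - 1 \<partial>M)"
        using integrable_cis[OF Umeas] by (simp add: \<phi>_def M.prob_space)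
      also have "cmod \<dots> \<le> E (\<lambda>s. cmod (cis (t \<bullet> U N s) - 1))" by (rule integral_norm_bound)
      also have "\<dots> \<le> E (\<lambda>s. norm t * norm (U N s))"
        using integrable_cis[OF Umeas] Ui
        by (intro integral_mono order_trans[OF cmod_cis_minus_1] Cauchy_Schwarz_ineq2) auto
      finally have 1: "cmod (\<phi> N t - 1) \<le> norm t * mean_norm (U N)" by simp
      have nc: "cmod (cis (t \<bullet> m) * complex_of_real y) = \<bar>y\<bar>" for y by (simp add: norm_mult)
      have "\<psi> t - 1 = cis (t \<bullet> m) * complex_of_real (exp (- (t \<bullet> (S *v t)) / 2) - 1) + (cis (t \<bullet> m) - 1)"
        by (simp add: \<psi>_def algebra_simps)
      also have "cmod \<dots> \<le> \<bar>exp (- (t \<bullet> (S *v t)) / 2) - 1\<bar> + \<bar>t \<bullet> m\<bar>"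
        by (intro order_trans[OF norm_triangle_ineq] add_mono order_eq_refl nc cmod_cis_minus_1)
      also have "\<bar>exp (- (t \<bullet> (S *v t)) / 2) - 1\<bar> \<le> t \<bullet> (S *v t)"
        using S_pos[of t] exp_ge_add_one_self[of "- (t \<bullet> (S *v t)) / 2"] by (simp add: abs_if)
      also have "t \<bullet> (S *v t) \<le> norm t * (spectral_norm S * norm t)"
        by (rule order_trans[OF norm_cauchy_schwarz mult_left_mono[OF norm_matrix_vector_mult_le_spectral_norm]]) simp
      also have "\<dots> \<le> norm t * (spectral_norm S * R)" using t(2) Sn by (intro mult_left_mono) auto
      also have "\<bar>t \<bullet> m\<bar> \<le> norm t * norm m" by (rule Cauchy_Schwarz_ineq2)
      finally have 2: "cmod (\<psi> t - 1) \<le> norm t * (spectral_norm S * R) + norm t * norm m" by simp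
      have "cmod (\<phi> N t - \<psi> t) \<le> cmod (\<phi> N t - 1) + cmod (\<psi> t - 1)"
        using norm_triangle_ineq4[of "\<phi> N t - 1" "\<psi> t - 1"] by simp
      also have "\<dots> \<le> d0 * norm t" using 1 2 by (simp add: d0_def algebra_simps)
      finally show "cmod (\<phi> N t - \<psi> t) \<le> d N * norm t" by (simp add: dN)
    qed
  next
    case (Suc n)
    show ?case
    proof (intro allI impI)
      fix t assume t: "P *v t = t" "norm t \<le> R"
      note e = eta[OF Suc.hyps]
      define t' where "t' = t - \<eta> n *\<^sub>R drift t"
      have t': "P *v t' = t'"
        by (simp add: t'_def matrix_vector_mult_diff_distrib matrix_vector_mult_scaleR t drift_bounds(3))
      have c: "norm t' \<le> (1 - \<mu> / 2 * \<eta> n) * norm t" unfolding t'_def by (rule drift_contraction[OF t(1) e])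
      also have "\<dots> \<le> 1 * norm t" using e mu by (intro mult_right_mono) auto
      finally have "norm t' \<le> R" using t(2) by simp
      then have IH: "cmod (\<phi> n t' - \<psi> t') \<le> d n * norm t'" using Suc.IH t' by blast
      define k where "k = cis (\<eta> n * (t \<bullet> bias)) * (damping n t)"
      have g: "cmod (\<psi> t - \<psi> t' * k) \<le> (C * \<eta> n) * \<eta> n * norm t" "cmod k \<le> 1"
        using gstep[OF N(3)[OF Suc.hyps] t] by (simp_all add: k_def t'_def norm_mult mult.assoc)
      have s: "cmod (\<phi> (Suc n) t - \<phi> n t' * k) \<le> \<epsilon> n * \<eta> n * norm t"
        using step[OF N(2)[OF Suc.hyps] t] by (simp add: k_def t'_def mult.assoc)
      have "\<phi> (Suc n) t - \<psi> t = (\<phi> (Suc n) t - \<phi> n t' * k) + (\<phi> n t' - \<psi> t') * k - (\<psi> t - \<psi> t' * k)"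
        by (simp add: algebra_simps)
      also have "cmod \<dots> \<le> cmod (\<phi> (Suc n) t - \<phi> n t' * k) + cmod ((\<phi> n t' - \<psi> t') * k) + cmod (\<psi> t - \<psi> t' * k)"
        by (intro order_trans[OF norm_triangle_ineq4] add_mono norm_triangle_ineq order_refl)
      also have "cmod ((\<phi> n t' - \<psi> t') * k) \<le> d n * ((1 - \<mu> / 2 * \<eta> n) * norm t)"
      proof -
        have "cmod ((\<phi> n t' - \<psi> t') * k) \<le> (d n * norm t') * 1"
          unfolding norm_mult using IH g(2) dpos[of n] by (intro mult_mono) auto
        also have "\<dots> \<le> d n * ((1 - \<mu> / 2 * \<eta> n) * norm t)"
          using c dpos[of n] by (simp add: mult_left_mono)
        finally show ?thesis .
      qed
      also have "cmod (\<phi> (Suc n) t - \<phi> n t' * k) \<le> \<bar>\<epsilon> n\<bar> * \<eta> n * norm t"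
        by (rule order_trans[OF s]) (use e(1) in \<open>intro mult_right_mono, auto\<close>)
      also note g(1)
      finally have "cmod (\<phi> (Suc n) t - \<psi> t)
          \<le> \<bar>\<epsilon> n\<bar> * \<eta> n * norm t + d n * ((1 - \<mu> / 2 * \<eta> n) * norm t) + C * \<eta> n * \<eta> n * norm t" by simp
      also have "\<dots> = d (Suc n) * norm t" using Suc.hyps by (simp add: dS \<epsilon>'_def algebra_simps)
      finally show "cmod (\<phi> (Suc n) t - \<psi> t) \<le> d (Suc n) * norm t" .
    qed
  qed
  have "(\<lambda>n. \<phi> n t0 - \<psi> t0) \<longlonglongrightarrow> 0"
  proof (rule Lim_null_comparison)
    show "\<forall>\<^sub>F n in sequentially. cmod (\<phi> n t0 - \<psi> t0) \<le> d n * norm t0"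
      unfolding eventually_sequentially using bound t0 R(2) by blast
    show "(\<lambda>n. d n * norm t0) \<longlonglongrightarrow> 0" using tendsto_mult[OF d_lim tendsto_const[of "norm t0"]] by simp
  qed
  then show ?thesis by (simp add: LIM_zero_iff)
qed

lemma char_tendsto: "(\<lambda>n. \<phi> n t) \<longlonglongrightarrow> \<psi> t"
proof -
  have "t \<bullet> U n s = (P *v t) \<bullet> U n s" for n s by (simp add: P_inner P_U)
  then have "\<phi> n t = \<phi> n (P *v t)" for n by (simp add: \<phi>_def)
  moreover have "\<psi> t = \<psi> (P *v t)"
    by (simp add: \<psi>_def P_inner P_m SP PS)
  moreover have "(\<lambda>n. \<phi> n (P *v t)) \<longlonglongrightarrow> \<psi> (P *v t)" by (rule char_tendsto_range) (rule P_idem)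
  ultimately show ?thesis by simp
qed

text \<open>
  The corrector is of order \<open>\<eta> n\<close> in the mean, hence invisible after division by \<open>sqrt (\<eta> (n - 1))\<close>. The first
  moments bounded along the way give tightness.
\<close>

theorem normalized_error_weakly_converges:
  "weakly_converges (\<lambda>n. distr M borel (\<lambda>s. (1 / sqrt (\<eta> (n - 1))) *\<^sub>R (P *v x n s - xs))) (multivariate_normal m S)"
proof -
  obtain K1 where K1: "K1 \<ge> 0" and fm: "\<And>n. n \<ge> 1 \<Longrightarrow> mean_norm (a n) \<le> K1 * r n \<and> mean_norm (v n) \<le> K1 * r n"
    using first_moments by blast
  obtain N where N: "N \<ge> 2" and small: "\<And>n. n \<ge> N \<Longrightarrow> p n = \<gamma> * r n"
    using reset_probability_threshold by blast
  define X where "X n s = (1 / sqrt (\<eta> (n - 1))) *\<^sub>R (P *v x n s - xs)" for n s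
  have X: "X n s = (1 / r (n - 1)) *\<^sub>R a n s" for n s by (simp add: X_def r_def a_def)
  have Xsq: "M.square_integrable (X n)" if "n \<ge> 1" for n
    unfolding X[abs_def] by (rule M.square_integrable_scaleR[OF a_square[OF that]])
  have Xm: "X n \<in> borel_measurable M" if "n \<ge> 1" for n using Xsq[OF that] by (simp add: M.square_integrable_def)
  have rle: "0 < r n" "0 < r (n - 1)" "r n \<le> r (n - 1)" if "n \<ge> N" for n
  proof -
    have n: "n \<ge> 1" "n - 1 \<ge> 1" "n \<ge> 2" using that N by auto
    show "0 < r n" "0 < r (n - 1)" using r_pos n by auto
    have "\<eta> (Suc (n - 1)) \<le> \<eta> (n - 1)" by (rule eta_decreasing[OF n(2)])
    then show "r n \<le> r (n - 1)" using n by (simp add: r_def)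
  qed
  have norm_X: "mean_norm (X n) \<le> K1" if n: "n \<ge> N" for n
  proof -
    have n1: "n \<ge> 1" using n N by simp
    have "mean_norm (X n) = mean_norm (a n) / r (n - 1)" using rle[OF n] by (simp add: X)
    also have "\<dots> \<le> (K1 * r n) / r (n - 1)" using fm[OF n1] rle[OF n] by (intro divide_right_mono) auto
    also have "\<dots> \<le> K1" using rle[OF n] K1 by (simp add: pos_divide_le_eq mult_left_mono)
    finally show ?thesis .
  qed
  have close: "cmod ((\<integral>s. cis (t \<bullet> X n s) \<partial>M) - \<phi> n t) \<le> norm t * (B * K1 / \<gamma>) * r n" if n: "n \<ge> Suc N" for n t
  proof -
    have nN: "n \<ge> N" "n - 1 \<ge> N" and n1: "n \<ge> 1" "n - 1 \<ge> 1" "n \<ge> 2" using n N by auto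
    have U2: "M.square_integrable (U n)" by (rule U_square[OF n1(3)])
    have Um: "U n \<in> borel_measurable M" using U2 by (simp add: M.square_integrable_def)
    have "p (n - 1) = \<gamma> * r (n - 1)" using small[OF nN(2)] by blast
    then have k: "\<kappa> (n - 1) = r (n - 1) / \<gamma>"
      using rle[OF nN(1)] gamma r_square[OF n1(2), symmetric] by (simp add: \<kappa>_def)
    have diff: "norm (X n s - U n s) \<le> B / \<gamma> * norm (v n s)" for s
    proof -
      have "X n s - U n s = (1 / \<gamma>) *\<^sub>R (P *v (G *v v n s))"
        unfolding X U_def k using rle[OF nN(1)] by (simp add: scaleR_diff_right)
      then show ?thesis using norm_PG[of "v n s"] gamma by (simp add: divide_right_mono)
    qed
    have vi: "integrable M (\<lambda>s. norm (v n s))"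
      by (rule integrable_norm[OF M.square_integrable_imp_integrable[OF v_square[OF n1(1)]]])
    have i: "integrable M (\<lambda>s. cis (t \<bullet> X n s))" "integrable M (\<lambda>s. cis (t \<bullet> U n s))"
      by (rule integrable_cis[OF Xm[OF n1(1)]] integrable_cis[OF Um])+
    have "(\<integral>s. cis (t \<bullet> X n s) \<partial>M) - \<phi> n t = (\<integral>s. cis (t \<bullet> X n s) - cis (t \<bullet> U n s) \<partial>M)"
      using i by (simp add: \<phi>_def)
    also have "cmod \<dots> \<le> E (\<lambda>s. cmod (cis (t \<bullet> X n s) - cis (t \<bullet> U n s)))" by (rule integral_norm_bound)
    also have "\<dots> \<le> E (\<lambda>s. norm t * (B / \<gamma>) * norm (v n s))"
    proof (rule integral_mono)
      show "integrable M (\<lambda>s. cmod (cis (t \<bullet> X n s) - cis (t \<bullet> U n s)))" using i by simp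
      show "integrable M (\<lambda>s. norm t * (B / \<gamma>) * norm (v n s))" using vi by simp
      fix s
      have "cmod (cis (t \<bullet> X n s) - cis (t \<bullet> U n s)) \<le> \<bar>t \<bullet> (X n s - U n s)\<bar>"
        using cmod_cis_diff by (simp add: inner_diff_right)
      also have "\<dots> \<le> norm t * norm (X n s - U n s)" by (rule Cauchy_Schwarz_ineq2)
      also have "\<dots> \<le> norm t * (B / \<gamma> * norm (v n s))" by (intro mult_left_mono diff) auto
      finally show "cmod (cis (t \<bullet> X n s) - cis (t \<bullet> U n s)) \<le> norm t * (B / \<gamma>) * norm (v n s)" by (simp add: mult.assoc)
    qed
    also have "\<dots> = norm t * (B / \<gamma>) * mean_norm (v n)" by simp
    also have "\<dots> \<le> norm t * (B / \<gamma>) * (K1 * r n)"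
      using fm[OF n1(1)] B_nonneg gamma by (intro mult_left_mono) auto
    finally show ?thesis by (simp add: mult_ac)
  qed
  have char_X: "(\<lambda>n. \<integral>s. cis (t \<bullet> X n s) \<partial>M) \<longlonglongrightarrow> \<psi> t" for t
  proof -
    have "(\<lambda>n. (\<integral>s. cis (t \<bullet> X n s) \<partial>M) - \<phi> n t) \<longlonglongrightarrow> 0"
    proof (rule Lim_null_comparison)
      show "\<forall>\<^sub>F n in sequentially. cmod ((\<integral>s. cis (t \<bullet> X n s) \<partial>M) - \<phi> n t) \<le> norm t * (B * K1 / \<gamma>) * r n"
        unfolding eventually_sequentially using close by blast
      show "(\<lambda>n. norm t * (B * K1 / \<gamma>) * r n) \<longlonglongrightarrow> 0"
        using tendsto_mult[OF tendsto_const[of "norm t * (B * K1 / \<gamma>)"] r_tendsto] by simp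
    qed
    from tendsto_add[OF this char_tendsto[of t]] show ?thesis by simp
  qed
  have psd: "positive_semidefinite S" using S by (simp add: projected_lyapunov_solution_def)
  note normal = char_multivariate_normal[OF psd, of m]
  have "weakly_converges (\<lambda>n. distr M borel (X (n + N))) (multivariate_normal m S)"
  proof (rule weakly_convergesI_characteristic_function[where K = K1 and ?n0.0 = 0])
    fix n
    have nN: "n + N \<ge> N" "n + N \<ge> 1" using N by auto
    show "prob_space (distr M borel (X (n + N)))" by (rule M.prob_space_distr[OF Xm[OF nN(2)]])
    show "sets (distr M borel (X (n + N))) = sets borel" by simp
    show "integrable (distr M borel (X (n + N))) norm"
      using M.square_integrable_imp_integrable[OF Xsq[OF nN(2)]]
      by (subst integrable_distr_eq[OF Xm[OF nN(2)]]) auto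
    show "(\<integral>y. norm y \<partial>distr M borel (X (n + N))) \<le> K1"
      using norm_X[OF nN(1)] by (subst integral_distr[OF Xm[OF nN(2)]]) auto
  next
    show "prob_space (multivariate_normal m S)" "sets (multivariate_normal m S) = sets borel" by (rule normal)+
    fix t
    have "(\<integral>y. cis (t \<bullet> y) \<partial>distr M borel (X (n + N))) = (\<integral>s. cis (t \<bullet> X (n + N) s) \<partial>M)" for n
      by (rule integral_distr[OF Xm]) (use N in auto)
    then show "(\<lambda>n. \<integral>y. cis (t \<bullet> y) \<partial>distr M borel (X (n + N))) \<longlonglongrightarrow> (\<integral>y. cis (t \<bullet> y) \<partial>multivariate_normal m S)"
      unfolding normal(3) using LIMSEQ_ignore_initial_segment[OF char_X[of t], of N] by (simp add: \<psi>_def)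
  qed
  then have "weakly_converges (\<lambda>n. distr M borel (X n)) (multivariate_normal m S)"
    unfolding weakly_converges_def by (blast intro: LIMSEQ_offset[of _ N])
  then show ?thesis by (simp add: X_def[abs_def])
qed

end

end

section \<open>From the assumptions to the limit theorem\<close>

text \<open>
  The first-order inequality with its quadratic term, obtained by letting the convex combination tend to one of its
  end points, is applied at both points and added.
\<close>

lemma strongly_convex_imp_strongly_monotone:
  fixes f :: "real^'d \<Rightarrow> real"
  assumes conv: "strongly_convex \<mu> f" and gf: "\<And>x. GDERIV f x :> gf x"
  shows "\<mu> * (norm (x - y))\<^sup>2 \<le> (gf x - gf y) \<bullet> (x - y)"
proof -
  have first_order: "f x + gf x \<bullet> (y - x) + \<mu> / 2 * (norm (x - y))\<^sup>2 \<le> f y" for x y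
  proof -
    have "(f has_derivative (\<lambda>h. h \<bullet> gf x)) (at (x + 0 *\<^sub>R (y - x)))" using gf by (simp add: gderiv_def)
    then have "((\<lambda>t. f (x + t *\<^sub>R (y - x))) has_derivative (\<lambda>t. (t *\<^sub>R (y - x)) \<bullet> gf x)) (at 0)"
      by (rule has_derivative_compose[rotated]) (auto intro!: derivative_eq_intros)
    then have "((\<lambda>t. f (x + t *\<^sub>R (y - x))) has_real_derivative gf x \<bullet> (y - x)) (at 0)"
      by (simp add: has_field_derivative_def inner_commute mult_commute_abs)
    then have "((\<lambda>h. (f (x + (0 + h) *\<^sub>R (y - x)) - f (x + 0 *\<^sub>R (y - x))) / h) \<longlongrightarrow> gf x \<bullet> (y - x)) (at_right 0)"
      unfolding DERIV_def filterlim_at_split by blast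
    then have lim: "((\<lambda>h. (f (x + h *\<^sub>R (y - x)) - f x) / h + \<mu> / 2 * (1 - h) * (norm (x - y))\<^sup>2)
        \<longlongrightarrow> gf x \<bullet> (y - x) + \<mu> / 2 * (1 - 0) * (norm (x - y))\<^sup>2) (at_right 0)"
      by (intro tendsto_intros) simp
    have "gf x \<bullet> (y - x) + \<mu> / 2 * (1 - 0) * (norm (x - y))\<^sup>2 \<le> f y - f x"
    proof (rule tendsto_upperbound[OF lim])
      show "\<forall>\<^sub>F h in at_right 0. (f (x + h *\<^sub>R (y - x)) - f x) / h + \<mu> / 2 * (1 - h) * (norm (x - y))\<^sup>2 \<le> f y - f x"
        unfolding eventually_at_right_field
      proof (intro exI[of _ 1] conjI allI impI)
        fix h :: real assume h: "0 < h" "h < 1"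
        have "x + h *\<^sub>R (y - x) = (1 - h) *\<^sub>R x + h *\<^sub>R y" by (simp add: algebra_simps)
        then have "f (x + h *\<^sub>R (y - x)) \<le> (1 - h) * f x + h * f y - \<mu> / 2 * h * (1 - h) * (norm (x - y))\<^sup>2"
          using conv h unfolding strongly_convex_def by simp
        then have "f (x + h *\<^sub>R (y - x)) - f x \<le> h * (f y - f x - \<mu> / 2 * (1 - h) * (norm (x - y))\<^sup>2)"
          by (simp add: algebra_simps)
        then have "(f (x + h *\<^sub>R (y - x)) - f x) / h \<le> f y - f x - \<mu> / 2 * (1 - h) * (norm (x - y))\<^sup>2"
          using h by (simp add: pos_divide_le_eq mult.commute)
        then show "(f (x + h *\<^sub>R (y - x)) - f x) / h + \<mu> / 2 * (1 - h) * (norm (x - y))\<^sup>2 \<le> f y - f x" by simp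
      qed simp
    qed simp
    then show ?thesis by simp
  qed
  from first_order[of x y] first_order[of y x] show ?thesis
    by (simp add: inner_diff_left inner_diff_right norm_minus_commute)
qed

lemma gradient_orthogonal_at_constrained_minimizer:
  fixes f :: "real^'d \<Rightarrow> real"
  assumes min: "is_arg_min f (\<lambda>y. T *v y = 0) xs" and gf: "GDERIV f xs :> g" and h: "T *v h = 0"
  shows "g \<bullet> h = 0"
proof -
  have "(f has_derivative (\<lambda>h. h \<bullet> g)) (at (xs + 0 *\<^sub>R h))" using gf by (simp add: gderiv_def)
  then have "((\<lambda>t. f (xs + t *\<^sub>R h)) has_derivative (\<lambda>t. (t *\<^sub>R h) \<bullet> g)) (at 0)"
    by (rule has_derivative_compose[rotated]) (auto intro!: derivative_eq_intros)
  then have der: "((\<lambda>t. f (xs + t *\<^sub>R h)) has_real_derivative g \<bullet> h) (at 0)"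
    by (simp add: has_field_derivative_def inner_commute mult_commute_abs)
  have le: "f xs \<le> f (xs + t *\<^sub>R h)" for t
  proof -
    have "T *v (xs + t *\<^sub>R h) = 0"
      using min h by (simp add: is_arg_min_def matrix_vector_right_distrib matrix_vector_mult_scaleR)
    then show ?thesis using min by (auto simp: is_arg_min_def not_less)
  qed
  show ?thesis
    by (rule DERIV_local_min[OF der, of 1]) (use le in auto)
qed

text \<open>
  With \<open>N = P H P + (I - P)\<close> invertible, \<open>P N\<^sup>-\<^sup>1\<close> satisfies the Penrose conditions: it inverts \<open>P H P\<close> on
  the range of \<open>P\<close> and vanishes on its complement.
\<close>

lemma pseudoinverse_of_compression:
  fixes P H :: "real^'n^'n"
  assumes P: "transpose P = P" "P ** P = P"
    and c: "c > 0" and pos: "\<And>v. P *v v = v \<Longrightarrow> v \<bullet> (H *v v) \<ge> c * (v \<bullet> v)"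
  defines "M \<equiv> P ** H ** P"
  shows "M ** pseudoinverse M = P" "P ** pseudoinverse M = pseudoinverse M"
proof -
  define Q where "Q = mat 1 - P"
  define N where "N = M + Q"
  have PQ: "P ** Q = 0" "Q ** P = 0"
    by (simp_all add: Q_def matrix_sub_ldistrib matrix_sub_rdistrib P(2))
  have PM: "P ** M = M" "M ** P = M"
    by (simp_all add: M_def P(2) matrix_mul_assoc) (simp add: P(2) flip: matrix_mul_assoc)
  have PN: "P ** N = M" "N ** P = M"
    by (simp_all add: N_def matrix_add_ldistrib matrix_add_rdistrib PM PQ)
  have Pin: "(P *v y) \<bullet> z = y \<bullet> (P *v z)" for y z by (rule inner_matrix_vector_symmetric[OF P(1)])
  have ker: "v = 0" if "N *v v = 0" for v
  proof -
    have "M *v v = 0"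
      by (metis PN(1) that matrix_vector_mul_assoc matrix_vector_mult_0_right)
    then have Q0: "Q *v v = 0" using that by (simp add: N_def matrix_vector_mult_add_rdistrib)
    then have Pv: "P *v v = v" by (simp add: Q_def matrix_vector_mult_diff_rdistrib)
    have "0 = v \<bullet> (M *v v)" using \<open>M *v v = 0\<close> by simp
    also have "\<dots> = v \<bullet> (H *v v)"
      by (simp add: M_def Pv flip: matrix_vector_mul_assoc) (simp add: Pv flip: Pin)
    finally have "c * (v \<bullet> v) \<le> 0" using pos[OF Pv] by simp
    then have "v \<bullet> v \<le> 0" using c by (simp add: mult_le_0_iff)
    then show ?thesis by (metis inner_eq_zero_iff inner_ge_zero order_antisym)
  qed
  have "inj ((*v) N)"
    by (subst linear_injective_0[OF matrix_vector_mul_linear]) (use ker in blast)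
  then obtain N' where N': "N' ** N = mat 1" using matrix_left_invertible_injective by blast
  then have N'2: "N ** N' = mat 1" by (simp add: matrix_left_right_inverse)
  define X where "X = P ** N'"
  have MX: "M ** X = P"
  proof -
    have "M ** X = M ** N'" by (simp add: X_def matrix_mul_assoc PM)
    also have "\<dots> = P ** (N ** N')" by (simp add: matrix_mul_assoc PN)
    finally show ?thesis by (simp add: N'2)
  qed
  have XM: "X ** M = P"
  proof -
    have comm: "N' ** P = P ** N'"
    proof -
      have "N' ** P = N' ** (P ** (N ** N'))" by (simp add: N'2)
      also have "\<dots> = (N' ** N) ** P ** N'" by (simp add: matrix_mul_assoc PN) (simp add: PN flip: matrix_mul_assoc)
      finally show ?thesis by (simp add: N')
    qed
    have "X ** M = (P ** N') ** (N ** P)" by (simp add: X_def PN)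
    also have "\<dots> = P ** (N' ** N) ** P" by (simp add: matrix_mul_assoc)
    finally show ?thesis by (simp add: N' P(2))
  qed
  have PX: "P ** X = X" by (simp add: X_def matrix_mul_assoc P(2))
  have "is_pseudoinverse M X"
    unfolding is_pseudoinverse_def by (simp add: MX XM PM PX P(1))
  then have "pseudoinverse M = X"
    unfolding pseudoinverse_def by (intro the_equality is_pseudoinverse_unique)
  then show "M ** pseudoinverse M = P" "P ** pseudoinverse M = pseudoinverse M" using MX PX by simp_all
qed

lemma lipschitz_constant_nonneg:
  fixes g :: "real^'d \<Rightarrow> real^'d \<Rightarrow> real"
  assumes "\<And>y z. g y z \<le> K * norm (y - z)" "\<And>y z. 0 \<le> g y z"
  shows "K \<ge> 0"
proof -
  define y where "y = (axis undefined 1 :: real^'d)"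
  have "0 \<le> K * norm (y - 0)" using assms order_trans by blast
  then show ?thesis by (simp add: y_def)
qed

theorem theorem3p6:
  fixes A :: "real^'k^'d"
    and D :: "'z measure" and M :: "'w measure"
    and F :: "real^'d \<Rightarrow> 'z \<Rightarrow> real" and gF :: "real^'d \<Rightarrow> 'z \<Rightarrow> real^'d"
    and f :: "real^'d \<Rightarrow> real" and gf :: "real^'d \<Rightarrow> real^'d" and hess :: "real^'d \<Rightarrow> real^'d^'d"
    and \<zeta> :: "nat \<Rightarrow> 'w \<Rightarrow> 'z" and \<omega> :: "nat \<Rightarrow> 'w \<Rightarrow> bool"
    and x :: "nat \<Rightarrow> 'w \<Rightarrow> real^'d" and x1 xstar m :: "real^'d"
    and P H :: "real^'d^'d" and \<Sigma> :: "real^'d \<Rightarrow> real^'d^'d"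
    and \<eta> p :: "nat \<Rightarrow> real"
    and \<eta>\<^sub>0 \<alpha> \<gamma> \<mu> L L' q :: real
  assumes D: "prob_space D" and M: "prob_space M"
    and P: "P = range_perp_projection A"
    \<comment> \<open>objective, gradients, Hessian, gradient covariance\<close>
    and F: "\<And>x. integrable D (F x)" "\<And>x. f x = (\<integral>z. F x z \<partial>D)"
    and gF: "\<And>x z. z \<in> space D \<Longrightarrow> GDERIV (\<lambda>y. F y z) x :> gF x z"
    and gf: "\<And>x. GDERIV f x :> gf x"
    and unbiased: "\<And>x. integrable D (gF x)" "\<And>x. (\<integral>z. gF x z \<partial>D) = gf x"
    and hess: "\<And>x. (gf has_derivative (\<lambda>h. hess x *v h)) (at x)"
    and square_integrable: "\<And>x. integrable D (\<lambda>z. (norm (gF x z))\<^sup>2)"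
    and Sigma: "\<And>x. \<Sigma> x = covariance_matrix D (gF x)"
    \<comment> \<open>the unique constrained minimizer\<close>
    and xstar: "is_arg_min f (\<lambda>y. transpose A *v y = 0) xstar"
      "\<And>y. is_arg_min f (\<lambda>y. transpose A *v y = 0) y \<Longrightarrow> y = xstar"
    \<comment> \<open>parameters\<close>
    and eta: "\<And>n. \<eta> n = \<eta>\<^sub>0 * real n powr (- \<alpha>)"
    and p: "\<And>n. p n = min (\<gamma> * \<eta> n powr (1/2)) 1"
    and "\<gamma> > 0" "0 < \<alpha>" "\<alpha> \<le> 1" "\<eta>\<^sub>0 > 0" "\<eta>\<^sub>0 > 2 * of_bool (\<alpha> = 1) / \<mu>"
    \<comment> \<open>the iterates\<close>
    and samples: "lpsa_samples M D p \<zeta> \<omega>"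
    and iterates: "lpsa_iterates M P gF \<eta> \<zeta> \<omega> x1 x"
    \<comment> \<open>assumptions (1)--(5)\<close>
    and smooth: "\<And>x y. norm (gf x - gf y) \<le> L * norm (x - y)"
    and convex: "\<mu> > 0" "strongly_convex \<mu> f"
    and hess_lipschitz: "\<And>x y. spectral_norm (hess x - hess y) \<le> L' * norm (x - y)"
    and Sigma_lipschitz: "\<And>x y. spectral_norm (\<Sigma> x - \<Sigma> y) \<le> L * norm (x - y)"
    and noise: "q > 2"
      "(SUP n\<in>{1..}. \<integral>\<^sup>+ s. ennreal (norm (gf (x n s) - gF (x n s) (\<zeta> n s)) powr q) \<partial>M) < \<infinity>"
    and H: "H = hess xstar - (of_bool (\<alpha> = 1) / (2 * \<eta>\<^sub>0)) *\<^sub>R mat 1"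
    and m: "m = (1 / \<gamma>) *\<^sub>R (pseudoinverse (P ** H ** P) *v (P *v (hess xstar *v gf xstar)))"
    and m_nonzero: "m \<noteq> 0"
  shows "(\<exists>!S. projected_lyapunov_solution P H (\<Sigma> xstar) S) \<and>
    (\<forall>S. projected_lyapunov_solution P H (\<Sigma> xstar) S \<longrightarrow>
      weakly_converges
        (\<lambda>n. distr M borel (\<lambda>s. (1 / sqrt (\<eta> (n - 1))) *\<^sub>R (P *v x n s - xstar)))
        (multivariate_normal m S))"
proof -
  define \<kappa>\<^sub>q where "\<kappa>\<^sub>q = enn2real (SUP n\<in>{1..}. \<integral>\<^sup>+ s. ennreal (norm (gf (x n s) - gF (x n s) (\<zeta> n s)) powr q) \<partial>M)"
  have sym: "transpose P = P" and idem: "\<And>y. P *v (P *v y) = P *v y"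
    and fixes_iff: "\<And>y. P *v y = y \<longleftrightarrow> transpose A *v y = 0"
    unfolding P by (rule range_perp_projection_symmetric range_perp_projection_idempotent range_perp_projection_fixes_iff)+
  have PP: "P ** P = P" by (simp add: matrix_eq idem flip: matrix_vector_mul_assoc)
  have L: "L \<ge> 0" by (rule lipschitz_constant_nonneg[OF smooth]) simp
  have L': "L' \<ge> 0"
    by (rule lipschitz_constant_nonneg[OF hess_lipschitz])
      (simp add: spectral_norm_def onorm_pos_le matrix_vector_mul_bounded_linear)
  have Pg: "P *v gf xstar = 0"
  proof -
    have "(P *v gf xstar) \<bullet> y = 0" for y
    proof -
      have "transpose A *v (P *v y) = 0" using fixes_iff idem by blast
      from gradient_orthogonal_at_constrained_minimizer[OF xstar(1) gf this]
      show ?thesis by (simp add: inner_matrix_vector_symmetric[OF sym])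
    qed
    then show ?thesis by (metis inner_eq_zero_iff)
  qed
  interpret step_sizes \<eta> p \<eta>\<^sub>0 \<alpha> \<gamma> \<mu>
    using assms by unfold_locales
  interpret lpsa_clt D M P gF \<eta> p \<zeta> \<omega> x1 x \<eta>\<^sub>0 \<alpha> \<gamma> \<mu> gf hess \<Sigma> xstar L L' q \<kappa>\<^sub>q
  proof (intro lpsa_clt.intro lpsa_chain.intro lpsa_chain_axioms.intro lpsa_clt_axioms.intro)
    show "prob_space D" "prob_space M" by fact+
    show "(\<lambda>(y, z). gF y z) \<in> borel_measurable (borel \<Otimes>\<^sub>M D)"
      by (rule borel_measurable_gradient[OF _ gF]) (use F(1) in auto)
    show "lpsa_samples M D p \<zeta> \<omega>" "lpsa_iterates M P gF \<eta> \<zeta> \<omega> x1 x" by fact+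
    show "0 \<le> p n \<and> p n \<le> 1" if "n \<ge> 1" for n using p_bounds(1)[OF that] p_bounds(2)[of n] by simp
    show "step_sizes \<eta> p \<eta>\<^sub>0 \<alpha> \<gamma> \<mu>" by unfold_locales
    show "P *v xstar = xstar" using xstar(1) by (simp add: fixes_iff is_arg_min_def)
    show "transpose (hess xstar) = hess xstar" by (rule lipschitz_hessian_symmetric[OF gf hess hess_lipschitz L'])
    show "\<mu> * (norm (y - z))\<^sup>2 \<le> (gf y - gf z) \<bullet> (y - z)" for y z
      by (rule strongly_convex_imp_strongly_monotone[OF convex(2) gf])
    show "\<kappa>\<^sub>q \<ge> 0" by (simp add: \<kappa>\<^sub>q_def)
    fix n :: nat assume "n \<ge> 1"
    then have "(\<integral>\<^sup>+ s. ennreal (norm (gf (x n s) - gF (x n s) (\<zeta> n s)) powr q) \<partial>M)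
      \<le> (SUP n\<in>{1..}. \<integral>\<^sup>+ s. ennreal (norm (gf (x n s) - gF (x n s) (\<zeta> n s)) powr q) \<partial>M)"
      by (intro SUP_upper) simp
    then show "(\<integral>\<^sup>+ s. ennreal (norm (gf (x n s) - gF (x n s) (\<zeta> n s)) powr q) \<partial>M) \<le> ennreal \<kappa>\<^sub>q"
      using noise(2) by (simp add: \<kappa>\<^sub>q_def)
  qed (fact sym idem Pg unbiased square_integrable Sigma smooth L hess hess_lipschitz L' Sigma_lipschitz noise(1))+
  have H': "H = hess xstar - e0 *\<^sub>R mat 1" by (simp add: H e0_def)
  have Hv: "H *v y = hess xstar *v y - e0 *\<^sub>R y" for y
    by (simp add: H' matrix_vector_mult_diff_rdistrib flip: scaleR_matrix_vector_assoc)
  have Hsym: "transpose H = H"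
    by (rule transpose_eqI_inner) (simp add: Hv inner_diff_left inner_diff_right G_inner)
  have Hpos: "\<mu> / 2 * (y \<bullet> y) \<le> y \<bullet> (H *v y)" for y
  proof -
    have "e0 * (y \<bullet> y) \<le> \<mu> / 4 * (y \<bullet> y)" using e0_bounds by (intro mult_right_mono) auto
    moreover have "0 \<le> \<mu> * (y \<bullet> y)" using convex(1) by simp
    ultimately show ?thesis
      using hess_positive[of y] by (simp add: Hv inner_diff_right power2_norm_eq_inner)
  qed
  have mu2: "\<mu> / 2 > 0" using convex(1) by simp
  have psd: "positive_semidefinite (\<Sigma> xstar)"
    unfolding positive_semidefinite_def
  proof (intro conjI allI)
    show "transpose (\<Sigma> xstar) = \<Sigma> xstar"
      by (simp add: Sigma covariance_matrix_def transpose_def vec_eq_iff mult.commute)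
    have "0 \<le> (\<integral>z. (t \<bullet> (gf xstar - gF xstar z))\<^sup>2 \<partial>D)" for t by simp
    then show "0 \<le> t \<bullet> (\<Sigma> xstar *v t)" for t by (simp only: covariance_quadratic)
  qed
  have ex: "\<exists>!S. projected_lyapunov_solution P H (\<Sigma> xstar) S"
    by (rule projected_lyapunov_solution_exists_unique[OF sym PP Hsym mu2 _ psd]) (rule Hpos)
  note pinv = pseudoinverse_of_compression[OF sym PP mu2 Hpos]
  define X where "X = pseudoinverse (P ** H ** P)"
  have m_eq: "m = (1 / \<gamma>) *\<^sub>R (X *v (P *v (hess xstar *v gf xstar)))" by (simp add: m X_def)
  have PX: "P *v (X *v y) = X *v y" for y
    using pinv(2) by (simp add: X_def matrix_vector_mul_assoc)
  have MX: "P *v (H *v (P *v (X *v y))) = P *v y" for y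
    using pinv(1) by (simp only: X_def matrix_vector_mul_assoc matrix_mul_assoc)
  have Pm: "P *v m = m" by (simp add: m_eq matrix_vector_mult_scaleR PX)
  have "drift m = P *v (H *v (P *v m))"
    by (simp add: drift_def Hv matrix_vector_mult_diff_distrib matrix_vector_mult_scaleR idem)
  also have "\<dots> = bias"
    by (simp add: m_eq bias_def matrix_vector_mult_scaleR MX idem)
  finally have dm: "drift m = bias" .
  show ?thesis
  proof (intro conjI ex allI impI)
    fix S assume "projected_lyapunov_solution P H (\<Sigma> xstar) S"
    then have "projected_lyapunov_solution P (hess xstar - e0 *\<^sub>R mat 1) (\<Sigma> xstar) S" by (simp add: H')
    from normalized_error_weakly_converges[OF this dm Pm]
    show "weakly_converges
        (\<lambda>n. distr M borel (\<lambda>s. (1 / sqrt (\<eta> (n - 1))) *\<^sub>R (P *v x n s - xstar)))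
        (multivariate_normal m S)" .
  qed
qed

end
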